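(* Let $a_n = p_n$ be the $n$-th prime. Let $(\eta(N))_{N \geq 1}$ be a strictly decreasing sequence of non-negative reals such that $\eta(2N)/\eta(N) \geq c_0$ for all $N$, for some constant $c_0 > 0$. Let $\mathcal{A}$ be the set of those $\alpha \in [0,1]$ for which $$\delta_{\min}^{\alpha}(N) \leq \eta(N \log N)$$ holds for infinitely many $N$. Then $\lambda(\mathcal{A}) = 0$ or $\lambda(\mathcal{A}) = 1$, according to whether the series $\sum_{N=1}^{\infty} \eta(N)$ is convergent or divergent, respectively.
   Context: $\lambda$ denotes Lebesgue measure. For $\alpha \in [0,1]$ and $N \geq 2$, $\delta_{\min}^{\alpha}(N) = \min\{\|(a_m - a_n)\alpha\| : 1 \leq m,n \leq N,\ m \neq n\}$, where $\|x\|$ is the distance from $x$ to the nearest integer. Here $\log x$ means $\max\{1,\log x\}$. The paper writes the hypothesis as $\eta(2N)/\eta(N) \gg 1$. *)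

theory Defs
  imports "HOL-Analysis.Analysis" "HOL-Computational_Algebra.Primes" "HOL-Library.Infinite_Set"
begin

text \<open>The n-th prime, 1-indexed: nth_prime 1 = 2, nth_prime 2 = 3, ...\<close>
definition nth_prime :: "nat \<Rightarrow> nat" where
  "nth_prime n = enumerate {p::nat. prime p} (n - 1)"

definition dist_int :: "real \<Rightarrow> real" where
  "dist_int x = \<bar>x - real_of_int (round x)\<bar>"

text \<open>The paper's convention: log x = max 1 (ln x).\<close>
definition logm :: "real \<Rightarrow> real" where
  "logm x = max 1 (ln x)"

definition delta_min :: "real \<Rightarrow> nat \<Rightarrow> real" where
  "delta_min \<alpha> N = Min {dist_int ((real (nth_prime m) - real (nth_prime n)) * \<alpha>) | m n.
      1 \<le> m \<and> m \<le> N \<and> 1 \<le> n \<and> n \<le> N \<and> m \<noteq> n}"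

end

theory Submission
  imports Defs "HOL-Number_Theory.Cong" "HOL-Computational_Algebra.Squarefree"
begin

text \<open>
  The number \<open>\<delta>(N)\<close> is the minimum of \<open>\<parallel>d \<alpha>\<parallel>\<close> over the differences \<open>d\<close> of the first \<open>N\<close> primes, all of
  which are at most \<open>X = 128 N log N\<close> by Chebyshev's lower bound for the number of primes. If the series
  converges, doubling gives \<open>\<parallel>d \<alpha>\<parallel> \<le> C \<eta>(d)\<close> for infinitely many \<open>d\<close> (or \<open>\<alpha>\<close> is rational), and the
  Borel-Cantelli lemma applies.

  If the series diverges, Selberg's sieve bounds the number of prime pairs with difference \<open>d\<close> by
  \<open>O(X / log\<^sup>2 X)\<close> times \<open>(d / \<phi>(d))\<^sup>2\<close>. Since there are about \<open>X\<^sup>2 / log\<^sup>2 X\<close> pairs of primes and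
  \<open>d / \<phi>(d)\<close> has bounded moments, a positive proportion of all \<open>d \<le> X\<close> are prime differences with
  \<open>d / \<phi>(d)\<close> bounded. The reduced fractions with these denominators are separated by \<open>1 / X\<^sup>2\<close> and
  each interval contains a positive proportion of the conceivable \<open>X\<^sup>2\<close> of them. For \<open>N = 2\<^sup>k\<close> the balls
  around these fractions are therefore quasi-independent on every interval, so by the second moment
  method their limsup set has positive relative measure in every interval, hence full measure.
\<close>

text \<open>No single d has to be recognised as a prime difference, and bounds of the right order of
  magnitude suffice: the pairs among the first N primes are counted exactly, so a sieve upper bound
  with any constant forces many distinct differences. Selberg's bound carries the unbounded factor
  (d / phi(d))^2; the fourth moment shows that the d with a large ratio contribute little to it.
  Bounding the ratio serves a second purpose: such a denominator has a positive proportion of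
  coprime numerators in every fixed interval. At scale X only radii up to 1 / (4 X^2) matter. Dyadic
  N makes X at least double, so that correlations between scales decay like 4^-(k-j), while X grows
  by a bounded factor, so that Cauchy condensation preserves divergence. The lower bound obtained is
  proportional to the length of the interval, with a constant independent of the interval. This
  uniformity takes the place of an abstract zero-one law, by way of a Vitali covering.\<close>

subsection \<open>Selberg's sieve\<close>

lemma prod_one_plus_eq_sum_Pow:
  fixes f :: "'a \<Rightarrow> 'b :: comm_semiring_1"
  assumes "finite A"
  shows "(\<Prod>x\<in>A. 1 + f x) = (\<Sum>X\<in>Pow A. prod f X)"
  using prod_add[OF assms, of f "\<lambda>_. 1"] by (simp add: add.commute)

text \<open>Moebius inversion on the Boolean lattice: with \<open>E = L \<union> X\<close> the sum
  factors into \<open>1 + (- 1)\<close> over the points of \<open>M - L\<close>, so it vanishes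
  unless \<open>M - L\<close> is empty.\<close>

lemma sum_alternating_between:
  fixes L M :: "'a set"
  assumes "finite M"
  shows "(\<Sum>E | L \<subseteq> E \<and> E \<subseteq> M. (- 1 :: real) ^ card E) = (if L = M then (- 1) ^ card L else 0)"
proof (cases "L \<subseteq> M")
  case True
  have fL: "finite L" using True assms finite_subset by blast
  have "(\<Sum>E | L \<subseteq> E \<and> E \<subseteq> M. (- 1 :: real) ^ card E) = (\<Sum>X\<in>Pow (M - L). (- 1) ^ card (L \<union> X))"
    by (rule sum.reindex_bij_witness[of _ "\<lambda>X. L \<union> X" "\<lambda>E. E - L"]) (use True in \<open>auto simp: Un_absorb1\<close>)
  also have "\<dots> = (\<Sum>X\<in>Pow (M - L). (- 1) ^ card L * (\<Prod>x\<in>X. - 1))"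
  proof (rule sum.cong[OF refl])
    fix X assume X: "X \<in> Pow (M - L)"
    then have "finite X" using assms by (auto intro: finite_subset)
    moreover have "L \<inter> X = {}" using X by auto
    ultimately show "(- 1 :: real) ^ card (L \<union> X) = (- 1) ^ card L * (\<Prod>x\<in>X. - 1)"
      using fL by (simp add: card_Un_disjoint power_add)
  qed
  also have "\<dots> = (- 1) ^ card L * (\<Prod>x\<in>M - L. 1 + (- 1))"
    by (subst prod_one_plus_eq_sum_Pow) (use assms in \<open>auto simp: sum_distrib_left\<close>)
  also have "\<dots> = (if L = M then (- 1) ^ card L else 0)"
    using True assms by (auto simp: prod_zero_iff card_gt_0_iff)
  finally show ?thesis .
next
  case False
  then have "{E. L \<subseteq> E \<and> E \<subseteq> M} = {}" by auto
  moreover have "L \<noteq> M" using False by auto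
  ultimately show ?thesis by (simp only: sum.empty if_False)
qed

text \<open>Square-free moduli are represented by finite sets of primes: divisibility becomes inclusion and
  the least common multiple becomes union.\<close>

locale selberg_sieve =
  fixes P :: "'a set" and g :: "'a \<Rightarrow> real" and \<E> :: "'a set set"
  assumes finite_P: "finite P"
    and g_pos: "\<And>p. p \<in> P \<Longrightarrow> 0 < g p"
    and g_less_1: "\<And>p. p \<in> P \<Longrightarrow> g p < 1"
    and \<E>_sub: "\<E> \<subseteq> Pow P"
    and \<E>_empty: "{} \<in> \<E>"
    and \<E>_down: "\<And>E F. F \<in> \<E> \<Longrightarrow> E \<subseteq> F \<Longrightarrow> E \<in> \<E>"
begin

text \<open>Chosen so that \<open>1 + 1 / h p = 1 / g p\<close>. This identity expands
  \<open>1 / prod g (E \<inter> F)\<close> over common subsets and thereby diagonalises the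
  quadratic form, whose value at \<open>lam\<close> is \<open>1 / G\<close>.\<close>

definition h :: "'a \<Rightarrow> real" where "h p = g p / (1 - g p)"

definition G :: real where "G = (\<Sum>E\<in>\<E>. prod h E)"

text \<open>Selberg's weights: they are obtained by Moebius inversion from the minimiser \<open>\<plusminus> prod h L / G\<close> of the
  diagonalised quadratic form.\<close>

definition lam :: "'a set \<Rightarrow> real" where
  "lam E = (- 1) ^ card E / prod g E * (\<Sum>M | M \<in> \<E> \<and> E \<subseteq> M. prod h M) / G"

lemma finite_\<E>: "finite \<E>"
  using \<E>_sub finite_P by (meson finite_Pow_iff finite_subset)

lemma finite_sub_P: "E \<subseteq> P \<Longrightarrow> finite E"
  using finite_P finite_subset by blast

lemma h_pos: "p \<in> P \<Longrightarrow> h p > 0"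
  unfolding h_def using g_pos g_less_1 by simp

lemma prod_g_pos: "E \<subseteq> P \<Longrightarrow> prod g E > 0"
  using g_pos by (auto intro!: prod_pos)

lemma prod_h_pos: "E \<subseteq> P \<Longrightarrow> prod h E > 0"
  using h_pos by (auto intro!: prod_pos)

lemma prod_h_nonneg: "E \<in> \<E> \<Longrightarrow> prod h E \<ge> 0"
  using prod_h_pos[of E] \<E>_sub by auto

lemma G_pos: "G > 0"
  unfolding G_def
proof (rule sum_pos2[OF finite_\<E> \<E>_empty])
  show "0 < prod h {}" by simp
qed (rule prod_h_nonneg)

lemma lam_empty: "lam {} = 1"
  using G_pos unfolding lam_def G_def by simp

lemma lam_outside:
  assumes "E \<notin> \<E>" shows "lam E = 0"
proof -
  have "{M. M \<in> \<E> \<and> E \<subseteq> M} = {}" using assms \<E>_down by blast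
  then show ?thesis by (simp only: lam_def) simp
qed

text \<open>The sum over the sets containing \<open>E\<close> is a part of \<open>G\<close>. The
  bound ignores the saving in that part, which is affordable because the sieving level will be a
  small power of the number of integers sifted.\<close>

lemma abs_lam_le:
  assumes "E \<subseteq> P"
  shows "\<bar>lam E\<bar> \<le> 1 / prod g E"
proof -
  have "(\<Sum>M | M \<in> \<E> \<and> E \<subseteq> M. prod h M) \<le> G"
    unfolding G_def by (rule sum_mono2) (use finite_\<E> prod_h_nonneg in auto)
  moreover have "(\<Sum>M | M \<in> \<E> \<and> E \<subseteq> M. prod h M) \<ge> 0"
    by (rule sum_nonneg) (use prod_h_nonneg in auto)
  ultimately have "\<bar>(\<Sum>M | M \<in> \<E> \<and> E \<subseteq> M. prod h M) / G\<bar> \<le> 1"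
    using G_pos by (simp add: divide_le_eq)
  moreover have "\<bar>lam E\<bar> = 1 / prod g E * \<bar>(\<Sum>M | M \<in> \<E> \<and> E \<subseteq> M. prod h M) / G\<bar>"
    unfolding lam_def using prod_g_pos[OF assms] by (simp add: abs_mult power_abs)
  ultimately show ?thesis
    using mult_left_mono[of "\<bar>(\<Sum>M | M \<in> \<E> \<and> E \<subseteq> M. prod h M) / G\<bar>" 1 "1 / prod g E"]
      prod_g_pos[OF assms] by (simp only:) simp
qed

section \<open>Diagonalising the quadratic form\<close>

text \<open>These sums are the coordinates in which the form is diagonal. Inserting
  \<open>lam\<close> and exchanging summations leaves the alternating sum over
  \<open>L \<subseteq> E \<subseteq> M\<close>, which keeps only \<open>M = L\<close>.\<close>

lemma sum_multiples_lam:
  assumes "L \<subseteq> P"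
  shows "(\<Sum>E | L \<subseteq> E \<and> E \<subseteq> P. prod g E * lam E) = (if L \<in> \<E> then (- 1) ^ card L * prod h L / G else 0)"
proof -
  have fin: "finite {E. L \<subseteq> E \<and> E \<subseteq> P}" using finite_P by (rule_tac finite_subset[of _ "Pow P"]) auto
  have "(\<Sum>E | L \<subseteq> E \<and> E \<subseteq> P. prod g E * lam E) =
      (\<Sum>E | L \<subseteq> E \<and> E \<subseteq> P. \<Sum>M | M \<in> \<E> \<and> E \<subseteq> M. (- 1) ^ card E * (prod h M / G))"
  proof (rule sum.cong[OF refl])
    fix E assume "E \<in> {E. L \<subseteq> E \<and> E \<subseteq> P}"
    then have "prod g E > 0" using prod_g_pos by auto
    then show "prod g E * lam E = (\<Sum>M | M \<in> \<E> \<and> E \<subseteq> M. (- 1) ^ card E * (prod h M / G))"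
      unfolding lam_def by (simp add: sum_distrib_left sum_divide_distrib)
  qed
  also have "\<dots> = (\<Sum>M\<in>\<E>. \<Sum>E | E \<in> {E. L \<subseteq> E \<and> E \<subseteq> P} \<and> E \<subseteq> M. (- 1) ^ card E * (prod h M / G))"
    by (rule sum.swap_restrict[OF fin finite_\<E>])
  also have "\<dots> = (\<Sum>M\<in>\<E>. (if L = M then (- 1) ^ card L else 0) * (prod h M / G))"
  proof (rule sum.cong[OF refl])
    fix M assume M: "M \<in> \<E>"
    then have "{E. E \<in> {E. L \<subseteq> E \<and> E \<subseteq> P} \<and> E \<subseteq> M} = {E. L \<subseteq> E \<and> E \<subseteq> M}"
      using \<E>_sub by auto
    moreover have "finite M" using M \<E>_sub finite_sub_P by auto
    ultimately show "(\<Sum>E | E \<in> {E. L \<subseteq> E \<and> E \<subseteq> P} \<and> E \<subseteq> M. (- 1) ^ card E * (prod h M / G)) =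
        (if L = M then (- 1) ^ card L else 0) * (prod h M / G)"
      by (simp only: sum_distrib_right[symmetric] sum_alternating_between)
  qed
  also have "\<dots> = (\<Sum>M\<in>\<E>. if L = M then (- 1) ^ card L * prod h M / G else 0)"
    by (intro sum.cong) auto
  also have "\<dots> = (if L \<in> \<E> then (- 1) ^ card L * prod h L / G else 0)"
    using finite_\<E> by simp
  finally show ?thesis .
qed

text \<open>The union couples \<open>E\<close> and \<open>F\<close> only through
  \<open>1 / prod g (E \<inter> F)\<close>, which expands over the subsets \<open>L\<close> of the
  intersection. With the sum over \<open>L\<close> outermost the two variables separate.\<close>

lemma prod_g_Un:
  assumes "E \<subseteq> P" "F \<subseteq> P"
  shows "prod g (E \<union> F) = prod g E * prod g F * (\<Sum>L | L \<subseteq> P \<and> L \<subseteq> E \<and> L \<subseteq> F. 1 / prod h L)"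
proof -
  have fin: "finite E" "finite F" using assms finite_sub_P by auto
  have 1: "prod g (E \<union> F) * prod g (E \<inter> F) = prod g E * prod g F"
    using prod.union_inter[OF fin] .
  have "(\<Sum>L | L \<subseteq> P \<and> L \<subseteq> E \<and> L \<subseteq> F. 1 / prod h L) = (\<Sum>L\<in>Pow (E \<inter> F). prod (\<lambda>p. 1 / h p) L)"
    by (rule sum.cong) (use assms in \<open>auto simp: prod_dividef\<close>)
  also have "\<dots> = (\<Prod>p\<in>E \<inter> F. 1 + 1 / h p)"
    by (rule prod_one_plus_eq_sum_Pow[symmetric]) (use fin in auto)
  also have "\<dots> = (\<Prod>p\<in>E \<inter> F. 1 / g p)"
  proof (rule prod.cong[OF refl])
    fix p assume "p \<in> E \<inter> F"
    then have "p \<in> P" using assms by auto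
    then show "1 + 1 / h p = 1 / g p" using g_pos[of p] g_less_1[of p]
      unfolding h_def by (simp add: field_simps)
  qed
  also have "\<dots> = 1 / prod g (E \<inter> F)" by (simp add: prod_dividef)
  finally have 2: "(\<Sum>L | L \<subseteq> P \<and> L \<subseteq> E \<and> L \<subseteq> F. 1 / prod h L) = 1 / prod g (E \<inter> F)" .
  have "prod g (E \<inter> F) > 0" by (rule prod_g_pos) (use assms in auto)
  then show ?thesis unfolding 2 using 1 by (simp add: field_simps)
qed

text \<open>After separation the form is the sum of \<open>1 / prod h L\<close> times the squared
  coordinates; up to sign these are \<open>prod h L / G\<close> on \<open>\<E>\<close>, so each term
  is \<open>prod h L / G\<^sup>2\<close>.\<close>

lemma quadratic_form_lam:
  "(\<Sum>E\<in>Pow P. \<Sum>F\<in>Pow P. lam E * lam F * prod g (E \<union> F)) = 1 / G"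
proof -
  let ?a = "\<lambda>E. prod g E * lam E"
  have fP: "finite (Pow P)" using finite_P by simp
  have "(\<Sum>E\<in>Pow P. \<Sum>F\<in>Pow P. lam E * lam F * prod g (E \<union> F)) =
     (\<Sum>E\<in>Pow P. \<Sum>F\<in>Pow P. \<Sum>L\<in>Pow P. if L \<subseteq> E \<and> L \<subseteq> F then ?a E * ?a F * (1 / prod h L) else 0)"
  proof (intro sum.cong refl)
    fix E F assume EF: "E \<in> Pow P" "F \<in> Pow P"
    have "lam E * lam F * prod g (E \<union> F) = (\<Sum>L | L \<in> Pow P \<and> L \<subseteq> E \<and> L \<subseteq> F. ?a E * ?a F * (1 / prod h L))"
      using EF by (subst prod_g_Un) (auto simp: sum_distrib_left mult_ac)
    also have "\<dots> = (\<Sum>L\<in>Pow P. if L \<subseteq> E \<and> L \<subseteq> F then ?a E * ?a F * (1 / prod h L) else 0)"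
      by (rule sum.inter_filter[OF fP])
    finally show "lam E * lam F * prod g (E \<union> F) = \<dots>" .
  qed
  also have "\<dots> = (\<Sum>E\<in>Pow P. \<Sum>L\<in>Pow P. \<Sum>F\<in>Pow P. if L \<subseteq> E \<and> L \<subseteq> F then ?a E * ?a F * (1 / prod h L) else 0)"
    by (intro sum.cong refl sum.swap)
  also have "\<dots> = (\<Sum>L\<in>Pow P. \<Sum>E\<in>Pow P. \<Sum>F\<in>Pow P. if L \<subseteq> E \<and> L \<subseteq> F then ?a E * ?a F * (1 / prod h L) else 0)"
    by (rule sum.swap)
  also have "\<dots> = (\<Sum>L\<in>Pow P. if L \<in> \<E> then prod h L / G\<^sup>2 else 0)"
  proof (rule sum.cong[OF refl])
    fix L assume L: "L \<in> Pow P"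
    have "(\<Sum>E\<in>Pow P. \<Sum>F\<in>Pow P. if L \<subseteq> E \<and> L \<subseteq> F then ?a E * ?a F * (1 / prod h L) else 0) =
       (\<Sum>E\<in>Pow P. \<Sum>F\<in>Pow P. (if L \<subseteq> E then ?a E else 0) * (if L \<subseteq> F then ?a F else 0) * (1 / prod h L))"
      by (intro sum.cong refl) auto
    also have "\<dots> = (\<Sum>E\<in>Pow P. if L \<subseteq> E then ?a E else 0) * (\<Sum>F\<in>Pow P. if L \<subseteq> F then ?a F else 0) * (1 / prod h L)"
      unfolding sum_product by (simp only: sum_distrib_right)
    also have "(\<Sum>E\<in>Pow P. if L \<subseteq> E then ?a E else 0) = (\<Sum>E | L \<subseteq> E \<and> E \<subseteq> P. ?a E)"
      by (subst sum.inter_filter[OF fP, symmetric]) (auto intro!: sum.cong)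
    also have "\<dots> = (if L \<in> \<E> then (- 1) ^ card L * prod h L / G else 0)"
      using sum_multiples_lam L by auto
    also have "(if L \<in> \<E> then (- 1) ^ card L * prod h L / G else 0) * (if L \<in> \<E> then (- 1) ^ card L * prod h L / G else 0) * (1 / prod h L)
       = (if L \<in> \<E> then prod h L / G\<^sup>2 else 0)"
      using prod_h_pos[of L] L
      by (auto simp: power2_eq_square field_simps simp flip: power_mult_distrib)
    finally show "(\<Sum>E\<in>Pow P. \<Sum>F\<in>Pow P. if L \<subseteq> E \<and> L \<subseteq> F then ?a E * ?a F * (1 / prod h L) else 0) =
       (if L \<in> \<E> then prod h L / G\<^sup>2 else 0)" .
  qed
  also have "\<dots> = (\<Sum>L\<in>\<E>. prod h L / G\<^sup>2)"
    by (subst sum.inter_filter[OF fP, symmetric]) (use \<E>_sub in \<open>auto intro!: sum.cong\<close>)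
  also have "\<dots> = 1 / G"
    using G_pos unfolding sum_divide_distrib[symmetric] G_def[symmetric] by (simp add: power2_eq_square)
  finally show ?thesis .
qed

text \<open>\<open>Q n\<close> is the set of sifting primes that hit \<open>n\<close>, and
  \<open>x * prod g E\<close> is the expected number of \<open>n\<close> hit by all of
  \<open>E\<close>. Submultiplicativity of the error \<open>R\<close> lets the double error sum
  factor into a square.\<close>

theorem upper_bound:
  fixes X :: "'b set" and Q :: "'b \<Rightarrow> 'a set" and R :: "'a set \<Rightarrow> real" and x :: real
  assumes "finite X"
    and Q: "\<And>n. n \<in> X \<Longrightarrow> Q n \<subseteq> P"
    and R: "\<And>E. E \<subseteq> P \<Longrightarrow> \<bar>real (card {n \<in> X. E \<subseteq> Q n}) - x * prod g E\<bar> \<le> R E"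
    and R_Un: "\<And>E F. E \<subseteq> P \<Longrightarrow> F \<subseteq> P \<Longrightarrow> R (E \<union> F) \<le> R E * R F"
  shows "real (card {n \<in> X. Q n = {}}) \<le> x / G + (\<Sum>E\<in>\<E>. R E / prod g E)\<^sup>2"
proof -
  have fP: "finite (Pow P)" using finite_P by simp
  let ?c = "\<lambda>E. real (card {n \<in> X. E \<subseteq> Q n})"
  have R0: "R E \<ge> 0" if "E \<subseteq> P" for E using R[OF that] by linarith
  have "real (card {n \<in> X. Q n = {}}) = (\<Sum>n\<in>X. if Q n = {} then 1 else 0)"
    using \<open>finite X\<close> by (simp add: sum.inter_filter[symmetric])
  \<comment> \<open>A square is nonnegative, and for empty \<open>Q n\<close> the inner sum is
    \<open>lam {} = 1\<close>.\<close>
  also have "\<dots> \<le> (\<Sum>n\<in>X. (\<Sum>E\<in>Pow (Q n). lam E)\<^sup>2)"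
    by (rule sum_mono) (auto simp: lam_empty)
  also have "\<dots> = (\<Sum>n\<in>X. \<Sum>E\<in>Pow P. \<Sum>F\<in>Pow P. if E \<union> F \<subseteq> Q n then lam E * lam F else 0)"
  proof (rule sum.cong[OF refl])
    fix n assume n: "n \<in> X"
    have "(\<Sum>E\<in>Pow (Q n). lam E) = (\<Sum>E | E \<in> Pow P \<and> E \<subseteq> Q n. lam E)"
      by (rule sum.cong) (use Q[OF n] in auto)
    also have "\<dots> = (\<Sum>E\<in>Pow P. if E \<subseteq> Q n then lam E else 0)"
      by (rule sum.inter_filter[OF fP])
    finally have "(\<Sum>E\<in>Pow (Q n). lam E)\<^sup>2 = (\<Sum>E\<in>Pow P. \<Sum>F\<in>Pow P. (if E \<subseteq> Q n then lam E else 0) * (if F \<subseteq> Q n then lam F else 0))"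
      by (simp only: power2_eq_square sum_product)
    also have "\<dots> = (\<Sum>E\<in>Pow P. \<Sum>F\<in>Pow P. if E \<union> F \<subseteq> Q n then lam E * lam F else 0)"
      by (intro sum.cong refl) auto
    finally show "(\<Sum>E\<in>Pow (Q n). lam E)\<^sup>2 = \<dots>" .
  qed
  also have "\<dots> = (\<Sum>E\<in>Pow P. \<Sum>n\<in>X. \<Sum>F\<in>Pow P. if E \<union> F \<subseteq> Q n then lam E * lam F else 0)"
    by (rule sum.swap)
  also have "\<dots> = (\<Sum>E\<in>Pow P. \<Sum>F\<in>Pow P. \<Sum>n\<in>X. if E \<union> F \<subseteq> Q n then lam E * lam F else 0)"
    by (intro sum.cong refl sum.swap)
  also have "\<dots> = (\<Sum>E\<in>Pow P. \<Sum>F\<in>Pow P. lam E * lam F * ?c (E \<union> F))"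
    using \<open>finite X\<close> by (intro sum.cong refl) (simp add: sum.inter_filter[symmetric])
  also have "\<dots> \<le> (\<Sum>E\<in>Pow P. \<Sum>F\<in>Pow P. x * (lam E * lam F * prod g (E \<union> F)) + \<bar>lam E\<bar> * R E * (\<bar>lam F\<bar> * R F))"
  proof (intro sum_mono)
    fix E F assume EF: "E \<in> Pow P" "F \<in> Pow P"
    have EF': "E \<union> F \<subseteq> P" using EF by auto
    let ?\<delta> = "?c (E \<union> F) - x * prod g (E \<union> F)"
    have "\<bar>?\<delta>\<bar> \<le> R E * R F"
      by (rule order_trans[OF R[OF EF'] R_Un]) (use EF in auto)
    then have "\<bar>lam E * lam F\<bar> * \<bar>?\<delta>\<bar> \<le> \<bar>lam E * lam F\<bar> * (R E * R F)"
      by (rule mult_left_mono) simp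
    moreover have "lam E * lam F * ?\<delta> \<le> \<bar>lam E * lam F\<bar> * \<bar>?\<delta>\<bar>"
      unfolding abs_mult[symmetric] by (rule abs_ge_self)
    moreover have "\<bar>lam E * lam F\<bar> * (R E * R F) = \<bar>lam E\<bar> * R E * (\<bar>lam F\<bar> * R F)"
      by (simp add: abs_mult mult_ac)
    moreover have "lam E * lam F * ?\<delta> = lam E * lam F * ?c (E \<union> F) - x * (lam E * lam F * prod g (E \<union> F))"
      by (simp add: right_diff_distrib mult_ac)
    ultimately show "lam E * lam F * ?c (E \<union> F) \<le> x * (lam E * lam F * prod g (E \<union> F)) + \<bar>lam E\<bar> * R E * (\<bar>lam F\<bar> * R F)"
      by linarith
  qed
  also have "\<dots> = x * (1 / G) + (\<Sum>E\<in>Pow P. \<bar>lam E\<bar> * R E)\<^sup>2"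
    by (simp only: sum.distrib sum_distrib_left[symmetric] quadratic_form_lam power2_eq_square sum_product)
  also have "(\<Sum>E\<in>Pow P. \<bar>lam E\<bar> * R E) = (\<Sum>E\<in>\<E>. \<bar>lam E\<bar> * R E)"
    by (rule sum.mono_neutral_right) (use fP \<E>_sub lam_outside in auto)
  also have "(\<Sum>E\<in>\<E>. \<bar>lam E\<bar> * R E)\<^sup>2 \<le> (\<Sum>E\<in>\<E>. R E / prod g E)\<^sup>2"
  proof (rule power_mono)
    show "(\<Sum>E\<in>\<E>. \<bar>lam E\<bar> * R E) \<le> (\<Sum>E\<in>\<E>. R E / prod g E)"
    proof (rule sum_mono)
      fix E assume "E \<in> \<E>"
      then have "E \<subseteq> P" using \<E>_sub by auto
      then show "\<bar>lam E\<bar> * R E \<le> R E / prod g E"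
        using mult_right_mono[OF abs_lam_le R0, of E E] by simp
    qed
    show "0 \<le> (\<Sum>E\<in>\<E>. \<bar>lam E\<bar> * R E)"
      by (intro sum_nonneg mult_nonneg_nonneg) (use R0 \<E>_sub in auto)
  qed
  finally show ?thesis by simp
qed

end

subsection \<open>Chebyshev's lower bound\<close>

text \<open>The entries \<open>1 / (k * (n choose k))\<close> of Leibniz's harmonic triangle are differences of entries with
  smaller \<open>k\<close>, so that inductively their denominators divide the least common multiple.\<close>

lemma mult_binomial_dvd_Lcm:
  "1 \<le> k \<Longrightarrow> k \<le> n \<Longrightarrow> k * (n choose k) dvd Lcm {1..n}"
proof (induction k arbitrary: n rule: nat_induct_at_least)
  case base
  then show ?case by (auto intro: dvd_Lcm)
next
  case (Suc k)
  let ?D = "(n - 1) choose k" and ?B = "n choose k" and ?M = "Lcm {1..n}"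
  have "k * ?D dvd Lcm {1..n-1}" using Suc by auto
  moreover have "Lcm {1..n-1} dvd ?M" by (rule Lcm_subset) auto
  ultimately have "k * ?D dvd ?M" by (rule dvd_trans)
  then obtain s where s: "?M = k * ?D * s" by (elim dvdE)
  obtain t where t: "?M = k * ?B * t" using Suc.IH[of n] Suc.prems by (auto elim: dvdE)
  have "k * (?D * s) = k * (?B * t)" using s t by (simp add: mult_ac)
  then have st: "?D * s = ?B * t" using Suc.hyps by simp
  \<comment> \<open>By absorption and \<open>st\<close>,
    \<open>n * ?D * t = (n - k) * ?D * s\<close>. Subtracting this from \<open>n * ?D * s\<close>
    leaves \<open>k * ?D * s = ?M\<close>, which is therefore a multiple of
    \<open>n * ?D\<close>.\<close>
  have "n * ?D * t = (n - k) * ?B * t" using binomial_absorb_comp[of n k] by simp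
  also have "\<dots> = (n - k) * ?D * s" using st by (simp add: mult.assoc)
  finally have "n * ?D * s - n * ?D * t = (n - (n - k)) * (?D * s)"
    by (simp add: mult.assoc diff_mult_distrib)
  then have "?M = n * ?D * s - n * ?D * t" using s Suc.prems by (simp add: mult_ac)
  moreover have "n * ?D dvd n * ?D * s - n * ?D * t" by (rule dvd_diff_nat) auto
  moreover have "Suc k * (n choose Suc k) = n * ?D"
    using times_binomial_minus1_eq[of "Suc k" n] by simp
  ultimately show ?case by simp
qed

text \<open>A prime enters the least common multiple with its largest power not exceeding
  \<open>n\<close>, so each prime contributes a factor of at most \<open>n\<close>.\<close>

lemma Lcm_upto_le_power_card_primes:
  fixes n :: nat
  assumes "n \<ge> 1"
  shows "Lcm {1..n} \<le> n ^ card {p. prime p \<and> p \<le> n}"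
proof -
  define e where "e p = Max {k. p ^ k \<le> n}" for p :: nat
  have fin: "finite {k. p ^ k \<le> n}" if "prime p" for p :: nat
  proof (rule finite_subset[of _ "{..n}"])
    show "{k. p ^ k \<le> n} \<subseteq> {..n}"
    proof
      fix k assume "k \<in> {k. p ^ k \<le> n}"
      moreover have "k < p ^ k" using prime_ge_2_nat[OF that] by (simp add: power_gt_expt)
      ultimately show "k \<in> {..n}" by simp
    qed
  qed simp
  have e1: "p ^ e p \<le> n" if "prime p" for p
  proof -
    have "0 \<in> {k. p ^ k \<le> n}" using assms by simp
    then have "{k. p ^ k \<le> n} \<noteq> {}" by blast
    then have "e p \<in> {k. p ^ k \<le> n}" unfolding e_def by (rule Max_in[OF fin[OF that]])
    then show ?thesis by simp
  qed
  have e2: "k \<le> e p" if "prime p" "p ^ k \<le> n" for p k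
    unfolding e_def using fin[OF that(1)] that(2) by (intro Max_ge) auto
  let ?P = "{p. prime p \<and> p \<le> n}"
  let ?W = "\<Prod>p\<in>?P. p ^ e p"
  have "Lcm {1..n} dvd ?W"
  proof (rule Lcm_least)
    fix m assume m: "m \<in> {1..n}"
    then have m0: "m > 0" by auto
    have "(\<Prod>p\<in>prime_factors m. p ^ multiplicity p m) dvd ?W"
    proof (rule prod_dvd_prod_subset2)
      show "finite ?P" by simp
      show "prime_factors m \<subseteq> ?P"
        using m by (auto simp: prime_factors_dvd dest!: dvd_imp_le)
      fix p assume p: "p \<in> prime_factors m"
      have "p ^ multiplicity p m \<le> m" using m0 multiplicity_dvd[of p m] by (rule_tac dvd_imp_le) auto
      then have "multiplicity p m \<le> e p" using p m by (intro e2) auto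
      then show "p ^ multiplicity p m dvd p ^ e p" by (rule le_imp_power_dvd)
    qed
    then show "m dvd ?W" using prime_factorization_nat[OF m0] by simp
  qed
  moreover have "?W > 0" by (intro prod_pos) (auto simp: prime_gt_0_nat)
  ultimately have "Lcm {1..n} \<le> ?W" by (rule dvd_imp_le)
  also have "\<dots> \<le> (\<Prod>p\<in>?P. n)" by (rule prod_mono) (use e1 in auto)
  finally show ?thesis by simp
qed

text \<open>Nair's method: the least common multiple of the numbers up to \<open>2 * m\<close> is at
  least \<open>m\<close> times the central binomial coefficient, hence at least
  \<open>4 ^ m / 2\<close>. Comparing with the upper bound and taking logarithms gives the
  claim.\<close>

lemma card_primes_lower_bound:
  assumes "m \<ge> 1"
  shows "(2 * real m - 1) * ln 2 \<le> real (card {p. prime p \<and> p \<le> 2 * m}) * ln (2 * real m)"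
proof -
  let ?k = "card {p. prime p \<and> p \<le> 2 * m}"
  have "m * ((2 * m) choose m) \<le> (2 * m) ^ ?k"
  proof (rule order_trans)
    show "m * ((2 * m) choose m) \<le> Lcm {1..2*m}"
    proof (rule dvd_imp_le[OF mult_binomial_dvd_Lcm])
      show "Lcm {1..2*m} > 0" by (rule gr0I, subst (asm) Lcm_0_iff) auto
    qed (use assms in auto)
    show "Lcm {1..2*m} \<le> (2 * m) ^ ?k" by (rule Lcm_upto_le_power_card_primes) (use assms in auto)
  qed
  then have "real (m * ((2 * m) choose m)) \<le> real ((2 * m) ^ ?k)" by (rule of_nat_mono)
  then have 1: "real m * real ((2 * m) choose m) \<le> (2 * real m) ^ ?k" by simp
  have "4 ^ m / (2 * real m) \<le> real ((2 * m) choose m)"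
    using central_binomial_lower_bound[of m] assms by simp
  then have "real m * (4 ^ m / (2 * real m)) \<le> real m * real ((2 * m) choose m)"
    by (rule mult_left_mono) simp
  then have "4 ^ m / 2 \<le> (2 * real m) ^ ?k" using 1 assms by simp
  then have "ln (4 ^ m / 2) \<le> ln ((2 * real m) ^ ?k)" by (subst ln_le_cancel_iff) (use assms in auto)
  moreover have "ln ((4::real) ^ m / 2) = (2 * real m - 1) * ln 2"
  proof -
    have "(4::real) ^ m = 2 ^ (2 * m)" by (simp add: power_mult)
    then show ?thesis by (simp add: ln_div ln_realpow algebra_simps)
  qed
  moreover have "ln ((2 * real m) ^ ?k) = real ?k * ln (2 * real m)"
    using assms by (subst ln_realpow) auto
  ultimately show ?thesis by simp
qed

section \<open>The n-th prime and the scale N log N\<close>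

lemma prime_nth_prime: "prime (nth_prime n)"
  unfolding nth_prime_def using enumerate_in_set[OF primes_infinite, of "n - 1"] by simp

lemma nth_prime_less_iff:
  assumes "1 \<le> m" "1 \<le> n"
  shows "nth_prime m < nth_prime n \<longleftrightarrow> m < n"
  unfolding nth_prime_def using enumerate_mono_iff[OF primes_infinite] assms by auto

lemma nth_prime_eq_iff:
  assumes "1 \<le> m" "1 \<le> n"
  shows "nth_prime m = nth_prime n \<longleftrightarrow> m = n"
  using nth_prime_less_iff[of m n] nth_prime_less_iff[of n m] assms by (metis less_irrefl linorder_neqE_nat)

lemma nth_prime_le_if_card:
  assumes "N \<ge> 1" "N \<le> card {p. prime p \<and> p \<le> x}"
  shows "nth_prime N \<le> x"
proof (rule ccontr)
  assume "\<not> nth_prime N \<le> x"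
  have "{p. prime p \<and> p \<le> x} \<subseteq> (\<lambda>m. enumerate {p::nat. prime p} m) ` {..<N-1}"
  proof
    fix p assume p: "p \<in> {p. prime p \<and> p \<le> x}"
    then obtain m where m: "enumerate {p::nat. prime p} m = p"
      using enumerate_Ex[OF primes_infinite, of p] by auto
    then have "enumerate {p::nat. prime p} m < enumerate {p::nat. prime p} (N - 1)"
      using p \<open>\<not> nth_prime N \<le> x\<close> unfolding nth_prime_def by auto
    then have "m < N - 1" using enumerate_mono_iff[OF primes_infinite] by blast
    then show "p \<in> (\<lambda>m. enumerate {p::nat. prime p} m) ` {..<N-1}" using m by auto
  qed
  then have "card {p. prime p \<and> p \<le> x} \<le> card {..<N-1}" by (rule surj_card_le[rotated]) simp
  then show False using assms by simp
qed

lemma logm_ge_1: "logm x \<ge> 1"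
  by (simp add: logm_def)

text \<open>The integer at which \<eta> is evaluated. Since \<open>logm\<close> is at least 1,
  rounding down costs at most a factor 2 and keeps \<open>NlogN N\<close> at least
  \<open>N\<close>.\<close>

definition NlogN :: "nat \<Rightarrow> nat" where
  "NlogN N = nat \<lfloor>real N * logm (real N)\<rfloor>"

lemma NlogN_le: "real (NlogN N) \<le> real N * logm (real N)"
  unfolding NlogN_def using logm_ge_1[of "real N"] by simp

lemma NlogN_ge:
  assumes "N \<ge> 1"
  shows "real (NlogN N) \<ge> real N * logm (real N) / 2" "NlogN N \<ge> N"
proof -
  have 1: "real N * 1 \<le> real N * logm (real N)" by (rule mult_left_mono[OF logm_ge_1]) simp
  then have "int N \<le> \<lfloor>real N * logm (real N)\<rfloor>" by (simp add: le_floor_iff)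
  then show 2: "NlogN N \<ge> N" by (simp add: NlogN_def)
  have "real (NlogN N) > real N * logm (real N) - 1" unfolding NlogN_def using 1 by linarith
  moreover have "real (NlogN N) \<ge> 1" using 2 assms by linarith
  ultimately show "real (NlogN N) \<ge> real N * logm (real N) / 2" by linarith
qed

text \<open>With \<open>Y = NlogN N\<close>, the logarithm of \<open>128 * Y\<close> is at most
  \<open>7 + 2 * logm N\<close>, hence at most \<open>9 * logm N\<close>; so \<open>N\<close> times
  it is at most \<open>18 * Y\<close>, well below \<open>(128 * Y - 1) * ln 2\<close>. The power 128
  = 2^7 later turns into seven doublings of \<eta>.\<close>

lemma nth_prime_le_NlogN:
  assumes "N \<ge> 1"
  shows "nth_prime N \<le> 128 * NlogN N"
proof (rule nth_prime_le_if_card[OF assms])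
  let ?Y = "NlogN N" and ?l = "logm (real N)"
  let ?k = "card {p. prime p \<and> p \<le> 128 * ?Y}"
  have Y1: "?Y \<ge> 1" using NlogN_ge(2)[OF assms] assms by linarith
  have l1: "?l \<ge> 1" by (rule logm_ge_1)
  have N1: "real N \<ge> 1" using assms by simp
  have "(128 * real ?Y - 1) * ln 2 \<le> real ?k * ln (128 * real ?Y)"
    using card_primes_lower_bound[of "64 * ?Y"] Y1 by simp
  moreover have "real N * (ln (128 * real ?Y)) \<le> (128 * real ?Y - 1) * ln 2"
  proof -
    have "ln (128 * real ?Y) = ln 128 + ln (real ?Y)" using Y1 by (subst ln_mult) auto
    also have "ln (128::real) = 7 * ln 2" using ln_realpow[of 2 7] by simp
    also have "7 * ln (2::real) \<le> 7 * 1" using ln_2_less_1 by simp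
    also have "ln (real ?Y) \<le> ln (real N * ?l)"
      by (subst ln_le_cancel_iff) (use NlogN_le[of N] Y1 N1 l1 in \<open>auto intro: mult_pos_pos\<close>)
    also have "ln (real N * ?l) = ln (real N) + ln ?l" using N1 l1 by (subst ln_mult) auto
    also have "ln (real N) \<le> ?l" by (simp add: logm_def)
    also have "ln ?l \<le> ?l" using ln_le_minus_one[of ?l] l1 by simp
    finally have "ln (128 * real ?Y) \<le> 9 * ?l" using l1 by simp
    then have "real N * ln (128 * real ?Y) \<le> real N * (9 * ?l)" by (rule mult_left_mono) simp
    also have "\<dots> \<le> 18 * real ?Y" using NlogN_ge(1)[OF assms] by simp
    also have "\<dots> \<le> (128 * real ?Y - 1) * (1/2)" using Y1 by simp
    also have "\<dots> \<le> (128 * real ?Y - 1) * ln 2"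
      by (rule mult_left_mono) (use Y1 ln2_ge_two_thirds in auto)
    finally show ?thesis .
  qed
  ultimately have "real N * ln (128 * real ?Y) \<le> real ?k * ln (128 * real ?Y)" by linarith
  moreover have "ln (128 * real ?Y) > 0" using Y1 by (intro ln_gt_zero) simp
  ultimately show "N \<le> ?k" by simp
qed

subsection \<open>Prime pairs\<close>

text \<open>In a half-open interval the multiples number exactly \<open>B div m - A div m\<close>, a
  difference of two floors.\<close>

lemma card_multiples_int:
  fixes m A B :: int
  assumes "m > 0" "A \<le> B"
  shows "\<bar>real (card {k \<in> {A<..B}. m dvd k}) - real_of_int (B - A) / real_of_int m\<bar> \<le> 1"
proof -
  have lower: "m * (C div m) \<le> C" and upper: "C < m * (C div m) + m" for C
    using mult_div_mod_eq[of m C] pos_mod_sign[OF \<open>m > 0\<close>, of C] pos_mod_bound[OF \<open>m > 0\<close>, of C] by linarith+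
  have "{k \<in> {A<..B}. m dvd k} = (\<lambda>j. m * j) ` {A div m<..B div m}"
  proof safe
    fix k assume k: "k \<in> {A<..B}" "m dvd k"
    then obtain j where j: "k = m * j" by (elim dvdE)
    have "m * (A div m) < m * j" using lower[of A] k(1) j by simp
    then have "A div m < j" using assms(1) by simp
    moreover have "j \<le> B div m" using zdiv_mono1[of k B m] k(1) assms(1) unfolding j by simp
    ultimately show "k \<in> (\<lambda>j. m * j) ` {A div m<..B div m}" using j by auto
  next
    fix j assume j: "j \<in> {A div m<..B div m}"
    have "m * j \<le> m * (B div m)" using j assms by simp
    also have "\<dots> \<le> B" by (rule lower)
    finally have "m * j \<le> B" .
    moreover have "A < m * j"
    proof -
      have "m * (A div m + 1) \<le> m * j" using j assms by simp
      moreover have "A < m * (A div m + 1)"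
        using upper[of A] by (simp add: distrib_left)
      ultimately show ?thesis by linarith
    qed
    ultimately show "m * j \<in> {A<..B}" by simp
  qed auto
  moreover have "inj_on (\<lambda>j. m * j) {A div m<..B div m}" using assms by (auto intro: inj_onI)
  ultimately have c: "card {k \<in> {A<..B}. m dvd k} = nat (B div m - A div m)"
    by (simp add: card_image)
  have "A div m \<le> B div m" using assms by (intro zdiv_mono1) auto
  then have "real (card {k \<in> {A<..B}. m dvd k}) = of_int (B div m) - of_int (A div m)"
    unfolding c by simp
  also have "B div m = \<lfloor>of_int B / of_int m :: real\<rfloor>" by (rule floor_divide_of_int_eq[symmetric])
  also have "A div m = \<lfloor>of_int A / of_int m :: real\<rfloor>" by (rule floor_divide_of_int_eq[symmetric])
  finally show ?thesis by (simp add: diff_divide_distrib) linarith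
qed

lemma prod_primes_dvd_iff:
  fixes T :: "nat set" and n :: int
  assumes "finite T" "\<And>p. p \<in> T \<Longrightarrow> prime p"
  shows "int (\<Prod>T) dvd n \<longleftrightarrow> (\<forall>p\<in>T. int p dvd n)"
  using assms
proof (induction T rule: finite_induct)
  case (insert p T)
  have "coprime p (\<Prod>T)"
    by (rule prod_coprime_right) (use insert in \<open>auto intro!: primes_coprime\<close>)
  then have "coprime (int p) (int (\<Prod>T))" by (simp only: coprime_int_iff)
  then have "int p * int (\<Prod>T) dvd n \<longleftrightarrow> int p dvd n \<and> int (\<Prod>T) dvd n"
    by (meson divides_mult dvd_mult_left dvd_mult_right)
  then show ?case using insert by simp
qed auto

lemma prime_factors_prod_primes:
  fixes E :: "nat set"
  assumes "finite E" "\<And>p. p \<in> E \<Longrightarrow> prime p"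
  shows "prime_factors (\<Prod>E) = E"
proof -
  have "\<Prod>E > 0" using assms by (intro prod_pos) (auto simp: prime_gt_0_nat)
  then have "p \<in> prime_factors (\<Prod>E) \<longleftrightarrow> prime p \<and> (\<exists>q\<in>E. p dvd q)" for p
    using prime_dvd_prod_iff[OF assms(1), of p "\<lambda>p. p"] by (auto simp: prime_factors_dvd)
  moreover have "prime p \<and> (\<exists>q\<in>E. p dvd q) \<longleftrightarrow> p \<in> E" for p
  proof
    assume "prime p \<and> (\<exists>q\<in>E. p dvd q)"
    then obtain q where "prime p" "q \<in> E" "p dvd q" by auto
    then show "p \<in> E" using primes_dvd_imp_eq[of p q] assms(2)[of q] by simp
  next
    assume "p \<in> E"
    then show "prime p \<and> (\<exists>q\<in>E. p dvd q)" using assms(2) by (intro conjI bexI[of _ p]) auto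
  qed
  ultimately show ?thesis by (intro set_eqI) simp
qed

text \<open>Unique factorisation: a set of primes is recovered from its product, so such sets inject
  into \<open>{1..z}\<close>.\<close>

lemma card_prime_sets_le:
  assumes "\<And>E. E \<in> \<E> \<Longrightarrow> finite E \<and> (\<forall>p\<in>E. prime p) \<and> \<Prod>E \<le> (z::nat)"
  shows "card \<E> \<le> z"
proof -
  have "inj_on Prod \<E>"
  proof (rule inj_onI)
    fix E F :: "nat set" assume EF: "E \<in> \<E>" "F \<in> \<E>" "\<Prod>E = \<Prod>F"
    have "prime_factors (\<Prod>E) = E"
      by (rule prime_factors_prod_primes) (use assms[OF EF(1)] in auto)
    moreover have "prime_factors (\<Prod>F) = F"
      by (rule prime_factors_prod_primes) (use assms[OF EF(2)] in auto)
    ultimately show "E = F" unfolding EF(3) by (rule trans[OF sym])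
  qed
  moreover have "Prod ` \<E> \<subseteq> {1..z}"
  proof
    fix n assume "n \<in> Prod ` \<E>"
    then obtain E where E: "E \<in> \<E>" "n = \<Prod>E" by auto
    have "\<Prod>E > 0" using assms[OF E(1)] by (intro prod_pos) (auto simp: prime_gt_0_nat)
    then have "1 \<le> n" unfolding E(2) by (simp only: Suc_le_eq One_nat_def)
    then show "n \<in> {1..z}" using assms[OF E(1)] E(2) by simp
  qed
  ultimately have "card \<E> \<le> card {1..z}" by (rule card_inj_on_le) simp
  then show ?thesis by simp
qed

text \<open>A prime p in \<open>E\<close> divides n (n + d) for n in exactly two residue classes, 0
  and -d, which differ because p does not divide \<open>d\<close>. Recording the set
  \<open>T\<close> of primes that divide n itself splits the count into \<open>2 ^ card E\<close>
  disjoint systems. By the Chinese remainder theorem each is a single class modulo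
  \<open>\<Prod>E\<close> and has error at most 1.\<close>

lemma card_dvd_pair_product:
  fixes E :: "nat set" and d x :: nat
  assumes E: "finite E" "\<And>p. p \<in> E \<Longrightarrow> prime p" "\<And>p. p \<in> E \<Longrightarrow> \<not> p dvd d"
  shows "\<bar>real (card {n \<in> {0<..int x}. \<forall>p\<in>E. int p dvd n * (n + int d)}) - real x * (\<Prod>p\<in>E. 2 / real p)\<bar> \<le> 2 ^ card E"
proof -
  let ?S = "\<lambda>T. {n \<in> {0<..int x}. int (\<Prod>T) dvd n \<and> int (\<Prod>(E - T)) dvd n + int d}"
  let ?M = "\<Prod>E"
  have M0: "?M > 0" using E by (intro prod_pos) (auto simp: prime_gt_0_nat)
  have dvdT: "int (\<Prod>T) dvd n \<longleftrightarrow> (\<forall>p\<in>T. int p dvd n)" if "T \<subseteq> E" for T n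
    using that E by (intro prod_primes_dvd_iff) (auto intro: finite_subset)
  have "{n \<in> {0<..int x}. \<forall>p\<in>E. int p dvd n * (n + int d)} = (\<Union>T\<in>Pow E. ?S T)"
  proof (intro equalityI subsetI)
    fix n assume n: "n \<in> {n \<in> {0<..int x}. \<forall>p\<in>E. int p dvd n * (n + int d)}"
    let ?T = "{p \<in> E. int p dvd n}"
    have "int p dvd n + int d" if "p \<in> E - ?T" for p
      using that n E(2)[of p] by (auto simp: prime_dvd_mult_iff)
    then have "int (\<Prod>(E - ?T)) dvd n + int d" by (subst dvdT) auto
    moreover have "int (\<Prod>?T) dvd n" by (subst dvdT) auto
    ultimately have "n \<in> ?S ?T" using n by simp
    moreover have "?T \<in> Pow E" by blast
    ultimately show "n \<in> (\<Union>T\<in>Pow E. ?S T)" by (rule UN_I[rotated])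
  next
    fix n assume "n \<in> (\<Union>T\<in>Pow E. ?S T)"
    then obtain T where T: "T \<subseteq> E" "n \<in> ?S T" by auto
    have "int p dvd n * (n + int d)" if "p \<in> E" for p
    proof (cases "p \<in> T")
      case True
      then have "int p dvd n" using dvdT[OF T(1), of n] T(2) by simp
      then show ?thesis by simp
    next
      case False
      then have "int p dvd n + int d" using dvdT[of "E - T" "n + int d"] T(2) that by simp
      then show ?thesis by simp
    qed
    then show "n \<in> {n \<in> {0<..int x}. \<forall>p\<in>E. int p dvd n * (n + int d)}" using T by auto
  qed
  moreover have "card (\<Union>T\<in>Pow E. ?S T) = (\<Sum>T\<in>Pow E. card (?S T))"
  proof (rule card_UN_disjoint)
    show "\<forall>i\<in>Pow E. \<forall>j\<in>Pow E. i \<noteq> j \<longrightarrow> ?S i \<inter> ?S j = {}"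
    proof (intro ballI impI)
      fix T U assume TU: "T \<in> Pow E" "U \<in> Pow E" "T \<noteq> U"
      show "?S T \<inter> ?S U = {}"
      proof (rule ccontr)
        assume "?S T \<inter> ?S U \<noteq> {}"
        then obtain n where n: "n \<in> ?S T" "n \<in> ?S U" by auto
        have no: False if "p \<in> E" "int p dvd n" "int p dvd n + int d" for p
        proof -
          have "int p dvd int d" using that by (simp add: dvd_add_right_iff)
          then show False using E(3)[OF that(1)] by simp
        qed
        have sub: "T' \<subseteq> U'" if "T' \<in> Pow E" "U' \<in> Pow E" "n \<in> ?S T'" "n \<in> ?S U'" for T' U'
        proof
          fix p assume p: "p \<in> T'"
          have "int p dvd n" using dvdT[of T' n] that p by simp
          then have "\<not> int p dvd n + int d" using no[of p] p that by auto
          then show "p \<in> U'" using dvdT[of "E - U'" "n + int d"] that p by auto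
        qed
        have "T = U" using sub[of T U] sub[of U T] n TU by simp
        then show False using TU by simp
      qed
    qed
    show "\<forall>T\<in>Pow E. finite (?S T)"
      by (rule ballI, rule finite_subset[of _ "{0<..int x}"]) (auto simp del: of_nat_prod)
  qed (use E in simp)
  ultimately have c: "real (card {n \<in> {0<..int x}. \<forall>p\<in>E. int p dvd n * (n + int d)}) = (\<Sum>T\<in>Pow E. real (card (?S T)))"
    by simp
  have each: "\<bar>real (card (?S T)) - real x / real ?M\<bar> \<le> 1" if T: "T \<in> Pow E" for T
  proof -
    have fT: "finite T" "finite (E - T)" using T E finite_subset by auto
    have cop: "coprime (int (\<Prod>T)) (int (\<Prod>(E - T)))"
    proof -
      have "coprime (\<Prod>T) (\<Prod>(E - T))"
        using T E by (intro prod_coprime_left prod_coprime_right primes_coprime) auto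
      then show ?thesis by (simp only: coprime_int_iff)
    qed
    have M: "int ?M = int (\<Prod>T) * int (\<Prod>(E - T))"
      using prod.subset_diff[of T E "\<lambda>p. p"] T E by (simp only: of_nat_mult[symmetric] mult.commute[of "\<Prod>T"] Pow_iff)
    obtain a where a: "[a = 0] (mod int (\<Prod>T))" "[a = - int d] (mod int (\<Prod>(E - T)))"
      using binary_chinese_remainder_int[OF cop] by blast
    have "(int (\<Prod>T) dvd n \<and> int (\<Prod>(E - T)) dvd n + int d) \<longleftrightarrow> int ?M dvd n - a" for n
    proof -
      have 1: "int (\<Prod>T) dvd a" using a(1) by (simp only: cong_0_iff)
      have 2: "int (\<Prod>(E - T)) dvd a + int d" using a(2) by (simp only: cong_iff_dvd_diff) simp
      have 3: "int (\<Prod>T) dvd n \<longleftrightarrow> int (\<Prod>T) dvd n - a"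
        using dvd_add_left_iff[OF 1, of "n - a"] by (simp only: diff_add_cancel)
      have "n + int d = (n - a) + (a + int d)" by simp
      then have 4: "int (\<Prod>(E - T)) dvd n + int d \<longleftrightarrow> int (\<Prod>(E - T)) dvd n - a"
        using dvd_add_left_iff[OF 2, of "n - a"] by (simp only:)
      show ?thesis unfolding 3 4 M using cop by (meson divides_mult dvd_mult_left dvd_mult_right)
    qed
    then have "?S T = {n \<in> {0<..int x}. int ?M dvd n - a}" by blast
    also have "\<dots> = (\<lambda>k. k + a) ` {k \<in> {- a<..int x - a}. int ?M dvd k}"
    proof (intro equalityI subsetI)
      fix n assume "n \<in> {n \<in> {0<..int x}. int ?M dvd n - a}"
      then show "n \<in> (\<lambda>k. k + a) ` {k \<in> {- a<..int x - a}. int ?M dvd k}"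
        by (intro image_eqI[of _ _ "n - a"]) (auto simp del: of_nat_prod)
    qed (auto simp del: of_nat_prod)
    finally have "card (?S T) = card {k \<in> {- a<..int x - a}. int ?M dvd k}"
      by (simp add: card_image)
    moreover have "int ?M > 0" using M0 by (simp only: of_nat_0_less_iff)
    ultimately show ?thesis using card_multiples_int[of "int ?M" "- a" "int x - a"] by (simp del: of_nat_prod)
  qed
  have "real x * (\<Prod>p\<in>E. 2 / real p) = (\<Sum>T\<in>Pow E. real x / real ?M)"
    using E by (simp add: prod_dividef card_Pow)
  then have "\<bar>real (card {n \<in> {0<..int x}. \<forall>p\<in>E. int p dvd n * (n + int d)}) - real x * (\<Prod>p\<in>E. 2 / real p)\<bar>
     = \<bar>\<Sum>T\<in>Pow E. real (card (?S T)) - real x / real ?M\<bar>"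
    unfolding c by (simp add: sum_subtractf)
  also have "\<dots> \<le> (\<Sum>T\<in>Pow E. \<bar>real (card (?S T)) - real x / real ?M\<bar>)" by (rule sum_abs)
  also have "\<dots> \<le> (\<Sum>T\<in>Pow E. 1)" by (rule sum_mono[OF each])
  also have "\<dots> = 2 ^ card E" using E by (simp add: card_Pow)
  finally show ?thesis .
qed

text \<open>This is \<open>d / \<phi>(d)\<close>.\<close>

definition inv_totient_ratio :: "nat \<Rightarrow> real" where
  "inv_totient_ratio d = (\<Prod>p\<in>prime_factors d. real p / (real p - 1))"

lemma inv_totient_ratio_ge_1: "inv_totient_ratio d \<ge> 1"
  unfolding inv_totient_ratio_def
proof (rule prod_ge_1)
  fix p assume "p \<in> prime_factors d"
  then have "p \<ge> 2" by (auto intro: prime_ge_2_nat)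
  then show "1 \<le> real p / (real p - 1)" by simp
qed

section \<open>Lower bounds for the sum \<open>G\<close> of the sieve\<close>

lemma sum_inverse_squares_le: "(\<Sum>k=1..n. 1 / (real k)\<^sup>2) \<le> 2"
proof -
  have *: "(\<Sum>k=1..Suc n. 1 / (real k)\<^sup>2) \<le> 2 - 1 / real (Suc n)" for n
  proof (induction n)
    case (Suc n)
    have "1 / (real (Suc (Suc n)))\<^sup>2 \<le> 1 / (real (Suc n) * real (Suc (Suc n)))"
      unfolding power2_eq_square by (rule divide_left_mono) (auto intro: mult_right_mono)
    also have "\<dots> = 1 / real (Suc n) - 1 / real (Suc (Suc n))"
      by (simp add: divide_simps)
    finally have "1 / (real (Suc (Suc n)))\<^sup>2 \<le> 1 / real (Suc n) - 1 / real (Suc (Suc n))" .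
    then show ?case using Suc by simp
  qed simp
  have "1 / real (Suc n) \<ge> 0" by simp
  with *[of n] have "(\<Sum>k=1..Suc n. 1 / (real k)\<^sup>2) \<le> 2" by linarith
  moreover have "(\<Sum>k=1..n. 1 / (real k)\<^sup>2) \<le> (\<Sum>k=1..Suc n. 1 / (real k)\<^sup>2)" by simp
  ultimately show ?thesis by linarith
qed

lemma prod_prime_factors_squarefree:
  fixes n :: nat
  assumes "squarefree n"
  shows "\<Prod>(prime_factors n) = n"
proof -
  have n: "n > 0" using assms by (rule_tac gr0I) auto
  have "n = (\<Prod>p\<in>prime_factors n. p ^ multiplicity p n)" using prime_factorization_nat[OF n] .
  also have "\<dots> = (\<Prod>p\<in>prime_factors n. p)"
  proof (rule prod.cong[OF refl])
    fix p assume p: "p \<in> prime_factors n"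
    have "multiplicity p n \<le> 1" using assms n p squarefree_factorial_semiring''[of n] by auto
    moreover have "multiplicity p n > 0" using p by (simp add: prime_factors_multiplicity)
    ultimately show "p ^ multiplicity p n = p" by (metis One_nat_def le_antisym Suc_leI power_one_right)
  qed
  finally show ?thesis by simp
qed

lemma sum_times_3:
  fixes f :: "'a \<Rightarrow> real" and g :: "'b \<Rightarrow> real" and h :: "'c \<Rightarrow> real"
  shows "(\<Sum>(x, y, z)\<in>A \<times> B \<times> C. f x * g y * h z) = sum f A * (sum g B * sum h C)"
proof -
  have "sum f A * (sum g B * sum h C) = (\<Sum>x\<in>A. \<Sum>w\<in>B \<times> C. f x * (case w of (y, z) \<Rightarrow> g y * h z))"
    by (simp only: sum_product sum.cartesian_product)
  also have "\<dots> = (\<Sum>(x, w)\<in>A \<times> B \<times> C. f x * (case w of (y, z) \<Rightarrow> g y * h z))"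
    by (rule sum.cartesian_product)
  also have "\<dots> = (\<Sum>(x, y, z)\<in>A \<times> B \<times> C. f x * g y * h z)"
    by (rule sum.cong) (auto simp: mult.assoc)
  finally show ?thesis by simp
qed

text \<open>Every m \<le> y is s k^2 with s square-free, and the primes of s split into those away
  from \<open>d\<close> and those dividing \<open>d\<close>. So the harmonic sum is at most a
  product of three sums: the one wanted, one over sets of primes dividing \<open>d\<close>, which is
  at most d / phi(d), and one over k, which is at most 2.\<close>

lemma sum_coprime_squarefree_ge:
  fixes d y z :: nat
  assumes "d > 0" "y \<le> z"
  defines "P \<equiv> {p. prime p \<and> p \<le> z \<and> \<not> p dvd d}"
  shows "ln (real y + 1) \<le> 2 * inv_totient_ratio d * (\<Sum>T | T \<subseteq> P \<and> \<Prod>T \<le> y. \<Prod>p\<in>T. 1 / real p)"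
proof -
  let ?\<T> = "{T. T \<subseteq> P \<and> \<Prod>T \<le> y}"
  let ?u = "\<lambda>T. \<Prod>p\<in>T. 1 / real p"
  have finP: "finite P" unfolding P_def by simp
  have finT: "finite ?\<T>" using finP by (rule_tac finite_subset[of _ "Pow P"]) auto
  have "harm y = (\<Sum>m\<in>{1..y}. 1 / real m)" by (simp add: harm_def inverse_eq_divide)
  also have "\<dots> \<le> (\<Sum>(T, V, k)\<in>?\<T> \<times> Pow (prime_factors d) \<times> {1..y}. ?u T * ?u V * (1 / (real k)\<^sup>2))"
  proof (rule sum_le_included[where i = "\<lambda>(T, V, k). \<Prod>T * \<Prod>V * k\<^sup>2"])
    show "finite (?\<T> \<times> Pow (prime_factors d) \<times> {1..y})" using finT by auto
    show "\<forall>w\<in>?\<T> \<times> Pow (prime_factors d) \<times> {1..y}. 0 \<le> (case w of (T, V, k) \<Rightarrow> ?u T * ?u V * (1 / (real k)\<^sup>2))"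
      by (auto intro!: divide_nonneg_nonneg mult_nonneg_nonneg prod_nonneg)
    show "\<forall>m\<in>{1..y}. \<exists>w\<in>?\<T> \<times> Pow (prime_factors d) \<times> {1..y}. (case w of (T, V, k) \<Rightarrow> \<Prod>T * \<Prod>V * k\<^sup>2) = m \<and>
       1 / real m \<le> (case w of (T, V, k) \<Rightarrow> ?u T * ?u V * (1 / (real k)\<^sup>2))"
    proof
      fix m assume m: "m \<in> {1..y}"
      define s where "s = squarefree_part m"
      define k where "k = square_part m"
      define W where "W = prime_factors s"
      define T where "T = {p \<in> W. \<not> p dvd d}"
      define V where "V = {p \<in> W. p dvd d}"
      have msk: "m = s * k\<^sup>2" unfolding s_def k_def by (rule squarefree_decompose)
      have s: "\<Prod>W = s" unfolding W_def s_def by (rule prod_prime_factors_squarefree) simp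
      have sTV: "s = \<Prod>T * \<Prod>V"
      proof -
        have W: "W = T \<union> V" unfolding T_def V_def by blast
        have "\<Prod>(T \<union> V) = \<Prod>T * \<Prod>V"
          by (rule prod.union_disjoint) (auto simp: T_def V_def W_def)
        then show ?thesis using s by (simp only: W)
      qed
      have mTV: "\<Prod>T * \<Prod>V * k\<^sup>2 = m" unfolding msk sTV ..
      have nz: "\<Prod>T * \<Prod>V * k\<^sup>2 \<noteq> 0" unfolding mTV using m by simp
      have pos: "\<Prod>T > 0" "k > 0"
        by (rule gr0I; use nz in \<open>simp only: mult_zero_left mult_zero_right zero_power2 not_True_eq_False\<close>)+
      have TV_le: "\<Prod>T \<le> m" "k \<le> m"
      proof -
        have "\<Prod>T dvd m" unfolding mTV[symmetric] mult.assoc by (rule dvd_triv_left)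
        then show "\<Prod>T \<le> m" using m by (intro dvd_imp_le) auto
        have "k dvd m" unfolding msk power2_eq_square by (simp add: dvd_mult)
        then show "k \<le> m" using m by (intro dvd_imp_le) auto
      qed
      have "T \<subseteq> P"
      proof
        fix p assume p: "p \<in> T"
        have "finite T" unfolding T_def W_def by simp
        then have "p dvd \<Prod>T" using p by (rule dvd_prodI)
        then have "p \<le> \<Prod>T" using pos by (intro dvd_imp_le)
        then have "p \<le> z" using TV_le m assms by auto
        then show "p \<in> P" using p unfolding P_def T_def W_def by auto
      qed
      then have "T \<in> ?\<T>" using TV_le m by auto
      moreover have "V \<in> Pow (prime_factors d)" using \<open>d > 0\<close> unfolding V_def W_def by (auto simp: prime_factors_dvd)
      moreover have "k \<in> {1..y}" using pos TV_le m by auto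
      moreover have "1 / real m = ?u T * ?u V * (1 / (real k)\<^sup>2)"
        unfolding mTV[symmetric] by (simp add: prod_dividef)
      ultimately show "\<exists>w\<in>?\<T> \<times> Pow (prime_factors d) \<times> {1..y}. (case w of (T, V, k) \<Rightarrow> \<Prod>T * \<Prod>V * k\<^sup>2) = m \<and>
         1 / real m \<le> (case w of (T, V, k) \<Rightarrow> ?u T * ?u V * (1 / (real k)\<^sup>2))"
        using mTV by (intro bexI[of _ "(T, V, k)"]) (simp_all only: prod.case mem_Sigma_iff order_refl simp_thms)
    qed
    show "finite {1..y}" by simp
  qed
  also have "\<dots> = (\<Sum>T\<in>?\<T>. ?u T) * ((\<Sum>V\<in>Pow (prime_factors d). ?u V) * (\<Sum>k=1..y. 1 / (real k)\<^sup>2))"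
    by (rule sum_times_3)
  also have "(\<Sum>V\<in>Pow (prime_factors d). ?u V) = (\<Prod>p\<in>prime_factors d. 1 + 1 / real p)"
    by (rule prod_one_plus_eq_sum_Pow[symmetric]) simp
  also have "(\<Sum>T\<in>?\<T>. ?u T) * ((\<Prod>p\<in>prime_factors d. 1 + 1 / real p) * (\<Sum>k=1..y. 1 / (real k)\<^sup>2))
     \<le> (\<Sum>T\<in>?\<T>. ?u T) * (inv_totient_ratio d * 2)"
  proof (intro mult_left_mono mult_mono sum_inverse_squares_le)
    show "(\<Prod>p\<in>prime_factors d. 1 + 1 / real p) \<le> inv_totient_ratio d"
      unfolding inv_totient_ratio_def
    proof (rule prod_mono)
      fix p assume "p \<in> prime_factors d"
      then have "p \<ge> 2" by (auto intro: prime_ge_2_nat)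
      then show "0 \<le> 1 + 1 / real p \<and> 1 + 1 / real p \<le> real p / (real p - 1)"
        by (simp add: field_simps)
    qed
    show "0 \<le> inv_totient_ratio d" using inv_totient_ratio_ge_1[of d] by simp
    show "0 \<le> (\<Sum>k = 1..y. 1 / (real k)\<^sup>2)" by (intro sum_nonneg) simp
    show "0 \<le> (\<Sum>T\<in>?\<T>. ?u T)" by (intro sum_nonneg prod_nonneg) simp
  qed
  finally have "harm y \<le> (\<Sum>T\<in>?\<T>. ?u T) * (inv_totient_ratio d * 2)" .
  then show ?thesis using harm_ge_ln[of y] by (simp add: mult_ac)
qed

text \<open>A pair \<open>(T, U)\<close> with \<open>T \<union> U = E\<close> is determined by \<open>T\<close> and \<open>T \<inter> U\<close>.\<close>

lemma square_sum_le_sum_Un: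
  fixes u :: "'a \<Rightarrow> real"
  assumes u: "\<And>p. p \<in> P \<Longrightarrow> u p \<ge> 0" and P: "finite P"
    and T: "\<T> \<subseteq> Pow P" and E: "\<E> \<subseteq> Pow P" and TE: "\<And>T U. T \<in> \<T> \<Longrightarrow> U \<in> \<T> \<Longrightarrow> T \<union> U \<in> \<E>"
  shows "(\<Sum>T\<in>\<T>. prod u T)\<^sup>2 \<le> (\<Sum>E\<in>\<E>. \<Prod>p\<in>E. u p * (2 + u p))"
proof -
  have finT: "finite \<T>" and finE: "finite \<E>" using T E P by (auto intro: finite_subset)
  have finE': "finite E" if "E \<in> \<E>" for E using that E P by (auto intro: finite_subset)
  have u': "prod u V \<ge> 0" if "V \<subseteq> P" for V using u that by (auto intro!: prod_nonneg)
  have "(\<Sum>T\<in>\<T>. prod u T)\<^sup>2 = (\<Sum>w\<in>\<T> \<times> \<T>. prod u (fst w) * prod u (snd w))"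
    by (simp add: power2_eq_square sum_product sum.cartesian_product case_prod_beta)
  also have "\<dots> = (\<Sum>E\<in>\<E>. \<Sum>w | w \<in> \<T> \<times> \<T> \<and> fst w \<union> snd w = E. prod u (fst w) * prod u (snd w))"
    by (rule sum.group[symmetric]) (use finT finE TE in auto)
  also have "\<dots> \<le> (\<Sum>E\<in>\<E>. \<Prod>p\<in>E. u p * (2 + u p))"
  proof (rule sum_mono)
    fix E' assume E': "E' \<in> \<E>"
    then have subP: "E' \<subseteq> P" using E by auto
    let ?W = "{w. w \<in> \<T> \<times> \<T> \<and> fst w \<union> snd w = E'}"
    have "(\<Sum>w\<in>?W. prod u (fst w) * prod u (snd w)) = (\<Sum>w\<in>?W. prod u E' * prod u (fst w \<inter> snd w))"
    proof (rule sum.cong[OF refl])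
      fix w assume w: "w \<in> ?W"
      then have "finite (fst w)" "finite (snd w)" using finE'[OF E'] by (auto intro: finite_subset)
      then show "prod u (fst w) * prod u (snd w) = prod u E' * prod u (fst w \<inter> snd w)"
        using prod.union_inter[of "fst w" "snd w" u] w by simp
    qed
    also have "\<dots> = prod u E' * (\<Sum>w\<in>?W. prod u (fst w \<inter> snd w))" by (simp only: sum_distrib_left)
    also have "\<dots> \<le> prod u E' * (\<Sum>w\<in>Sigma (Pow E') Pow. prod u (snd w))"
    proof (rule mult_left_mono)
      show "(\<Sum>w\<in>?W. prod u (fst w \<inter> snd w)) \<le> (\<Sum>w\<in>Sigma (Pow E') Pow. prod u (snd w))"
      \<comment> \<open>Given \<open>T\<close> and \<open>V = T \<inter> U\<close>, the set
        \<open>U\<close> is recovered as \<open>(E' - T) \<union> V\<close>. Dropping membership in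
        \<open>\<T>\<close> leaves all chains \<open>V \<subseteq> T \<subseteq> E'\<close>, whose
        sum is the product of \<open>2 + u p\<close>.\<close>
      proof (rule sum_le_included[where i = "\<lambda>w. (fst w, (E' - fst w) \<union> snd w)"])
        show "finite ?W" using finT by (auto intro: finite_subset[of _ "\<T> \<times> \<T>"])
        show "finite (Sigma (Pow E') Pow)" using finE'[OF E'] by (intro finite_SigmaI) (auto intro: finite_subset)
        show "\<forall>y\<in>Sigma (Pow E') Pow. 0 \<le> prod u (snd y)" using u' subP by auto
        show "\<forall>x\<in>?W. \<exists>y\<in>Sigma (Pow E') Pow. (fst y, (E' - fst y) \<union> snd y) = x \<and> prod u (fst x \<inter> snd x) \<le> prod u (snd y)"
        proof
          fix x assume x: "x \<in> ?W"
          show "\<exists>y\<in>Sigma (Pow E') Pow. (fst y, (E' - fst y) \<union> snd y) = x \<and> prod u (fst x \<inter> snd x) \<le> prod u (snd y)"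
          proof (rule bexI[of _ "(fst x, fst x \<inter> snd x)"])
            have "(E' - fst x) \<union> (fst x \<inter> snd x) = snd x" using x by auto
            then show "(fst (fst x, fst x \<inter> snd x), (E' - fst (fst x, fst x \<inter> snd x)) \<union> snd (fst x, fst x \<inter> snd x)) = x \<and>
               prod u (fst x \<inter> snd x) \<le> prod u (snd (fst x, fst x \<inter> snd x))" by simp
            show "(fst x, fst x \<inter> snd x) \<in> Sigma (Pow E') Pow" using x by auto
          qed
        qed
      qed
      show "0 \<le> prod u E'" by (rule u'[OF subP])
    qed
    also have "(\<Sum>w\<in>Sigma (Pow E') Pow. prod u (snd w)) = (\<Sum>T\<in>Pow E'. \<Sum>V\<in>Pow T. prod u V)"
      using finE'[OF E'] by (subst sum.Sigma) (auto intro: finite_subset simp: case_prod_beta)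
    also have "\<dots> = (\<Sum>T\<in>Pow E'. \<Prod>p\<in>T. 1 + u p)"
      using finE'[OF E'] by (intro sum.cong refl prod_one_plus_eq_sum_Pow[symmetric]) (auto intro: finite_subset)
    also have "\<dots> = (\<Prod>p\<in>E'. 1 + (1 + u p))"
      by (rule prod_one_plus_eq_sum_Pow[symmetric, OF finE'[OF E']])
    also have "prod u E' * (\<Prod>p\<in>E'. 1 + (1 + u p)) = (\<Prod>p\<in>E'. u p * (2 + u p))"
      by (simp add: prod.distrib add.assoc[symmetric])
    finally show "(\<Sum>w\<in>?W. prod u (fst w) * prod u (snd w)) \<le> (\<Prod>p\<in>E'. u p * (2 + u p))" .
  qed
  finally show ?thesis .
qed

section \<open>The sieve applied to the pairs n, n + d\<close>

text \<open>Two residue classes are removed per prime, so \<open>G\<close> should have order log^2 y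
  up to a factor depending on \<open>d\<close>. It is bounded below by the square of the
  one-dimensional sum over moduli up to \<open>y\<close>; the union of two such moduli has product
  at most \<open>y\<^sup>2\<close>, which explains the level.\<close>

lemma sifted_pairs_le:
  fixes d x y :: nat
  assumes d: "d > 0" "even d" and y: "y \<ge> 1"
  defines "P \<equiv> {p. prime p \<and> p \<le> y\<^sup>2 \<and> \<not> p dvd d}"
  shows "real (card {n \<in> {0<..int x}. \<forall>p\<in>P. \<not> int p dvd n * (n + int d)})
    \<le> real x * (2 * inv_totient_ratio d / ln (real y + 1))\<^sup>2 + real y ^ 8"
proof -
  define \<E> where "\<E> = {E. E \<subseteq> P \<and> \<Prod>E \<le> y\<^sup>2}"
  define \<T> where "\<T> = {T. T \<subseteq> P \<and> \<Prod>T \<le> y}"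
  define S where "S = (\<Sum>T\<in>\<T>. \<Prod>p\<in>T. 1 / real p)"
  have finP: "finite P" unfolding P_def by simp
  have prP: "prime p" if "p \<in> P" for p using that unfolding P_def by simp
  \<comment> \<open>Evenness of \<open>d\<close> removes 2 from \<open>P\<close>; at p = 2 the
    density 2 / p would not be below 1.\<close>
  have P3: "p \<ge> 3" if "p \<in> P" for p
  proof -
    have "prime p" "p \<noteq> 2" using that d unfolding P_def by auto
    then show ?thesis using prime_ge_2_nat[of p] by linarith
  qed
  have pos: "\<Prod>E > 0" if "E \<subseteq> P" for E
    using that P3 by (intro prod_pos) force
  have mono: "\<Prod>E \<le> \<Prod>F" if "E \<subseteq> F" "F \<subseteq> P" for E F
    using that finP pos[of F] by (intro dvd_imp_le prod_dvd_prod_subset) (auto intro: finite_subset)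
  interpret selberg_sieve P "\<lambda>p. 2 / real p" \<E>
  proof
    show "0 < 2 / real p" if "p \<in> P" for p using P3[OF that] by simp
    show "2 / real p < 1" if "p \<in> P" for p using P3[OF that] by simp
    show "{} \<in> \<E>" unfolding \<E>_def using y by simp
    show "E \<in> \<E>" if "F \<in> \<E>" "E \<subseteq> F" for E F
      using that mono[of E F] unfolding \<E>_def by auto
  qed (use finP in \<open>auto simp: \<E>_def\<close>)
  let ?Q = "\<lambda>n. {p \<in> P. int p dvd n * (n + int d)}"
  have "real (card {n \<in> {0<..int x}. ?Q n = {}}) \<le> real x / G + (\<Sum>E\<in>\<E>. 2 ^ card E / (\<Prod>p\<in>E. 2 / real p))\<^sup>2"
  proof (rule upper_bound)
    fix E assume E: "E \<subseteq> P"
    have "{n \<in> {0<..int x}. E \<subseteq> ?Q n} = {n \<in> {0<..int x}. \<forall>p\<in>E. int p dvd n * (n + int d)}"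
      using E by (intro Collect_cong conj_cong refl) blast
    then show "\<bar>real (card {n \<in> {0<..int x}. E \<subseteq> ?Q n}) - real x * (\<Prod>p\<in>E. 2 / real p)\<bar> \<le> 2 ^ card E"
      using card_dvd_pair_product[of E d x] E finite_sub_P[OF E] unfolding P_def by (simp only:) blast
  next
    fix E F assume "E \<subseteq> P" "F \<subseteq> P"
    have "(2::real) ^ card (E \<union> F) \<le> 2 ^ (card E + card F)" by (intro power_increasing card_Un_le) simp
    then show "(2::real) ^ card (E \<union> F) \<le> 2 ^ card E * 2 ^ card F" by (simp add: power_add)
  qed auto
  \<comment> \<open>Error divided by density is exactly the modulus. There are at most
    \<open>y\<^sup>2\<close> moduli, each at most \<open>y\<^sup>2\<close>, and squaring their sum
    gives \<open>y ^ 8\<close>.\<close>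
  also have "(\<Sum>E\<in>\<E>. 2 ^ card E / (\<Prod>p\<in>E. 2 / real p)) = (\<Sum>E\<in>\<E>. real (\<Prod>E))"
    by (intro sum.cong refl) (simp add: prod_dividef)
  also have "(\<Sum>E\<in>\<E>. real (\<Prod>E))\<^sup>2 \<le> (real (card \<E>) * real (y\<^sup>2))\<^sup>2"
  proof (rule power_mono)
    show "(\<Sum>E\<in>\<E>. real (\<Prod>E)) \<le> real (card \<E>) * real (y\<^sup>2)"
      by (rule sum_bounded_above) (auto simp: \<E>_def simp del: of_nat_prod of_nat_power)
  qed (intro sum_nonneg of_nat_0_le_iff)
  also have "\<dots> \<le> (real (y\<^sup>2) * real (y\<^sup>2))\<^sup>2"
  proof -
    have "card \<E> \<le> y\<^sup>2"
      by (rule card_prime_sets_le) (use finite_sub_P prP in \<open>auto simp: \<E>_def\<close>)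
    then have "real (card \<E>) \<le> real (y\<^sup>2)" by (rule of_nat_mono)
    then show ?thesis by (intro power_mono mult_right_mono) auto
  qed
  also have "(real (y\<^sup>2) * real (y\<^sup>2))\<^sup>2 = real y ^ 8" by (simp flip: power_mult power_add)
  also have "real x / G \<le> real x * (2 * inv_totient_ratio d / ln (real y + 1))\<^sup>2"
  proof -
    have lny: "ln (real y + 1) > 0" using y by simp
    have ln_le: "ln (real y + 1) \<le> 2 * inv_totient_ratio d * S"
      unfolding S_def \<T>_def P_def using d y by (intro sum_coprime_squarefree_ge) (auto simp: power2_eq_square)
    have S0: "S \<ge> 0" unfolding S_def by (intro sum_nonneg prod_nonneg) simp
    then have S1: "S > 0" using ln_le lny by (cases "S = 0") auto
    \<comment> \<open>The square lemma with \<open>u p = 1 / p\<close>: the factor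
      \<open>u p * (2 + u p)\<close> does not exceed \<open>h p = 2 / (p - 2)\<close>.\<close>
    have "S\<^sup>2 \<le> (\<Sum>E\<in>\<E>. \<Prod>p\<in>E. 1 / real p * (2 + 1 / real p))"
      unfolding S_def
    proof (rule square_sum_le_sum_Un[OF _ finP])
      show "T \<union> U \<in> \<E>" if TU: "T \<in> \<T>" "U \<in> \<T>" for T U
      proof -
        have sub: "T \<subseteq> P" "U \<subseteq> P" using TU unfolding \<T>_def by auto
        have "\<Prod>(T \<union> U) * 1 \<le> \<Prod>(T \<union> U) * \<Prod>(T \<inter> U)"
          using pos[of "T \<inter> U"] sub by (intro mult_le_mono2) (auto simp: Suc_le_eq)
        also have "\<dots> = \<Prod>T * \<Prod>U" by (rule prod.union_inter) (use sub finite_sub_P in auto)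
        also have "\<dots> \<le> y * y" using TU unfolding \<T>_def by (intro mult_le_mono) auto
        finally show ?thesis using sub unfolding \<E>_def by (simp add: power2_eq_square)
      qed
    qed (auto simp: \<E>_def \<T>_def)
    also have "\<dots> \<le> G"
      unfolding G_def
    proof (intro sum_mono prod_mono)
      fix E p assume "E \<in> \<E>" "p \<in> E"
      then have "p \<in> P" unfolding \<E>_def by auto
      then have p: "real p \<ge> 3" using P3 by fastforce
      have "h p = 2 / (real p - 2)" unfolding h_def using p by (simp add: field_simps)
      moreover have "1 / real p * (2 + 1 / real p) \<le> 2 / (real p - 2)"
      proof -
        have "(2 * real p + 1) * (real p - 2) \<le> 2 * (real p * real p)" using p by (simp add: algebra_simps)
        then have "(2 * real p + 1) / (real p * real p) \<le> 2 / (real p - 2)" using p by (simp add: frac_le_eq divide_le_eq pos_le_divide_eq)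
        moreover have "1 / real p * (2 + 1 / real p) = (2 * real p + 1) / (real p * real p)" using p by (simp add: field_simps)
        ultimately show ?thesis by simp
      qed
      ultimately show "0 \<le> 1 / real p * (2 + 1 / real p) \<and> 1 / real p * (2 + 1 / real p) \<le> h p" by simp
    qed
    finally have "S\<^sup>2 \<le> G" .
    then have "1 / G \<le> 1 / S\<^sup>2" using S1 G_pos by (intro divide_left_mono) auto
    also have "\<dots> = (1 / S)\<^sup>2" by (simp add: power_divide)
    also have "\<dots> \<le> (2 * inv_totient_ratio d / ln (real y + 1))\<^sup>2"
      using S1 ln_le lny by (intro power_mono) (auto simp: field_simps)
    finally have "real x * (1 / G) \<le> real x * (2 * inv_totient_ratio d / ln (real y + 1))\<^sup>2"
      by (rule mult_left_mono) simp
    then show ?thesis by simp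
  qed
  finally have "real (card {n \<in> {0<..int x}. ?Q n = {}}) \<le> real x * (2 * inv_totient_ratio d / ln (real y + 1))\<^sup>2 + real y ^ 8"
    by simp
  moreover have "{n \<in> {0<..int x}. ?Q n = {}} = {n \<in> {0<..int x}. \<forall>p\<in>P. \<not> int p dvd n * (n + int d)}" by blast
  ultimately show ?thesis by simp
qed

text \<open>The choice y = x^(1/16) keeps \<open>y ^ 8\<close> at most sqrt x and makes ln (y + 1)
  at least ln x / 16, so the main term has the constant 1024 = 32^2. The remaining 48 = 3 * 16 pays
  for \<open>y\<^sup>2\<close>, 1 and \<open>y ^ 8\<close>, each at most sqrt x and hence at most 16
  x / ln^2 x.\<close>

theorem prime_pairs_le:
  fixes d x :: nat
  assumes d: "d > 0" "even d" and x: "x \<ge> 2"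
  shows "real (card {q. prime q \<and> prime (q + d) \<and> q \<le> x}) \<le> 1072 * real x * (inv_totient_ratio d)\<^sup>2 / (ln (real x))\<^sup>2"
proof -
  define y where "y = nat \<lfloor>real x powr (1 / 16)\<rfloor>"
  let ?P = "{p. prime p \<and> p \<le> y\<^sup>2 \<and> \<not> p dvd d}"
  let ?f = "inv_totient_ratio d"
  have x1: "real x \<ge> 1" using x by simp
  have lnx: "ln (real x) > 0" using x by simp
  have yle: "real y \<le> real x powr (1 / 16)" unfolding y_def by simp
  have ylt: "real x powr (1 / 16) < real y + 1" unfolding y_def by linarith
  have y1: "y \<ge> 1"
  proof -
    have "1 \<le> real x powr (1 / 16)" using x1 by (simp add: ge_one_powr_ge_zero)
    then show ?thesis unfolding y_def by (simp add: le_nat_iff)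
  qed
  have ln_y: "ln (real x) / 16 \<le> ln (real y + 1)"
  proof -
    have "ln (real x powr (1 / 16)) \<le> ln (real y + 1)"
      using ylt x1 by (subst ln_le_cancel_iff) auto
    then show ?thesis using x1 by (simp add: ln_powr)
  qed
  have y_pow: "real y ^ 8 \<le> sqrt (real x)"
  proof -
    have "real y ^ 8 \<le> (real x powr (1 / 16)) ^ 8" by (rule power_mono[OF yle]) simp
    also have "\<dots> = real x powr (1 / 2)" using x1 by (simp add: powr_power)
    finally show ?thesis by (simp add: powr_half_sqrt)
  qed
  have "(ln (real x))\<^sup>2 \<le> 16 * sqrt (real x)"
  proof -
    have "ln (real x powr (1 / 4)) \<le> real x powr (1 / 4)"
      using ln_le_minus_one[of "real x powr (1 / 4)"] x1 by simp
    then have "ln (real x) \<le> 4 * real x powr (1 / 4)" using x1 by (simp add: ln_powr)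
    then have "(ln (real x))\<^sup>2 \<le> (4 * real x powr (1 / 4))\<^sup>2" using lnx by (intro power_mono) auto
    also have "\<dots> = 16 * real x powr (1 / 2)" using x1 by (simp add: power_mult_distrib powr_power)
    finally show ?thesis by (simp add: powr_half_sqrt)
  qed
  then have "sqrt (real x) * (ln (real x))\<^sup>2 \<le> sqrt (real x) * (16 * sqrt (real x))"
    by (rule mult_left_mono) simp
  moreover have "sqrt (real x) * (16 * sqrt (real x)) = 16 * real x" by simp
  ultimately have "sqrt (real x) * (ln (real x))\<^sup>2 \<le> 16 * real x" by (simp only:)
  then have sq: "sqrt (real x) \<le> 16 * real x / (ln (real x))\<^sup>2"
    using lnx by (simp add: pos_le_divide_eq)
  have f1: "?f \<ge> 1" by (rule inv_totient_ratio_ge_1)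
  \<comment> \<open>For \<open>q\<close> above \<open>y\<^sup>2\<close> neither \<open>q\<close> nor
    \<open>q + d\<close> is a sifting prime, so \<open>q\<close> survives the sieve; the smaller
    \<open>q\<close> are counted trivially.\<close>
  have "{q. prime q \<and> prime (q + d) \<and> q \<le> x} \<subseteq> {0..y\<^sup>2} \<union> nat ` {n \<in> {0<..int x}. \<forall>p\<in>?P. \<not> int p dvd n * (n + int d)}"
  proof
    fix q assume q: "q \<in> {q. prime q \<and> prime (q + d) \<and> q \<le> x}"
    show "q \<in> {0..y\<^sup>2} \<union> nat ` {n \<in> {0<..int x}. \<forall>p\<in>?P. \<not> int p dvd n * (n + int d)}"
    proof (cases "q \<le> y\<^sup>2")
      case False
      have "\<not> int p dvd int q * (int q + int d)" if p: "p \<in> ?P" for p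
      proof
        assume "int p dvd int q * (int q + int d)"
        then have "p dvd q * (q + d)" by (simp only: of_nat_add[symmetric] of_nat_mult[symmetric] of_nat_dvd_iff)
        then have "p dvd q \<or> p dvd q + d" using p by (simp add: prime_dvd_mult_iff)
        then have "p = q \<or> p = q + d" using p q primes_dvd_imp_eq[of p q] primes_dvd_imp_eq[of p "q + d"] by auto
        then show False using p False by auto
      qed
      then have "int q \<in> {n \<in> {0<..int x}. \<forall>p\<in>?P. \<not> int p dvd n * (n + int d)}"
        using q prime_gt_0_nat[of q] by auto
      then show ?thesis by (intro UnI2 image_eqI[of _ _ "int q"]) auto
    qed simp
  qed
  moreover have "finite {n \<in> {0<..int x}. \<forall>p\<in>?P. \<not> int p dvd n * (n + int d)}"
    by (rule finite_subset[of _ "{0<..int x}"]) auto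
  ultimately have "card {q. prime q \<and> prime (q + d) \<and> q \<le> x}
      \<le> card ({0..y\<^sup>2} \<union> nat ` {n \<in> {0<..int x}. \<forall>p\<in>?P. \<not> int p dvd n * (n + int d)})"
    by (intro card_mono finite_UnI finite_imageI) simp_all
  also have "\<dots> \<le> card {0..y\<^sup>2} + card (nat ` {n \<in> {0<..int x}. \<forall>p\<in>?P. \<not> int p dvd n * (n + int d)})"
    by (rule card_Un_le)
  also have "\<dots> \<le> (y\<^sup>2 + 1) + card {n \<in> {0<..int x}. \<forall>p\<in>?P. \<not> int p dvd n * (n + int d)}"
    by (intro add_mono card_image_le) (auto intro: finite_subset[of _ "{0<..int x}"])
  finally have "real (card {q. prime q \<and> prime (q + d) \<and> q \<le> x})
      \<le> (real y ^ 2 + 1) + real (card {n \<in> {0<..int x}. \<forall>p\<in>?P. \<not> int p dvd n * (n + int d)})"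
    by (simp flip: of_nat_power of_nat_add of_nat_Suc)
  moreover have "real (card {n \<in> {0<..int x}. \<forall>p\<in>?P. \<not> int p dvd n * (n + int d)})
      \<le> real x * (2 * ?f / ln (real y + 1))\<^sup>2 + real y ^ 8"
    by (rule sifted_pairs_le[OF d y1])
  moreover have "real y ^ 2 \<le> real y ^ 8" using y1 by (intro power_increasing) auto
  moreover have "1 \<le> sqrt (real x)" using x1 by simp
  moreover have "real x * (2 * ?f / ln (real y + 1))\<^sup>2 \<le> 1024 * real x * ?f\<^sup>2 / (ln (real x))\<^sup>2"
  proof -
    have "2 * ?f / ln (real y + 1) \<le> 2 * ?f / (ln (real x) / 16)"
      using ln_y lnx f1 y1 by (intro divide_left_mono) auto
    then have "(2 * ?f / ln (real y + 1))\<^sup>2 \<le> (2 * ?f / (ln (real x) / 16))\<^sup>2"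
      using f1 y1 by (intro power_mono) auto
    also have "\<dots> = 1024 * ?f\<^sup>2 / (ln (real x))\<^sup>2" by (simp add: power_mult_distrib power_divide)
    finally have "real x * (2 * ?f / ln (real y + 1))\<^sup>2 \<le> real x * (1024 * ?f\<^sup>2 / (ln (real x))\<^sup>2)"
      by (rule mult_left_mono) simp
    then show ?thesis by (simp add: mult_ac)
  qed
  moreover have "48 * real x / (ln (real x))\<^sup>2 \<le> 48 * real x * ?f\<^sup>2 / (ln (real x))\<^sup>2"
  proof (rule divide_right_mono)
    have "1 \<le> ?f\<^sup>2" using f1 by simp
    then have "48 * real x * 1 \<le> 48 * real x * ?f\<^sup>2" by (intro mult_left_mono) auto
    then show "48 * real x \<le> 48 * real x * ?f\<^sup>2" by simp
  qed simp
  moreover have "1072 * real x * ?f\<^sup>2 / (ln (real x))\<^sup>2 =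
      1024 * real x * ?f\<^sup>2 / (ln (real x))\<^sup>2 + 48 * real x * ?f\<^sup>2 / (ln (real x))\<^sup>2"
    by (simp flip: add_divide_distrib)
  moreover have "48 * real x / (ln (real x))\<^sup>2 = 3 * (16 * real x / (ln (real x))\<^sup>2)" by simp
  ultimately show ?thesis using y_pow sq by linarith
qed

subsection \<open>Differences of primes have positive density\<close>

text \<open>With u = 1 / (p - 1) \<le> 1 the higher powers of u are at most u, so (1 + u)^4 \<le> 1
  + 15 u, where 15 = 4 + 6 + 4 + 1; moreover u \<le> 2 / p. The product on the right expands over
  square-free divisors.\<close>

lemma inv_totient_ratio_pow4_le:
  "inv_totient_ratio d ^ 4 \<le> (\<Prod>p\<in>prime_factors d. 1 + 30 / real p)"
  unfolding inv_totient_ratio_def prod_power_distrib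
proof (rule prod_mono)
  fix p assume "p \<in> prime_factors d"
  then have p: "real p \<ge> 2" by (metis in_prime_factors_imp_prime of_nat_le_iff of_nat_numeral prime_ge_2_nat)
  define u where "u = 1 / (real p - 1)"
  have u: "0 \<le> u" "u \<le> 1" "u \<le> 2 / real p" unfolding u_def using p by (auto simp: field_simps)
  have "real p / (real p - 1) = 1 + u" unfolding u_def using p by (simp add: field_simps)
  moreover have "(1 + u) ^ 4 \<le> 1 + 15 * u"
  proof -
    have "u ^ 2 \<le> u" "u ^ 3 \<le> u" "u ^ 4 \<le> u"
      using u power_decreasing[of 1 2 u] power_decreasing[of 1 3 u] power_decreasing[of 1 4 u] by auto
    moreover have "(1 + u) ^ 4 = 1 + 4 * u + 6 * u ^ 2 + 4 * u ^ 3 + u ^ 4"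
      by (simp add: power4_eq_xxxx power3_eq_cube power2_eq_square algebra_simps)
    ultimately show ?thesis by linarith
  qed
  moreover have "15 * u \<le> 30 / real p" using u(3) by simp
  ultimately have "(real p / (real p - 1)) ^ 4 \<le> 1 + 30 / real p" by simp
  then show "0 \<le> (real p / (real p - 1)) ^ 4 \<and> (real p / (real p - 1)) ^ 4 \<le> 1 + 30 / real p" by simp
qed

text \<open>Expanding over square-free divisors and exchanging sums leaves x times the product of 1
  + 30 / p^2. This is at most the exponential of 30 times the sum of inverse squares, which is at
  most 2.\<close>

lemma sum_inv_totient_ratio_pow4_le:
  "(\<Sum>d=1..x. inv_totient_ratio d ^ 4) \<le> exp 60 * real x"
proof -
  define P where "P = {p::nat. prime p \<and> p \<le> x}"
  have finP: "finite P" unfolding P_def by simp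
  have "(\<Sum>d=1..x. inv_totient_ratio d ^ 4) \<le> (\<Sum>d=1..x. \<Sum>E | E \<in> Pow P \<and> \<Prod>E dvd d. \<Prod>p\<in>E. 30 / real p)"
  proof (rule sum_mono)
    fix d assume d: "d \<in> {1..x}"
    have "inv_totient_ratio d ^ 4 \<le> (\<Prod>p\<in>prime_factors d. 1 + 30 / real p)"
      by (rule inv_totient_ratio_pow4_le)
    also have "\<dots> = (\<Sum>E\<in>Pow (prime_factors d). \<Prod>p\<in>E. 30 / real p)"
      by (rule prod_one_plus_eq_sum_Pow) simp
    also have "\<dots> \<le> (\<Sum>E | E \<in> Pow P \<and> \<Prod>E dvd d. \<Prod>p\<in>E. 30 / real p)"
    proof (rule sum_mono2)
      show "finite {E. E \<in> Pow P \<and> \<Prod>E dvd d}" using finP by simp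
      show "Pow (prime_factors d) \<subseteq> {E. E \<in> Pow P \<and> \<Prod>E dvd d}"
      proof
        fix E assume E: "E \<in> Pow (prime_factors d)"
        then have fE: "finite E" by (auto intro: finite_subset)
        have pE: "prime p" "p dvd d" if "p \<in> E" for p using that E by (auto simp: prime_factors_dvd)
        have "p \<in> P" if "p \<in> E" for p
          using pE[OF that] d unfolding P_def by (auto dest!: dvd_imp_le)
        moreover have "\<Prod>E dvd d"
        proof -
          have "int (\<Prod>E) dvd int d" using pE fE by (subst prod_primes_dvd_iff) auto
          then show ?thesis by (simp only: of_nat_dvd_iff)
        qed
        ultimately show "E \<in> {E. E \<in> Pow P \<and> \<Prod>E dvd d}" by blast
      qed
    qed (auto intro!: prod_nonneg)
    finally show "inv_totient_ratio d ^ 4 \<le> (\<Sum>E | E \<in> Pow P \<and> \<Prod>E dvd d. \<Prod>p\<in>E. 30 / real p)" .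
  qed
  also have "\<dots> = (\<Sum>E\<in>Pow P. \<Sum>d | d \<in> {1..x} \<and> \<Prod>E dvd d. \<Prod>p\<in>E. 30 / real p)"
    by (rule sum.swap_restrict) (use finP in auto)
  also have "\<dots> \<le> (\<Sum>E\<in>Pow P. real x * (\<Prod>p\<in>E. 30 / (real p)\<^sup>2))"
  proof (rule sum_mono)
    fix E assume E: "E \<in> Pow P"
    have pos: "\<Prod>E > 0" using E unfolding P_def by (intro prod_pos) (auto simp: prime_gt_0_nat)
    have "{d \<in> {1..x}. \<Prod>E dvd d} \<subseteq> (\<lambda>j. \<Prod>E * j) ` {1..x div \<Prod>E}"
    proof
      fix d assume d: "d \<in> {d \<in> {1..x}. \<Prod>E dvd d}"
      then obtain j where j: "d = \<Prod>E * j" by (auto elim: dvdE)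
      have "j \<ge> 1" using d j by (cases j) auto
      moreover have "j \<le> x div \<Prod>E" using d pos unfolding j by (simp add: less_eq_div_iff_mult_less_eq mult.commute del: prod_pos_nat_iff)
      ultimately show "d \<in> (\<lambda>j. \<Prod>E * j) ` {1..x div \<Prod>E}" using j by (intro image_eqI[of _ _ j]) auto
    qed
    then have "card {d \<in> {1..x}. \<Prod>E dvd d} \<le> card {1..x div \<Prod>E}" by (rule surj_card_le[rotated]) simp
    then have "real (card {d \<in> {1..x}. \<Prod>E dvd d}) \<le> real (x div \<Prod>E)" by simp
    also have "\<dots> \<le> real x / real (\<Prod>E)" by (rule of_nat_div_le_of_nat)
    finally have "real (card {d \<in> {1..x}. \<Prod>E dvd d}) * (\<Prod>p\<in>E. 30 / real p) \<le> real x / real (\<Prod>E) * (\<Prod>p\<in>E. 30 / real p)"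
      by (rule mult_right_mono) (auto intro: prod_nonneg)
    also have "\<dots> = real x * (\<Prod>p\<in>E. 30 / (real p)\<^sup>2)"
      by (simp add: prod_dividef power2_eq_square prod.distrib)
    finally show "(\<Sum>d | d \<in> {1..x} \<and> \<Prod>E dvd d. \<Prod>p\<in>E. 30 / real p) \<le> real x * (\<Prod>p\<in>E. 30 / (real p)\<^sup>2)"
      by simp
  qed
  also have "\<dots> = real x * (\<Prod>p\<in>P. 1 + 30 / (real p)\<^sup>2)"
    unfolding sum_distrib_left[symmetric] by (subst prod_one_plus_eq_sum_Pow[OF finP]) simp
  also have "\<dots> \<le> real x * exp 60"
  proof (rule mult_left_mono)
    have "(\<Prod>p\<in>P. 1 + 30 / (real p)\<^sup>2) \<le> (\<Prod>p\<in>P. exp (30 / (real p)\<^sup>2))"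
      by (intro prod_mono conjI exp_ge_add_one_self) auto
    also have "\<dots> = exp (\<Sum>p\<in>P. 30 / (real p)\<^sup>2)" by (simp add: exp_sum finP)
    also have "\<dots> \<le> exp 60"
    proof -
      have "(\<Sum>p\<in>P. 1 / (real p)\<^sup>2) \<le> (\<Sum>k=1..x. 1 / (real k)\<^sup>2)"
        by (rule sum_mono2) (auto simp: P_def dest: prime_ge_1_nat)
      then have "(\<Sum>p\<in>P. 1 / (real p)\<^sup>2) \<le> 2" using sum_inverse_squares_le[of x] by linarith
      moreover have "(\<Sum>p\<in>P. 30 / (real p)\<^sup>2) = 30 * (\<Sum>p\<in>P. 1 / (real p)\<^sup>2)" by (simp add: sum_distrib_left)
      ultimately show ?thesis by simp
    qed
    finally show "(\<Prod>p\<in>P. 1 + 30 / (real p)\<^sup>2) \<le> exp 60" .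
  qed simp
  finally show ?thesis by (simp add: mult.commute)
qed

section \<open>Counting differences of primes\<close>

definition prime_diffs :: "nat \<Rightarrow> nat set" where
  "prime_diffs N = {nth_prime m - nth_prime n | m n. 1 \<le> n \<and> n < m \<and> m \<le> N}"

lemma nth_prime_odd:
  assumes "n \<ge> 2" shows "odd (nth_prime n)"
proof -
  have "nth_prime 1 < nth_prime n" using assms by (subst nth_prime_less_iff) auto
  then have "nth_prime n > 2" using prime_ge_2_nat[OF prime_nth_prime[of 1]] by linarith
  then show ?thesis using prime_odd_nat[OF prime_nth_prime] by blast
qed

text \<open>Counting pairs of primes by their difference and inserting the sieve bound shows that (d
  / phi(d))^2 sums to at least a constant times X over the differences. The fourth moment bounds the
  share of the d with ratio above \<open>K\<close>, and the small d are too few to matter. Both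
  restrictions secure many coprime numerators for each denominator.\<close>

lemma many_prime_diffs:
  obtains K \<delta> c :: real where "K \<ge> 1" "\<delta> > 0" "c > 0"
    "\<And>N. N \<ge> 4 \<Longrightarrow> real (card {d \<in> prime_diffs N. inv_totient_ratio d \<le> K \<and> real d \<ge> \<delta> * real (128 * NlogN N)}) \<ge> c * real (128 * NlogN N)"
proof -
  \<comment> \<open>In \<open>c2\<close>, 8 comes from \<open>card Q \<ge> N\<^sup>2 / 8\<close>,
    \<open>128\<^sup>2\<close> from N \<ge> X / (128 ln X), and 1072 from the sieve.
    \<open>K\<close> makes the tail \<open>exp 60 * X / K\<^sup>2\<close> half of
    \<open>c2 * X\<close>; the other half yields \<open>c3\<close>.\<close>
  define c2 where "c2 = 1 / (8 * 128\<^sup>2 * 1072 :: real)"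
  define K where "K = sqrt (2 * exp 60 / c2)"
  define c3 where "c3 = c2 / (2 * K\<^sup>2)"
  have c2: "c2 > 0" "c2 \<le> 1" unfolding c2_def by auto
  have K2: "K\<^sup>2 = 2 * exp 60 / c2" unfolding K_def using c2 by simp
  have "exp 60 \<ge> (1::real)" by simp
  then have "1 * c2 \<le> 2 * exp 60" using c2 by linarith
  then have "2 * exp 60 / c2 \<ge> 1" using c2 by (simp only: pos_le_divide_eq)
  then have K1: "K \<ge> 1" unfolding K_def by simp
  have c3: "c3 > 0" unfolding c3_def using c2 K1 by simp
  show ?thesis
  proof (rule that[of K "c3 / 2" "c3 / 2"])
    fix N :: nat assume N: "N \<ge> 4"
    define X where "X = 128 * NlogN N"
    \<comment> \<open>Starting at index 2 omits the prime 2, so that all differences are even, as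
      the sieve bound requires.\<close>
    define Q where "Q = {(m, n). 2 \<le> n \<and> n < m \<and> m \<le> N}"
    define D where "D = (\<lambda>w. nth_prime (fst w) - nth_prime (snd w)) ` Q"
    let ?L = "ln (real X)"
    have NX: "128 * N \<le> X" unfolding X_def using NlogN_ge(2)[of N] N by simp
    have X2: "X \<ge> 2" using NX N by simp
    have L1: "?L \<ge> 1"
    proof -
      have "exp 1 \<le> real X" using exp_le NX N by (simp add: order_trans[of "exp 1" 3])
      then show ?thesis using X2 by (subst ln_ge_iff) auto
    qed
    have X_le: "real X \<le> 128 * real N * ?L"
    proof -
      have "logm (real N) \<le> ?L" unfolding logm_def using L1 NX N by auto
      then have "real N * logm (real N) \<le> real N * ?L" by (rule mult_left_mono) simp
      then show ?thesis unfolding X_def using NlogN_le[of N] by simp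
    qed
    have prime_le: "nth_prime m \<le> X" if "1 \<le> m" "m \<le> N" for m
    proof -
      have "nth_prime m \<le> nth_prime N"
        using that nth_prime_less_iff[of N m] by (cases "nth_prime m \<le> nth_prime N") auto
      then show ?thesis unfolding X_def using nth_prime_le_NlogN[of N] N by simp
    qed
    have Q_prop: "2 \<le> snd w" "snd w < fst w" "fst w \<le> N" "nth_prime (snd w) < nth_prime (fst w)" if "w \<in> Q" for w
    proof -
      show 1: "2 \<le> snd w" "snd w < fst w" "fst w \<le> N" using that unfolding Q_def by auto
      show "nth_prime (snd w) < nth_prime (fst w)" using 1 by (subst nth_prime_less_iff) auto
    qed
    have D_sub: "D \<subseteq> prime_diffs N"
    proof
      fix d assume "d \<in> D"
      then obtain w where w: "w \<in> Q" "d = nth_prime (fst w) - nth_prime (snd w)" unfolding D_def by auto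
      then show "d \<in> prime_diffs N" unfolding prime_diffs_def
        using Q_prop[OF w(1)] by (intro CollectI exI[of _ "fst w"] exI[of _ "snd w"]) auto
    qed
    have D_prop: "d > 0 \<and> even d \<and> d \<le> X" if dD: "d \<in> D" for d
    proof -
      obtain w where w: "w \<in> Q" "d = nth_prime (fst w) - nth_prime (snd w)" using dD unfolding D_def by auto
      define m n where "m = fst w" "n = snd w"
      have mn: "d = nth_prime m - nth_prime n" "2 \<le> n" "n < m" "m \<le> N" using w Q_prop[OF w(1)] unfolding m_n_def by auto
      have "nth_prime n < nth_prime m" using mn by (subst nth_prime_less_iff) auto
      moreover have "even d" using mn nth_prime_odd[of m] nth_prime_odd[of n] by simp
      moreover have "d \<le> X" using mn prime_le[of m] by simp
      ultimately show ?thesis using mn by simp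
    qed
    have D_X: "D \<subseteq> {1..X}" using D_prop by force
    have finD: "finite D" using D_X finite_subset by blast
    have finQ: "finite Q" unfolding Q_def by (rule finite_subset[of _ "{..N} \<times> {..N}"]) auto
    have cardQ: "real (card Q) = (real N - 1) * (real N - 2) / 2"
    proof -
      have "Q = Sigma {3..N} (\<lambda>m. {2..<m})" unfolding Q_def by auto
      then have "real (card Q) = (\<Sum>m=3..N. real (m - 2))" by (simp add: card_SigmaI)
      also have "\<dots> = (real N - 1) * (real N - 2) / 2"
      proof -
        have "2 \<le> N \<Longrightarrow> (\<Sum>m=3..N. real (m - 2)) = (real N - 1) * (real N - 2) / 2" for N :: nat
        proof (induction N rule: nat_induct_at_least)
          case (Suc n)
          then show ?case by (simp add: of_nat_diff field_simps)
        qed simp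
        then show ?thesis using N by simp
      qed
      finally show ?thesis .
    qed
    have "real (card Q) = (\<Sum>d\<in>D. real (card {w \<in> Q. nth_prime (fst w) - nth_prime (snd w) = d}))"
    proof -
      have "card Q = (\<Sum>d\<in>D. \<Sum>w\<in>{w \<in> Q. nth_prime (fst w) - nth_prime (snd w) = d}. 1)"
        unfolding card_eq_sum
        by (rule sum.group[symmetric, OF finQ finD]) (simp add: D_def)
      then show ?thesis by simp
    qed
    also have "\<dots> \<le> (\<Sum>d\<in>D. 1072 * real X * (inv_totient_ratio d)\<^sup>2 / ?L\<^sup>2)"
    proof (rule sum_mono)
      fix d assume d: "d \<in> D"
      have "card {w \<in> Q. nth_prime (fst w) - nth_prime (snd w) = d} \<le> card {q. prime q \<and> prime (q + d) \<and> q \<le> X}"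
      proof (rule card_inj_on_le)
        show "inj_on (\<lambda>w. nth_prime (snd w)) {w \<in> Q. nth_prime (fst w) - nth_prime (snd w) = d}"
        proof (rule inj_onI)
          fix w w' assume w: "w \<in> {w \<in> Q. nth_prime (fst w) - nth_prime (snd w) = d}"
            "w' \<in> {w \<in> Q. nth_prime (fst w) - nth_prime (snd w) = d}" "nth_prime (snd w) = nth_prime (snd w')"
          have wQ: "w \<in> Q" "w' \<in> Q" using w by auto
          have "nth_prime (fst w) = nth_prime (fst w')"
            using w Q_prop(4)[OF wQ(1)] Q_prop(4)[OF wQ(2)] by auto
          then have "fst w = fst w'"
            using Q_prop[OF wQ(1)] Q_prop[OF wQ(2)] by (subst nth_prime_eq_iff[symmetric]) auto
          moreover have "snd w = snd w'"
            using w(3) Q_prop[OF wQ(1)] Q_prop[OF wQ(2)] by (subst nth_prime_eq_iff[symmetric]) auto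
          ultimately show "w = w'" by (rule prod_eqI)
        qed
        show "(\<lambda>w. nth_prime (snd w)) ` {w \<in> Q. nth_prime (fst w) - nth_prime (snd w) = d} \<subseteq> {q. prime q \<and> prime (q + d) \<and> q \<le> X}"
        proof
          fix q assume "q \<in> (\<lambda>w. nth_prime (snd w)) ` {w \<in> Q. nth_prime (fst w) - nth_prime (snd w) = d}"
          then obtain w where w: "w \<in> Q" "nth_prime (fst w) - nth_prime (snd w) = d" "q = nth_prime (snd w)" by auto
          have "q + d = nth_prime (fst w)" using w Q_prop(4)[OF w(1)] by simp
          moreover have "q \<le> X" unfolding w(3) using Q_prop[OF w(1)] by (intro prime_le) auto
          ultimately show "q \<in> {q. prime q \<and> prime (q + d) \<and> q \<le> X}" using w prime_nth_prime by simp
        qed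
      qed simp
      then have "real (card {w \<in> Q. nth_prime (fst w) - nth_prime (snd w) = d}) \<le> real (card {q. prime q \<and> prime (q + d) \<and> q \<le> X})" by simp
      also have "\<dots> \<le> 1072 * real X * (inv_totient_ratio d)\<^sup>2 / ?L\<^sup>2"
        using D_prop[OF d] X2 by (intro prime_pairs_le) auto
      finally show "real (card {w \<in> Q. nth_prime (fst w) - nth_prime (snd w) = d}) \<le> 1072 * real X * (inv_totient_ratio d)\<^sup>2 / ?L\<^sup>2" .
    qed
    also have "\<dots> = 1072 * real X / ?L\<^sup>2 * (\<Sum>d\<in>D. (inv_totient_ratio d)\<^sup>2)"
      by (simp add: sum_distrib_left)
    finally have 1: "(real N - 1) * (real N - 2) / 2 \<le> 1072 * real X / ?L\<^sup>2 * (\<Sum>d\<in>D. (inv_totient_ratio d)\<^sup>2)"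
      unfolding cardQ .
    have "c2 * real X \<le> (\<Sum>d\<in>D. (inv_totient_ratio d)\<^sup>2)"
    proof -
      have "real X / (128 * ?L) \<le> real N" using X_le L1 by (simp add: pos_divide_le_eq mult_ac)
      then have "(real X / (128 * ?L))\<^sup>2 \<le> (real N)\<^sup>2" using L1 by (intro power_mono) auto
      also have "(real N)\<^sup>2 / 8 \<le> (real N - 1) * (real N - 2) / 2"
      proof -
        have "4 * real N \<le> real N * real N" using N by (intro mult_right_mono) auto
        then show ?thesis by (simp add: power2_eq_square algebra_simps)
      qed
      finally have "(real X / (128 * ?L))\<^sup>2 / 8 \<le> 1072 * real X / ?L\<^sup>2 * (\<Sum>d\<in>D. (inv_totient_ratio d)\<^sup>2)"
        using 1 by simp
      moreover have "(real X / (128 * ?L))\<^sup>2 / 8 = 1072 * real X / ?L\<^sup>2 * (c2 * real X)"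
        unfolding c2_def by (simp add: power_divide power_mult_distrib power2_eq_square)
      ultimately have "1072 * real X / ?L\<^sup>2 * (c2 * real X) \<le> 1072 * real X / ?L\<^sup>2 * (\<Sum>d\<in>D. (inv_totient_ratio d)\<^sup>2)"
        by simp
      moreover have "1072 * real X / ?L\<^sup>2 > 0" using X2 L1 by simp
      ultimately show ?thesis by (simp only: mult_le_cancel_left_pos)
    qed
    \<comment> \<open>Where the ratio exceeds \<open>K\<close>, its square is at most its fourth
      power divided by \<open>K\<^sup>2\<close>.\<close>
    also have "(\<Sum>d\<in>D. (inv_totient_ratio d)\<^sup>2) \<le> (\<Sum>d\<in>D. (if inv_totient_ratio d \<le> K then K\<^sup>2 else 0) + inv_totient_ratio d ^ 4 / K\<^sup>2)"
    proof (rule sum_mono)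
      fix d
      let ?f = "inv_totient_ratio d"
      have f: "?f \<ge> 1" by (rule inv_totient_ratio_ge_1)
      show "?f\<^sup>2 \<le> (if ?f \<le> K then K\<^sup>2 else 0) + ?f ^ 4 / K\<^sup>2"
      proof (cases "?f \<le> K")
        case True
        then have "?f\<^sup>2 \<le> K\<^sup>2" using f by (intro power_mono) auto
        moreover have "0 \<le> ?f ^ 4 / K\<^sup>2" by simp
        ultimately have "?f\<^sup>2 \<le> K\<^sup>2 + ?f ^ 4 / K\<^sup>2" by linarith
        then show ?thesis using True by simp
      next
        case False
        then have "K\<^sup>2 \<le> ?f\<^sup>2" using K1 by (intro power_mono) auto
        then have "?f\<^sup>2 * K\<^sup>2 \<le> ?f\<^sup>2 * ?f\<^sup>2" by (intro mult_left_mono) auto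
        also have "\<dots> = ?f ^ 4" by (simp flip: power_add)
        finally show ?thesis using False K1 by (simp add: pos_le_divide_eq)
      qed
    qed
    also have "\<dots> = K\<^sup>2 * real (card {d \<in> D. inv_totient_ratio d \<le> K}) + (\<Sum>d\<in>D. inv_totient_ratio d ^ 4) / K\<^sup>2"
      using finD by (simp add: sum.distrib sum.inter_filter[symmetric] sum_divide_distrib)
    also have "\<dots> \<le> K\<^sup>2 * real (card {d \<in> D. inv_totient_ratio d \<le> K}) + c2 / 2 * real X"
    proof -
      have "(\<Sum>d\<in>D. inv_totient_ratio d ^ 4) \<le> (\<Sum>d=1..X. inv_totient_ratio d ^ 4)"
        using D_X by (intro sum_mono2) auto
      also have "\<dots> \<le> exp 60 * real X" by (rule sum_inv_totient_ratio_pow4_le)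
      finally have "(\<Sum>d\<in>D. inv_totient_ratio d ^ 4) / K\<^sup>2 \<le> exp 60 * real X / K\<^sup>2" by (rule divide_right_mono) simp
      also have "\<dots> = c2 / 2 * real X" unfolding K2 using c2 by simp
      finally show ?thesis by simp
    qed
    finally have "c2 / 2 * real X \<le> K\<^sup>2 * real (card {d \<in> D. inv_totient_ratio d \<le> K})" by simp
    then have A: "c3 * real X \<le> real (card {d \<in> D. inv_totient_ratio d \<le> K})"
      unfolding c3_def using K1 by (simp add: field_simps)
    \<comment> \<open>Discarding the d below \<open>c3 / 2 * X\<close> loses at most half of the
      lower bound \<open>A\<close>.\<close>
    have "{d \<in> D. inv_totient_ratio d \<le> K} \<subseteq> {d \<in> prime_diffs N. inv_totient_ratio d \<le> K \<and> real d \<ge> c3 / 2 * real X} \<union> {1..nat \<lfloor>c3 / 2 * real X\<rfloor>}"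
    proof
      fix d assume d: "d \<in> {d \<in> D. inv_totient_ratio d \<le> K}"
      show "d \<in> {d \<in> prime_diffs N. inv_totient_ratio d \<le> K \<and> real d \<ge> c3 / 2 * real X} \<union> {1..nat \<lfloor>c3 / 2 * real X\<rfloor>}"
      proof (cases "real d \<ge> c3 / 2 * real X")
        case True
        then show ?thesis using d D_sub by auto
      next
        case False
        then have "d \<le> nat \<lfloor>c3 / 2 * real X\<rfloor>" by (simp add: le_nat_floor)
        then show ?thesis using d D_X by auto
      qed
    qed
    moreover have finS: "finite {d \<in> prime_diffs N. inv_totient_ratio d \<le> K \<and> real d \<ge> c3 / 2 * real X}"
    proof (rule finite_subset)
      show "{d \<in> prime_diffs N. inv_totient_ratio d \<le> K \<and> real d \<ge> c3 / 2 * real X} \<subseteq> {..X}"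
        using prime_le unfolding prime_diffs_def by (auto intro: order_trans[OF diff_le_self])
    qed simp
    ultimately have "card {d \<in> D. inv_totient_ratio d \<le> K} \<le> card ({d \<in> prime_diffs N. inv_totient_ratio d \<le> K \<and> real d \<ge> c3 / 2 * real X} \<union> {1..nat \<lfloor>c3 / 2 * real X\<rfloor>})"
      by (intro card_mono) auto
    also have "\<dots> \<le> card {d \<in> prime_diffs N. inv_totient_ratio d \<le> K \<and> real d \<ge> c3 / 2 * real X} + card {1..nat \<lfloor>c3 / 2 * real X\<rfloor>}"
      by (rule card_Un_le)
    finally have "real (card {d \<in> D. inv_totient_ratio d \<le> K}) \<le> real (card {d \<in> prime_diffs N. inv_totient_ratio d \<le> K \<and> real d \<ge> c3 / 2 * real X}) + real (nat \<lfloor>c3 / 2 * real X\<rfloor>)"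
      by simp
    moreover have "real (nat \<lfloor>c3 / 2 * real X\<rfloor>) \<le> c3 / 2 * real X" using c3 by (intro of_nat_floor) simp
    ultimately show "c3 / 2 * real (128 * NlogN N) \<le> real (card {d \<in> prime_diffs N. inv_totient_ratio d \<le> K \<and> c3 / 2 * real (128 * NlogN N) \<le> real d})"
      using A unfolding X_def by linarith
  qed (use K1 c3 in auto)
qed

subsection \<open>Limsup sets of balls around separated points\<close>

text \<open>Cut the line into half-open cells of length \<open>s\<close> starting at
  \<open>u\<close>: no cell contains two points of \<open>A\<close>.\<close>

lemma card_separated_le:
  fixes A :: "real set" and s u v :: real
  assumes s: "s > 0" and uv: "u \<le> v"
    and sep: "\<And>a b. a \<in> A \<Longrightarrow> b \<in> A \<Longrightarrow> a \<noteq> b \<Longrightarrow> \<bar>a - b\<bar> \<ge> s"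
  shows "finite (A \<inter> {u..v})" "real (card (A \<inter> {u..v})) \<le> 1 + (v - u) / s"
proof -
  let ?f = "\<lambda>t. \<lfloor>(t - u) / s\<rfloor>"
  have inj: "inj_on ?f (A \<inter> {u..v})"
  proof (rule inj_onI, rule ccontr)
    fix a b assume ab: "a \<in> A \<inter> {u..v}" "b \<in> A \<inter> {u..v}" "?f a = ?f b" "a \<noteq> b"
    have "\<bar>(a - u) / s - (b - u) / s\<bar> < 1" using ab(3) by linarith
    moreover have "(a - u) / s - (b - u) / s = (a - b) / s" by (simp add: diff_divide_distrib)
    ultimately have "\<bar>a - b\<bar> < s" using s by (simp add: divide_less_eq)
    then show False using sep[of a b] ab by auto
  qed
  have sub: "?f ` (A \<inter> {u..v}) \<subseteq> {0..?f v}"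
    using s by (auto intro!: floor_mono divide_right_mono)
  show "finite (A \<inter> {u..v})"
    using inj sub by (meson finite_atLeastAtMost_int finite_imageD finite_subset)
  have "card (A \<inter> {u..v}) \<le> card {0..?f v}"
    by (rule card_inj_on_le[OF inj sub]) simp
  then have "real (card (A \<inter> {u..v})) \<le> real (nat (?f v + 1))" by simp
  also have "\<dots> = of_int (?f v) + 1" using s uv by simp
  also have "\<dots> \<le> 1 + (v - u) / s" by linarith
  finally show "real (card (A \<inter> {u..v})) \<le> 1 + (v - u) / s" .
qed

section \<open>Second moments and coverings\<close>

text \<open>Cauchy-Schwarz for the counting function X of the sets, in linearised form: 0 \<le> (s X
  - 1)^2 on the union and X = 0 off it give, after integration, the inequality \<open>key\<close>
  for every s.\<close>

lemma chung_erdos: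
  fixes F :: "'i \<Rightarrow> 'a set"
  assumes K: "finite K" and F: "\<And>k. k \<in> K \<Longrightarrow> F k \<in> fmeasurable M"
  shows "(\<Sum>k\<in>K. measure M (F k))\<^sup>2 \<le> (\<Sum>j\<in>K. \<Sum>k\<in>K. measure M (F j \<inter> F k)) * measure M (\<Union>k\<in>K. F k)"
proof -
  let ?U = "\<Union>k\<in>K. F k"
  define m1 where "m1 = (\<Sum>k\<in>K. measure M (F k))"
  define m2 where "m2 = (\<Sum>j\<in>K. \<Sum>k\<in>K. measure M (F j \<inter> F k))"
  have U: "?U \<in> fmeasurable M" using K F by (intro fmeasurable.finite_UN) auto
  have int: "integrable M (\<lambda>x. indicator S x :: real)" if "S \<in> fmeasurable M" for S
    using that by (auto simp: fmeasurable_def)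
  have FF: "F j \<inter> F k \<in> fmeasurable M" if "j \<in> K" "k \<in> K" for j k
    using F that by (intro fmeasurable.Int) auto
  have m: "(\<integral>x. indicator S x \<partial>M) = measure M S" if "S \<in> fmeasurable M" for S
    using that by (simp add: fmeasurableD sets.Int_space_eq2)
  have key: "2 * s * m1 \<le> s\<^sup>2 * m2 + measure M ?U" for s :: real
  proof -
    have "2 * s * m1 = (\<integral>x. 2 * s * (\<Sum>k\<in>K. indicator (F k) x) \<partial>M)"
      unfolding m1_def using F int m by simp
    also have "\<dots> \<le> (\<integral>x. s\<^sup>2 * (\<Sum>j\<in>K. \<Sum>k\<in>K. indicator (F j \<inter> F k) x) + indicator ?U x \<partial>M)"
    proof (rule integral_mono)
      show "integrable M (\<lambda>x. 2 * s * (\<Sum>k\<in>K. indicator (F k) x))"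
        using F int by (intro integrable_mult_right integrable_sum) auto
      show "integrable M (\<lambda>x. s\<^sup>2 * (\<Sum>j\<in>K. \<Sum>k\<in>K. indicator (F j \<inter> F k) x) + indicator ?U x)"
        using FF U int by (intro Bochner_Integration.integrable_add integrable_mult_right integrable_sum) auto
      fix x
      define X where "X = (\<Sum>k\<in>K. indicator (F k) x :: real)"
      have "(\<Sum>j\<in>K. \<Sum>k\<in>K. indicator (F j \<inter> F k) x :: real) = X\<^sup>2"
        unfolding X_def power2_eq_square sum_product by (simp add: indicator_inter_arith)
      moreover have "2 * s * X \<le> s\<^sup>2 * X\<^sup>2 + indicator ?U x"
      proof (cases "x \<in> ?U")
        case True
        have "0 \<le> (s * X - 1)\<^sup>2" by simp
        then show ?thesis using True by (simp add: power2_diff power_mult_distrib)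
      next
        case False
        then have "X = 0" unfolding X_def by (intro sum.neutral) auto
        then show ?thesis by simp
      qed
      ultimately show "2 * s * (\<Sum>k\<in>K. indicator (F k) x) \<le> s\<^sup>2 * (\<Sum>j\<in>K. \<Sum>k\<in>K. indicator (F j \<inter> F k) x) + indicator ?U x"
        unfolding X_def by simp
    qed
    also have "\<dots> = s\<^sup>2 * m2 + measure M ?U"
    proof -
      have "(\<integral>x. (\<Sum>j\<in>K. \<Sum>k\<in>K. indicator (F j \<inter> F k) x) \<partial>M) = m2"
      proof -
        have "(\<integral>x. (\<Sum>j\<in>K. \<Sum>k\<in>K. (indicator (F j \<inter> F k) x :: real)) \<partial>M) = (\<Sum>j\<in>K. \<integral>x. (\<Sum>k\<in>K. (indicator (F j \<inter> F k) x :: real)) \<partial>M)"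
          using FF int by (intro Bochner_Integration.integral_sum Bochner_Integration.integrable_sum) auto
        also have "\<dots> = (\<Sum>j\<in>K. \<Sum>k\<in>K. \<integral>x. (indicator (F j \<inter> F k) x :: real) \<partial>M)"
          using FF int by (intro sum.cong refl Bochner_Integration.integral_sum) auto
        also have "\<dots> = m2" unfolding m2_def by (intro sum.cong refl m FF)
        finally show ?thesis .
      qed
      moreover have "integrable M (\<lambda>x. \<Sum>j\<in>K. \<Sum>k\<in>K. indicator (F j \<inter> F k) x :: real)"
        using FF int by (intro Bochner_Integration.integrable_sum) auto
      ultimately show ?thesis using U int m by simp
    qed
    finally show ?thesis .
  qed
  have m2: "m2 \<ge> 0" unfolding m2_def by (intro sum_nonneg) simp
  show ?thesis
  proof (cases "m2 = 0")
    case True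
    \<comment> \<open>The diagonal terms alone majorise \<open>m1\<close>, so a vanishing second
      moment forces \<open>m1 = 0\<close>.\<close>
    have "m1 \<le> m2" unfolding m1_def m2_def
    proof (rule sum_mono)
      fix k assume "k \<in> K"
      then show "measure M (F k) \<le> (\<Sum>j\<in>K. measure M (F k \<inter> F j))"
        using member_le_sum[of k K "\<lambda>j. measure M (F k \<inter> F j)"] K by simp
    qed
    moreover have "m1 \<ge> 0" unfolding m1_def by (intro sum_nonneg) simp
    ultimately show ?thesis using True unfolding m1_def m2_def by simp
  next
    case False
    then have "m2 > 0" using m2 by simp
    \<comment> \<open>The optimal parameter in \<open>key\<close> is \<open>m1 / m2\<close>.\<close>
    then have "m1\<^sup>2 \<le> m2 * measure M ?U"
      using key[of "m1 / m2"] by (simp add: field_simps power2_eq_square)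
    then show ?thesis unfolding m1_def m2_def .
  qed
qed

text \<open>This replaces the density theorem. If the complement had measure \<open>b > 0\<close>,
  it would lie in an open set exceeding it by less than \<open>c * b\<close>. Disjoint balls inside
  that open set cover the complement up to a null set, and \<open>L\<close> occupies at least
  \<open>c * b\<close> of them, which is too much.\<close>

lemma null_complement_if_positive_proportion:
  fixes L :: "real set" and c :: real
  assumes L: "L \<in> sets lebesgue" and c: "c > 0"
    and dens: "\<And>u v. 0 \<le> u \<Longrightarrow> u < v \<Longrightarrow> v \<le> 1 \<Longrightarrow> emeasure lebesgue (L \<inter> {u..v}) \<ge> ennreal (c * (v - u))"
  shows "{0..1} - L \<in> null_sets lebesgue"
proof -
  \<comment> \<open>Without the endpoints every point of \<open>B\<close> has small balls inside the
    unit interval, where \<open>dens\<close> applies.\<close>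
  define B where "B = {0<..<1} - L"
  have B: "B \<in> sets lebesgue" unfolding B_def using L by auto
  have Bfin: "emeasure lebesgue B \<le> 1"
  proof -
    have "emeasure lebesgue B \<le> emeasure lebesgue {0..1::real}"
      unfolding B_def by (intro emeasure_mono) auto
    then show ?thesis by simp
  qed
  have "emeasure lebesgue B = 0"
  proof (rule ccontr)
    assume "emeasure lebesgue B \<noteq> 0"
    define b where "b = measure lebesgue B"
    have b: "emeasure lebesgue B = ennreal b"
      unfolding b_def using Bfin by (intro emeasure_eq_ennreal_measure) (auto simp: top_unique)
    have b0: "b > 0" using \<open>emeasure lebesgue B \<noteq> 0\<close> b by (metis ennreal_eq_0_iff not_le)
    obtain T where T: "open T" "B \<subseteq> T" "T - B \<in> lmeasurable" "emeasure lebesgue (T - B) < ennreal (c * b)"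
      by (rule sets_lebesgue_outer_open[OF B, of "c * b"]) (use b0 c in auto)
    define T' where "T' = T \<inter> {0<..<1}"
    have T': "open T'" "B \<subseteq> T'" unfolding T'_def using T by (auto simp: B_def)
    define K where "K = {p :: real \<times> real. snd p > 0 \<and> cball (fst p) (snd p) \<subseteq> T'}"
    have K0: "0 < snd i" if "i \<in> K" for i using that unfolding K_def by simp
    have cover: "\<exists>i. i \<in> K \<and> x \<in> cball (fst i) (snd i) \<and> snd i < d" if "x \<in> B" "0 < d" for x d
    proof -
      obtain e where e: "e > 0" "cball x e \<subseteq> T'" using T' \<open>x \<in> B\<close> by (meson open_contains_cball subsetD)
      have "cball x (min e (d/2)) \<subseteq> T'" using e(2) by (meson min.cobounded1 order_trans subset_cball)
      then have "(x, min e (d/2)) \<in> K" unfolding K_def using e that by simp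
      then show ?thesis using e that by (intro exI[of _ "(x, min e (d/2))"]) auto
    qed
    obtain C where C: "countable C" "C \<subseteq> K"
       "pairwise (\<lambda>i j. disjnt (cball (fst i) (snd i)) (cball (fst j) (snd j))) C"
       "negligible (B - (\<Union>i\<in>C. cball (fst i) (snd i)))"
      by (rule Vitali_covering_theorem_cballs[OF K0 cover])
    let ?I = "\<lambda>i. cball (fst i) (snd i) :: real set"
    let ?V = "\<Union>i\<in>C. ?I i"
    have disj: "disjoint_family_on ?I C" "disjoint_family_on (\<lambda>i. L \<inter> ?I i) C"
      using C(3) unfolding disjoint_family_on_def pairwise_def disjnt_def by blast+
    have "ennreal b \<le> emeasure lebesgue ?V"
    proof -
      have V: "?V \<in> sets lebesgue" using C(1) by (intro sets.countable_UN') auto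
      have "emeasure lebesgue B \<le> emeasure lebesgue (?V \<union> (B - ?V))"
        using V B by (intro emeasure_mono) auto
      also have "\<dots> = emeasure lebesgue ?V"
        using C(4) V by (intro emeasure_Un_null_set) (auto simp: negligible_iff_null_sets)
      finally show ?thesis using b by simp
    qed
    then have "ennreal c * ennreal b \<le> ennreal c * emeasure lebesgue ?V" by (rule mult_left_mono) simp
    also have "\<dots> = (\<integral>\<^sup>+i. ennreal c * emeasure lebesgue (?I i) \<partial>count_space C)"
      using C(1) disj by (subst emeasure_UN_countable) (auto simp: nn_integral_cmult)
    also have "\<dots> \<le> (\<integral>\<^sup>+i. emeasure lebesgue (L \<inter> ?I i) \<partial>count_space C)"
    proof (rule nn_integral_mono)
      fix i assume "i \<in> space (count_space C)"
      then have i: "snd i > 0" "?I i \<subseteq> {0<..<1}" using C(2) unfolding K_def T'_def by auto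
      have I: "?I i = {fst i - snd i..fst i + snd i}" by (rule cball_eq_atLeastAtMost)
      have "0 \<le> fst i - snd i" "fst i + snd i \<le> 1"
        using subsetD[OF i(2)[unfolded I], of "fst i - snd i"] subsetD[OF i(2)[unfolded I], of "fst i + snd i"] i(1)
        by auto
      then show "ennreal c * emeasure lebesgue (?I i) \<le> emeasure lebesgue (L \<inter> ?I i)"
        using dens[of "fst i - snd i" "fst i + snd i"] i c unfolding I by (simp add: ennreal_mult[symmetric])
    qed
    also have "\<dots> = emeasure lebesgue (\<Union>i\<in>C. L \<inter> ?I i)"
      using C(1) disj L by (subst emeasure_UN_countable) auto
    also have "\<dots> \<le> emeasure lebesgue (T - B)"
    proof (rule emeasure_mono)
      have "?I i \<subseteq> T" if "i \<in> C" for i using that C(2) unfolding K_def T'_def by blast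
      then show "(\<Union>i\<in>C. L \<inter> ?I i) \<subseteq> T - B" unfolding B_def by blast
    qed (use T(3) in auto)
    also have "\<dots> < ennreal (c * b)" by (rule T)
    finally show False using c b0 by (simp add: ennreal_mult)
  qed
  then have "B \<in> null_sets lebesgue" using B by auto
  moreover have "{0,1::real} \<in> null_sets lebesgue"
    by (metis finite.emptyI finite.insertI negligible_finite negligible_iff_null_sets)
  ultimately have "B \<union> {0,1} \<in> null_sets lebesgue" by (rule null_sets.Un)
  moreover have "{0..1} - L \<in> sets lebesgue" using L by auto
  moreover have "{0..1} - L \<subseteq> B \<union> {0,1}" unfolding B_def by auto
  ultimately show ?thesis by (rule null_sets_subset)
qed


text \<open>In a fixed interval the balls of a late level k fill a proportion of order
  \<open>t k = r k * (X k)\<^sup>2\<close>. Two levels overlap like independent sets, except for a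
  bounded excess in the number of centres near a given centre; its contribution decays like 4^-(k-j)
  because X at least doubles. Once the \<open>t k\<close> sum to more than 4 the independent part
  dominates, and the second moment method works beyond any index.\<close>

theorem limsup_balls_full_measure:
  fixes A :: "nat \<Rightarrow> real set" and X r :: "nat \<Rightarrow> real" and c :: real
  assumes fin: "\<And>k. finite (A k)"
    and X_pos: "\<And>k. X k > 0" and X_Suc: "\<And>k. 2 * X k \<le> X (Suc k)"
    and r_nonneg: "\<And>k. r k \<ge> 0" and r_le: "\<And>k. r k * (X k)\<^sup>2 \<le> 1 / 4"
    and div: "\<not> summable (\<lambda>k. r k * (X k)\<^sup>2)"
    and sep: "\<And>k a b. a \<in> A k \<Longrightarrow> b \<in> A k \<Longrightarrow> a \<noteq> b \<Longrightarrow> \<bar>a - b\<bar> \<ge> 1 / (X k)\<^sup>2"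
    and c: "c > 0"
    and count: "\<And>u v. 0 \<le> u \<Longrightarrow> u < v \<Longrightarrow> v \<le> 1 \<Longrightarrow>
      eventually (\<lambda>k. real (card (A k \<inter> {u..v})) \<ge> c * (v - u) * (X k)\<^sup>2) sequentially"
  shows "{0..1} - {\<alpha>. \<exists>\<^sub>\<infinity>k. \<exists>a\<in>A k. \<bar>\<alpha> - a\<bar> \<le> r k} \<in> null_sets lebesgue"
proof -
  define \<Lambda> where "\<Lambda> = {\<alpha>. \<exists>\<^sub>\<infinity>k. \<exists>a\<in>A k. \<bar>\<alpha> - a\<bar> \<le> r k}"
  define t where "t k = r k * (X k)\<^sup>2" for k
  have t0: "t k \<ge> 0" for k unfolding t_def using r_nonneg by simp
  have ball_eq: "{a - r k..a + r k} = {\<alpha>. \<bar>\<alpha> - a\<bar> \<le> r k}" for a k by auto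
  have \<Lambda>_eq: "\<Lambda> = (\<Inter>m. \<Union>k\<in>{m..}. \<Union>a\<in>A k. {a - r k..a + r k})"
    unfolding \<Lambda>_def INFM_nat_le ball_eq by (auto simp: Bex_def)
  have \<Lambda>_sets: "\<Lambda> \<in> sets lebesgue"
    unfolding \<Lambda>_eq using fin by (intro sets.countable_INT'' sets.countable_UN' sets.finite_UN) auto
  have X_growth: "X j * 2 ^ (k - j) \<le> X k" if "j \<le> k" for j k
    using that
  proof (induction k rule: dec_induct)
    case base then show ?case by simp
  next
    case (step k)
    have "X j * 2 ^ (Suc k - j) = 2 * (X j * 2 ^ (k - j))" using step.hyps by (simp add: Suc_diff_le)
    then show ?case using step.IH X_Suc[of k] by linarith
  qed
  \<comment> \<open>The constant \<open>c\<^sup>2 / 64\<close> does not depend on \<open>u\<close>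
    and \<open>v\<close>, as the covering argument requires.\<close>
  have local: "emeasure lebesgue (\<Lambda> \<inter> {u..v}) \<ge> ennreal (c\<^sup>2 / 64 * (v - u))" if uv: "0 \<le> u" "u < v" "v \<le> 1" for u v
  proof -
    define l where "l = v - u"
    have l: "l > 0" using uv by (simp add: l_def)
    \<comment> \<open>Only centres in the middle half are kept, so that for large \<open>k\<close>
      the intervals around them stay inside \<open>{u..v}\<close>.\<close>
    define B where "B k = A k \<inter> {u + l / 4..v - l / 4}" for k
    define I where "I k a = {a - r k..a + r k}" for k a
    define F where "F k = (\<Union>a\<in>B k. I k a)" for k
    have finB: "finite (B k)" for k unfolding B_def using fin by auto
    have Fm: "F k \<in> lmeasurable" for k
      unfolding F_def I_def using finB by (intro fmeasurable.finite_UN) auto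
    have "\<exists>k0. \<forall>k\<ge>k0. real (card (B k)) \<ge> c * (l / 2) * (X k)\<^sup>2 \<and> l * (X k)\<^sup>2 \<ge> 1"
    proof -
      obtain k1 where k1: "1 / (l * (X 0)\<^sup>2) < 4 ^ k1" using real_arch_pow[of 4] by auto
      have "eventually (\<lambda>k. l * (X 0)\<^sup>2 * 4 ^ k \<ge> 1) sequentially"
      proof (rule eventually_sequentiallyI[of k1])
        fix k assume "k1 \<le> k"
        then have "(4::real) ^ k1 \<le> 4 ^ k" by (intro power_increasing) auto
        then have "1 / (l * (X 0)\<^sup>2) \<le> 4 ^ k" using k1 by linarith
        then show "l * (X 0)\<^sup>2 * 4 ^ k \<ge> 1" using l X_pos[of 0] by (simp add: field_simps)
      qed
      then have "eventually (\<lambda>k. l * (X k)\<^sup>2 \<ge> 1) sequentially"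
      proof eventually_elim
        case (elim k)
        have "(X 0 * 2 ^ k)\<^sup>2 \<le> (X k)\<^sup>2" using X_growth[of 0 k] X_pos[of 0] by (intro power_mono) auto
        then have "l * (X 0 * 2 ^ k)\<^sup>2 \<le> l * (X k)\<^sup>2" using l by simp
        moreover have "(X 0 * 2 ^ k)\<^sup>2 = (X 0)\<^sup>2 * 4 ^ k"
          by (simp add: power_mult_distrib power2_eq_square flip: power_mult_distrib)
        ultimately show ?case using elim by (simp add: mult.assoc)
      qed
      moreover have "eventually (\<lambda>k. real (card (B k)) \<ge> c * (l / 2) * (X k)\<^sup>2) sequentially"
      proof -
        have e: "v - l / 4 - (u + l / 4) = l / 2" by (simp add: l_def field_simps)
        have "0 \<le> u + l / 4" "u + l / 4 < v - l / 4" "v - l / 4 \<le> 1"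
          using uv e l by auto
        from count[OF this] show ?thesis unfolding e B_def .
      qed
      ultimately have "eventually (\<lambda>k. real (card (B k)) \<ge> c * (l / 2) * (X k)\<^sup>2 \<and> l * (X k)\<^sup>2 \<ge> 1) sequentially"
        by (rule eventually_conj[rotated])
      then show ?thesis unfolding eventually_sequentially .
    qed
    then obtain k0 where k0: "\<And>k. k \<ge> k0 \<Longrightarrow> real (card (B k)) \<ge> c * (l / 2) * (X k)\<^sup>2"
        "\<And>k. k \<ge> k0 \<Longrightarrow> l * (X k)\<^sup>2 \<ge> 1" by blast
    have r_small: "r k \<le> 1 / (4 * (X k)\<^sup>2)" for k
      using r_le[of k] X_pos[of k] by (simp add: field_simps)
    have card_le: "real (card (A k \<inter> {p..q})) \<le> 1 + (q - p) * (X k)\<^sup>2" if "p \<le> q" for k p q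
      using card_separated_le(2)[of "1 / (X k)\<^sup>2" p q "A k"] sep X_pos[of k] that by simp
    have cardB: "real (card (B k)) \<le> 2 * l * (X k)\<^sup>2" if "k \<ge> k0" for k
    proof -
      have "real (card (B k)) \<le> 1 + (v - l / 4 - (u + l / 4)) * (X k)\<^sup>2"
        unfolding B_def by (rule card_le) (use l in \<open>simp add: l_def field_simps\<close>)
      also have "v - l / 4 - (u + l / 4) = l / 2" by (simp add: l_def field_simps)
      also have "1 + l / 2 * (X k)\<^sup>2 \<le> 2 * l * (X k)\<^sup>2" using k0(2)[OF that] by simp
      finally show ?thesis .
    qed
    have F_sub: "F k \<subseteq> {u..v}" if "k \<ge> k0" for k
    proof -
      have "1 / (X k)\<^sup>2 \<le> l" using k0(2)[OF that] X_pos[of k] by (simp add: field_simps)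
      then have "r k \<le> l / 4" using r_small[of k] by simp
      then show ?thesis unfolding F_def B_def I_def by auto
    qed
    have I_meas: "measure lebesgue (I k a) = 2 * r k" for k a
      unfolding I_def using r_nonneg[of k] by simp
    have F_lower: "measure lebesgue (F k) \<ge> c * l * t k" if "k \<ge> k0" for k
    proof -
      have "measure lebesgue (F k) = (\<Sum>a\<in>B k. measure lebesgue (I k a))"
        unfolding F_def
      proof (rule measure_UNION'[OF finB])
        show "I k a \<in> lmeasurable" for a unfolding I_def by simp
        \<comment> \<open>By \<open>r_le\<close> each interval is at most half as long as the
          spacing of the centres.\<close>
        show "pairwise (\<lambda>i j. disjnt (I k i) (I k j)) (B k)"
        proof (rule pairwiseI)
          fix a b assume "a \<in> B k" "b \<in> B k" "a \<noteq> b"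
          then have "\<bar>a - b\<bar> \<ge> 1 / (X k)\<^sup>2" using sep unfolding B_def by blast
          moreover have "2 * r k < 1 / (X k)\<^sup>2" using r_small[of k] X_pos[of k] by (simp add: field_simps)
          ultimately show "disjnt (I k a) (I k b)" unfolding disjnt_def I_def by auto
        qed
      qed
      also have "\<dots> = real (card (B k)) * (2 * r k)" by (simp add: I_meas)
      also have "\<dots> \<ge> c * (l / 2) * (X k)\<^sup>2 * (2 * r k)"
        by (rule mult_right_mono[OF k0(1)[OF that]]) (use r_nonneg in simp)
      finally show ?thesis by (simp add: t_def mult_ac)
    qed
    have FF: "measure lebesgue (F j \<inter> F k) \<le> 8 * l * (t j * t k + (1 / 4) ^ (k - j) * t k)" if jk: "k0 \<le> j" "j \<le> k" for j k
    proof (cases "j = k")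
      case True
      have "measure lebesgue (F k) \<le> (\<Sum>a\<in>B k. measure lebesgue (I k a))"
        unfolding F_def using finB by (intro measure_UNION_le) (auto simp: I_def)
      also have "\<dots> = real (card (B k)) * (2 * r k)" by (simp add: I_meas)
      also have "\<dots> \<le> 2 * l * (X k)\<^sup>2 * (2 * r k)"
        by (rule mult_right_mono[OF cardB]) (use jk r_nonneg in auto)
      also have "\<dots> = 4 * l * t k" by (simp add: t_def)
      also have "\<dots> \<le> 8 * l * (t k * t k + t k)" using l t0[of k] by (simp add: algebra_simps)
      finally show ?thesis using True by simp
    next
      case False
      \<comment> \<open>The centres of level \<open>k\<close> whose interval can meet the one around
        \<open>a\<close>. Separation bounds their number by
        \<open>1 + 2 * (r j + r k) * (X k)\<^sup>2\<close>, where the part with \<open>r k\<close>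
        is at most 1/2.\<close>
      let ?N = "\<lambda>a. A k \<inter> {a - (r j + r k)..a + (r j + r k)}"
      have "F j \<inter> F k \<subseteq> (\<Union>a\<in>B j. \<Union>b\<in>?N a. I k b)"
      proof
        fix x assume "x \<in> F j \<inter> F k"
        then obtain a b where ab: "a \<in> B j" "x \<in> I j a" "b \<in> B k" "x \<in> I k b" unfolding F_def by auto
        then have "b \<in> ?N a" unfolding B_def I_def by auto
        then show "x \<in> (\<Union>a\<in>B j. \<Union>b\<in>?N a. I k b)" using ab by blast
      qed
      then have "measure lebesgue (F j \<inter> F k) \<le> measure lebesgue (\<Union>a\<in>B j. \<Union>b\<in>?N a. I k b)"
        using fin finB Fm
        by (intro measure_mono_fmeasurable fmeasurable.finite_UN sets.Int) (auto simp: I_def dest: fmeasurableD)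
      also have "\<dots> \<le> (\<Sum>a\<in>B j. measure lebesgue (\<Union>b\<in>?N a. I k b))"
        using fin finB by (intro measure_UNION_le) (auto simp: I_def intro!: sets.finite_UN)
      also have "\<dots> \<le> (\<Sum>a\<in>B j. (2 + 2 * r j * (X k)\<^sup>2) * (2 * r k))"
      proof (rule sum_mono)
        fix a
        have "measure lebesgue (\<Union>b\<in>?N a. I k b) \<le> (\<Sum>b\<in>?N a. measure lebesgue (I k b))"
          using fin by (intro measure_UNION_le) (auto simp: I_def)
        also have "\<dots> = real (card (?N a)) * (2 * r k)" by (simp add: I_meas)
        also have "\<dots> \<le> (2 + 2 * r j * (X k)\<^sup>2) * (2 * r k)"
        proof (rule mult_right_mono)
          have "real (card (?N a)) \<le> 1 + (a + (r j + r k) - (a - (r j + r k))) * (X k)\<^sup>2"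
            by (rule card_le) (use r_nonneg[of j] r_nonneg[of k] in simp)
          also have "\<dots> = 1 + 2 * r j * (X k)\<^sup>2 + 2 * (r k * (X k)\<^sup>2)" by (simp add: algebra_simps)
          finally show "real (card (?N a)) \<le> 2 + 2 * r j * (X k)\<^sup>2" using r_le[of k] by simp
        qed (use r_nonneg in simp)
        finally show "measure lebesgue (\<Union>b\<in>?N a. I k b) \<le> (2 + 2 * r j * (X k)\<^sup>2) * (2 * r k)" .
      qed
      also have "\<dots> = real (card (B j)) * ((2 + 2 * r j * (X k)\<^sup>2) * (2 * r k))" by simp
      also have "\<dots> \<le> 2 * l * (X j)\<^sup>2 * ((2 + 2 * r j * (X k)\<^sup>2) * (2 * r k))"
        by (rule mult_right_mono[OF cardB[OF jk(1)]]) (use r_nonneg in simp)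
      also have "\<dots> = 8 * l * (t j * t k + (X j)\<^sup>2 * r k)" by (simp add: t_def algebra_simps)
      also have "\<dots> \<le> 8 * l * (t j * t k + (1 / 4) ^ (k - j) * t k)"
      proof -
        have "(X j * 2 ^ (k - j))\<^sup>2 \<le> (X k)\<^sup>2" using X_growth[OF jk(2)] X_pos[of j] by (intro power_mono) auto
        moreover have "(2 ^ (k - j))\<^sup>2 = (4::real) ^ (k - j)"
          by (simp add: power2_eq_square flip: power_mult_distrib)
        ultimately have "(X j)\<^sup>2 * 4 ^ (k - j) \<le> (X k)\<^sup>2" by (simp only: power_mult_distrib)
        then have "(X j)\<^sup>2 \<le> (1 / 4) ^ (k - j) * (X k)\<^sup>2"
          by (simp add: power_divide field_simps)
        then have "(X j)\<^sup>2 * r k \<le> (1 / 4) ^ (k - j) * (X k)\<^sup>2 * r k"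
          using r_nonneg by (intro mult_right_mono) auto
        then have "(X j)\<^sup>2 * r k \<le> (1 / 4) ^ (k - j) * t k" by (simp add: t_def mult_ac)
        then show ?thesis using l by (intro mult_left_mono add_left_mono) auto
      qed
      finally show ?thesis .
    qed
    have union: "\<exists>n. measure lebesgue (\<Union>k\<in>{m..<n}. F k) \<ge> c\<^sup>2 / 64 * l" if m: "m \<ge> k0" for m
    proof -
      \<comment> \<open>The threshold 4 gives \<open>4 * T \<le> T * T\<close>, which absorbs the
        near-diagonal terms.\<close>
      have "\<exists>n. (\<Sum>k\<le>n. t (k + m)) > 4"
      proof (rule ccontr)
        assume "\<not> (\<exists>n. (\<Sum>k\<le>n. t (k + m)) > 4)"
        then have "(\<Sum>k\<le>n. t (k + m)) \<le> 4" for n by (simp add: not_less)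
        then have "summable (\<lambda>k. t (k + m))" by (rule bounded_imp_summable[OF t0])
        then have "summable t" by (simp only: summable_iff_shift)
        moreover have "t = (\<lambda>k. r k * (X k)\<^sup>2)" by (simp add: t_def fun_eq_iff)
        ultimately show False using div by simp
      qed
      then obtain n where n: "(\<Sum>k<n. t (k + m)) > 4" by (metis lessThan_Suc_atMost)
      define K where "K = {m..<m+n}"
      define T where "T = sum t K"
      have "T = (\<Sum>k<n. t (k + m))" unfolding T_def K_def
        using sum.shift_bounds_nat_ivl[of t 0 m n] by (simp add: atLeast0LessThan add.commute)
      then have T4: "T > 4" using n by simp
      have fK: "finite K" unfolding K_def by simp
      have Kk0: "k \<ge> k0" if "k \<in> K" for k using that m unfolding K_def by simp
      \<comment> \<open>The error term for \<open>j \<le> k\<close> only. Adding both orders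
        majorises the overlap of every pair, and each order sums to at most
        \<open>2 * T\<close>.\<close>
      let ?q = "\<lambda>j k. if j \<le> k then (1 / 4 :: real) ^ (k - j) * t k else 0"
      have q0: "?q j k \<ge> 0" for j k using t0[of k] by simp
      have q_sum: "(\<Sum>j\<in>K. ?q j k) \<le> 2 * t k" for k
      proof -
        have "(\<Sum>j\<in>K. if j \<le> k then (1 / 4 :: real) ^ (k - j) else 0) = (\<Sum>j | j \<in> K \<and> j \<le> k. (1 / 4) ^ (k - j))"
          using fK by (simp add: sum.inter_filter)
        also have "\<dots> \<le> (\<Sum>j\<le>k. (1 / 4) ^ (k - j))" by (rule sum_mono2) auto
        also have "\<dots> = (\<Sum>i\<le>k. (1 / 4) ^ i)"
          by (rule sum.reindex_bij_witness[of _ "\<lambda>i. k - i" "\<lambda>i. k - i"]) auto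
        also have "\<dots> = (\<Sum>i<Suc k. (1 / 4) ^ i)" by (simp add: lessThan_Suc_atMost)
        also have "\<dots> = (1 - (1/4) ^ Suc k) / (1 - 1/4)" by (rule sum_gp_strict[THEN trans]) simp
        also have "\<dots> \<le> 2"
        proof -
          have *: "(1 - q) / (1 - 1 / 4) \<le> 2" if "0 \<le> q" for q :: real using that by simp
          show ?thesis by (rule *) simp
        qed
        finally have "(\<Sum>j\<in>K. if j \<le> k then (1 / 4 :: real) ^ (k - j) else 0) * t k \<le> 2 * t k"
          by (rule mult_right_mono[OF _ t0])
        moreover have "(\<Sum>j\<in>K. ?q j k) = (\<Sum>j\<in>K. if j \<le> k then (1 / 4 :: real) ^ (k - j) else 0) * t k"
          unfolding sum_distrib_right by (rule sum.cong) auto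
        ultimately show ?thesis by simp
      qed
      have "(\<Sum>j\<in>K. \<Sum>k\<in>K. measure lebesgue (F j \<inter> F k)) \<le> (\<Sum>j\<in>K. \<Sum>k\<in>K. 8 * l * (t j * t k + ?q j k + ?q k j))"
      proof (intro sum_mono)
        fix j k assume jk: "j \<in> K" "k \<in> K"
        show "measure lebesgue (F j \<inter> F k) \<le> 8 * l * (t j * t k + ?q j k + ?q k j)"
        proof (cases "j \<le> k")
          case True
          have "measure lebesgue (F j \<inter> F k) \<le> 8 * l * (t j * t k + (1 / 4) ^ (k - j) * t k)"
            by (rule FF) (use True Kk0 jk in auto)
          also have "\<dots> \<le> 8 * l * (t j * t k + ?q j k + ?q k j)"
            using True l q0[of k j] by (intro mult_left_mono) auto
          finally show ?thesis .
        next
          case False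
          have "measure lebesgue (F k \<inter> F j) \<le> 8 * l * (t k * t j + (1 / 4) ^ (j - k) * t j)"
            by (rule FF) (use False Kk0 jk in auto)
          then show ?thesis using False by (simp add: Int_commute mult.commute)
        qed
      qed
      also have "\<dots> = 8 * l * (T * T + (\<Sum>k\<in>K. \<Sum>j\<in>K. ?q j k) + (\<Sum>j\<in>K. \<Sum>k\<in>K. ?q k j))"
      proof -
        have "(\<Sum>j\<in>K. \<Sum>k\<in>K. 8 * l * (t j * t k + ?q j k + ?q k j)) =
          8 * l * (\<Sum>j\<in>K. \<Sum>k\<in>K. (t j * t k + ?q j k + ?q k j))"
          by (simp only: sum_distrib_left)
        also have "(\<Sum>j\<in>K. \<Sum>k\<in>K. (t j * t k + ?q j k + ?q k j)) =
            (\<Sum>j\<in>K. \<Sum>k\<in>K. t j * t k) + (\<Sum>j\<in>K. \<Sum>k\<in>K. ?q j k) + (\<Sum>j\<in>K. \<Sum>k\<in>K. ?q k j)"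
          by (simp only: sum.distrib)
        also have "(\<Sum>j\<in>K. \<Sum>k\<in>K. t j * t k) = T * T" unfolding T_def by (simp only: sum_product)
        also have "(\<Sum>j\<in>K. \<Sum>k\<in>K. ?q j k) = (\<Sum>k\<in>K. \<Sum>j\<in>K. ?q j k)" by (rule sum.swap)
        finally show ?thesis .
      qed
      also have "\<dots> \<le> 8 * l * (T * T + 2 * T + 2 * T)"
      proof -
        have "(\<Sum>k\<in>K. \<Sum>j\<in>K. ?q j k) \<le> (\<Sum>k\<in>K. 2 * t k)" by (intro sum_mono q_sum)
        also have "\<dots> = 2 * T" unfolding T_def by (simp add: sum_distrib_left)
        finally show ?thesis using l by (intro mult_left_mono) auto
      qed
      also have "\<dots> \<le> 8 * l * (T * T + T * T)"
      proof -
        have "4 * T \<le> T * T" using T4 by (intro mult_right_mono) auto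
        then show ?thesis using l by (intro mult_left_mono) auto
      qed
      also have "\<dots> = 16 * l * T\<^sup>2" by (simp add: power2_eq_square)
      finally have m2: "(\<Sum>j\<in>K. \<Sum>k\<in>K. measure lebesgue (F j \<inter> F k)) \<le> 16 * l * T\<^sup>2" .
      have m1: "c * l * T \<le> (\<Sum>k\<in>K. measure lebesgue (F k))"
        unfolding T_def sum_distrib_left by (rule sum_mono) (use F_lower Kk0 in auto)
      have "(c * l * T)\<^sup>2 \<le> (\<Sum>k\<in>K. measure lebesgue (F k))\<^sup>2"
        by (rule power_mono[OF m1]) (use c l T4 in simp)
      also have "\<dots> \<le> (\<Sum>j\<in>K. \<Sum>k\<in>K. measure lebesgue (F j \<inter> F k)) * measure lebesgue (\<Union>k\<in>K. F k)"
        by (rule chung_erdos[OF fK Fm])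
      also have "\<dots> \<le> 16 * l * T\<^sup>2 * measure lebesgue (\<Union>k\<in>K. F k)"
        by (rule mult_right_mono[OF m2]) simp
      finally have "c\<^sup>2 * l * (l * T\<^sup>2) \<le> 16 * measure lebesgue (\<Union>k\<in>K. F k) * (l * T\<^sup>2)"
        by (simp add: power2_eq_square mult_ac)
      then have "c\<^sup>2 * l \<le> 16 * measure lebesgue (\<Union>k\<in>K. F k)"
        using l T4 by (simp add: mult_le_cancel_right)
      then have "c\<^sup>2 / 64 * l \<le> measure lebesgue (\<Union>k\<in>K. F k)"
      proof -
        have "c\<^sup>2 / 64 * l = c\<^sup>2 * l / 64" by simp
        then show ?thesis
          using measure_nonneg[of lebesgue "\<Union>k\<in>K. F k"] \<open>c\<^sup>2 * l \<le> _\<close> by linarith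
      qed
      then show ?thesis unfolding K_def by blast
    qed
    \<comment> \<open>The finite unions bound every tail union from below; continuity of the measure
      along the decreasing tails passes the bound to the limsup set.\<close>
    define U where "U m = (\<Union>k\<in>{k0 + m..}. F k)" for m
    have U_sets: "U m \<in> sets lebesgue" for m
      unfolding U_def using Fm by (intro sets.countable_UN') auto
    have U_sub: "U m \<subseteq> {u..v}" for m unfolding U_def using F_sub by (intro UN_least) auto
    have U_fm: "U m \<in> lmeasurable" for m
      by (rule fmeasurableI2[of "{u..v}"]) (use U_sub U_sets in auto)
    have U_ge: "measure lebesgue (U m) \<ge> c\<^sup>2 / 64 * l" for m
    proof -
      obtain n where "measure lebesgue (\<Union>k\<in>{k0+m..<n}. F k) \<ge> c\<^sup>2 / 64 * l" using union[of "k0 + m"] by auto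
      also have "measure lebesgue (\<Union>k\<in>{k0+m..<n}. F k) \<le> measure lebesgue (U m)"
        using Fm U_fm by (intro measure_mono_fmeasurable) (auto simp: U_def dest: fmeasurableD)
      finally show ?thesis .
    qed
    have "(\<lambda>m. measure lebesgue (U m)) \<longlonglongrightarrow> measure lebesgue (\<Inter>m. U m)"
    proof (rule Lim_measure_decseq)
      show "decseq U" unfolding decseq_def U_def by (intro allI impI UN_mono) auto
      show "emeasure lebesgue (U i) \<noteq> \<infinity>" for i using U_fm[of i] by (auto simp: fmeasurable_def)
    qed (use U_sets in auto)
    then have "measure lebesgue (\<Inter>m. U m) \<ge> c\<^sup>2 / 64 * l" by (rule LIMSEQ_le_const) (use U_ge in auto)
    moreover have U_inf: "(\<Inter>m. U m) \<in> lmeasurable"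
    proof (rule fmeasurableI2[of "{u..v}"])
      show "(\<Inter>m. U m) \<subseteq> {u..v}" using U_sub[of 0] by blast
    qed (use U_sets in auto)
    ultimately have "ennreal (c\<^sup>2 / 64 * l) \<le> emeasure lebesgue (\<Inter>m. U m)"
      by (simp add: emeasure_eq_measure2)
    also have "\<dots> \<le> emeasure lebesgue (\<Lambda> \<inter> {u..v})"
    proof (rule emeasure_mono)
      show "(\<Inter>m. U m) \<subseteq> \<Lambda> \<inter> {u..v}"
      proof
        fix x assume x: "x \<in> (\<Inter>m. U m)"
        have "x \<in> \<Lambda>" unfolding \<Lambda>_eq
        proof
          fix m
          have "x \<in> U m" using x by blast
          then obtain k a where "k \<ge> k0 + m" "a \<in> A k" "x \<in> I k a" unfolding U_def F_def B_def by auto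
          then show "x \<in> (\<Union>k\<in>{m..}. \<Union>a\<in>A k. {a - r k..a + r k})" unfolding I_def
            by (intro UN_I[of k] UN_I[of a]) auto
        qed
        then show "x \<in> \<Lambda> \<inter> {u..v}" using x U_sub by blast
      qed
      show "\<Lambda> \<inter> {u..v} \<in> sets lebesgue" using \<Lambda>_sets by auto
    qed
    finally show ?thesis unfolding l_def .
  qed
  have "{0..1} - \<Lambda> \<in> null_sets lebesgue"
    by (rule null_complement_if_positive_proportion[OF \<Lambda>_sets _ local]) (use c in auto)
  then show ?thesis unfolding \<Lambda>_def .
qed

subsection \<open>Reduced fractions\<close>

lemma coprime_int_iff_no_prime_factor:
  fixes a :: int and d :: nat
  assumes "d > 0"
  shows "coprime a (int d) \<longleftrightarrow> (\<forall>p\<in>prime_factors d. \<not> int p dvd a)"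
proof
  assume c: "coprime a (int d)"
  show "\<forall>p\<in>prime_factors d. \<not> int p dvd a"
  proof
    fix p assume p: "p \<in> prime_factors d"
    show "\<not> int p dvd a"
    proof
      assume "int p dvd a"
      moreover have "int p dvd int d" using p by auto
      ultimately have "is_unit (int p)" using c by (rule coprime_common_divisor[rotated])
      then show False using p by (auto dest!: in_prime_factors_imp_prime)
    qed
  qed
next
  assume h: "\<forall>p\<in>prime_factors d. \<not> int p dvd a"
  show "coprime a (int d)"
  proof (rule ccontr)
    assume "\<not> coprime a (int d)"
    then have "gcd a (int d) \<noteq> 1" by (simp add: coprime_iff_gcd_eq_1)
    then have "nat (gcd a (int d)) \<noteq> 1" by simp
    then obtain p where p: "prime p" "p dvd nat (gcd a (int d))" using prime_factor_nat by blast
    then have "int p dvd gcd a (int d)" by (simp add: int_dvd_int_iff[symmetric] del: int_dvd_int_iff)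
    then have "int p dvd a" "p dvd d" by auto
    then show False using h p assms by (auto simp: prime_factors_dvd)
  qed
qed

text \<open>Legendre's sieve: inclusion-exclusion over the square-free divisors of \<open>d\<close>,
  with an error of at most 1 for each.\<close>

lemma card_coprime_ge:
  fixes A B :: int and d :: nat
  assumes d: "d > 0" and AB: "A \<le> B"
  shows "real (card {a \<in> {A<..B}. coprime a (int d)}) \<ge> real_of_int (B - A) / inv_totient_ratio d - 2 ^ card (prime_factors d)"
proof -
  let ?F = "prime_factors d"
  let ?I = "{A<..B}"
  have "real (card {a \<in> ?I. coprime a (int d)}) = (\<Sum>a\<in>?I. if coprime a (int d) then 1 else 0)"
    by (simp add: sum.inter_filter[symmetric])
  also have "\<dots> = (\<Sum>a\<in>?I. \<Sum>E | E \<in> Pow ?F \<and> int (\<Prod>E) dvd a. (- 1) ^ card E)"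
  proof (rule sum.cong[OF refl])
    fix a
    let ?G = "{p \<in> ?F. int p dvd a}"
    have "{E. E \<in> Pow ?F \<and> int (\<Prod>E) dvd a} = Pow ?G"
    proof (intro equalityI subsetI)
      fix E assume "E \<in> {E. E \<in> Pow ?F \<and> int (\<Prod>E) dvd a}"
      then have E: "E \<subseteq> ?F" "int (\<Prod>E) dvd a" by auto
      have "finite E" using E(1) by (auto intro: finite_subset)
      then have "\<forall>p\<in>E. int p dvd a" using E by (subst prod_primes_dvd_iff[symmetric]) auto
      then show "E \<in> Pow ?G" using E by auto
    next
      fix E assume E: "E \<in> Pow ?G"
      then have "finite E" by (auto intro: finite_subset[of _ ?F])
      then have "int (\<Prod>E) dvd a" using E by (subst prod_primes_dvd_iff) auto
      then show "E \<in> {E. E \<in> Pow ?F \<and> int (\<Prod>E) dvd a}" using E by blast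
    qed
    then have "(\<Sum>E | E \<in> Pow ?F \<and> int (\<Prod>E) dvd a. (- 1) ^ card E) = (\<Sum>E\<in>Pow ?G. \<Prod>p\<in>E. - 1 :: real)"
      by simp
    also have "\<dots> = (\<Prod>p\<in>?G. 1 + (- 1))" by (rule prod_one_plus_eq_sum_Pow[symmetric]) simp
    also have "\<dots> = (if coprime a (int d) then 1 else 0)"
    proof (cases "?G = {}")
      case True
      then have "coprime a (int d)" using coprime_int_iff_no_prime_factor[OF d] by blast
      then show ?thesis using True by (simp only: prod.empty if_True)
    next
      case False
      then have "\<not> coprime a (int d)" using coprime_int_iff_no_prime_factor[OF d] by blast
      moreover have "(\<Prod>p\<in>?G. 1 + (- 1) :: real) = 0" using False by (subst prod_zero_iff) auto
      ultimately show ?thesis by simp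
    qed
    finally show "(if coprime a (int d) then 1 else 0) = (\<Sum>E | E \<in> Pow ?F \<and> int (\<Prod>E) dvd a. (- 1 :: real) ^ card E)" by simp
  qed
  also have "\<dots> = (\<Sum>E\<in>Pow ?F. \<Sum>a | a \<in> ?I \<and> int (\<Prod>E) dvd a. (- 1) ^ card E)"
    by (rule sum.swap_restrict) auto
  also have "\<dots> \<ge> (\<Sum>E\<in>Pow ?F. (- 1) ^ card E * (real_of_int (B - A) / real (\<Prod>E)) - 1)"
  proof (rule sum_mono)
    fix E assume E: "E \<in> Pow ?F"
    have pos: "\<Prod>E > 0"
    proof (rule prod_pos)
      fix p assume "p \<in> E"
      then have "prime p" using E by auto
      then show "p > 0" by (rule prime_gt_0_nat)
    qed
    have sgn: "s * b - 1 \<le> c * s" if "\<bar>c - b\<bar> \<le> 1" "s = 1 \<or> s = - 1" for s b c :: real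
      using that by auto
    let ?c = "real (card {a \<in> ?I. int (\<Prod>E) dvd a})"
    have "int (\<Prod>E) > 0" using pos by (simp only: of_nat_0_less_iff)
    then have "\<bar>?c - real_of_int (B - A) / real (\<Prod>E)\<bar> \<le> 1"
      using card_multiples_int[of "int (\<Prod>E)" A B] AB by (simp only: of_int_of_nat_eq)
    moreover have "(- 1 :: real) ^ card E = 1 \<or> (- 1 :: real) ^ card E = - 1" by (cases "even (card E)") auto
    ultimately have "(- 1) ^ card E * (real_of_int (B - A) / real (\<Prod>E)) - 1 \<le> ?c * (- 1) ^ card E"
      by (rule sgn)
    then show "(- 1) ^ card E * (real_of_int (B - A) / real (\<Prod>E)) - 1 \<le> (\<Sum>a | a \<in> ?I \<and> int (\<Prod>E) dvd a. (- 1) ^ card E)"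
      by simp
  qed
  also have "(\<Sum>E\<in>Pow ?F. (- 1) ^ card E * (real_of_int (B - A) / real (\<Prod>E)) - 1) =
      real_of_int (B - A) * (\<Sum>E\<in>Pow ?F. \<Prod>p\<in>E. - (1 / real p)) - 2 ^ card ?F"
  proof -
    have "(\<Prod>p\<in>E. - (1 / real p)) = (- 1) ^ card E / real (\<Prod>E)" for E :: "nat set"
      by (simp add: prod_uminus prod_dividef)
    then show ?thesis by (simp add: sum_subtractf sum_distrib_left card_Pow mult_ac)
  qed
  also have "(\<Sum>E\<in>Pow ?F. \<Prod>p\<in>E. - (1 / real p)) = (\<Prod>p\<in>?F. 1 + - (1 / real p))"
    by (rule prod_one_plus_eq_sum_Pow[symmetric]) simp
  also have "\<dots> = (\<Prod>p\<in>?F. 1 / (real p / (real p - 1)))"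
    by (rule prod.cong) (auto simp: field_simps dest!: in_prime_factors_imp_prime prime_gt_0_nat)
  also have "\<dots> = 1 / inv_totient_ratio d"
    unfolding inv_totient_ratio_def by (simp only: prod_dividef prod.neutral_const)
  finally show ?thesis by simp
qed

text \<open>Compare 4 with each prime factor: the primes from 5 on are larger, while 2 and 3 get an
  extra factor 2 each. Hence \<open>4 ^ card (prime_factors d) \<le> 4 * d\<close>, and Legendre's
  error is negligible against \<open>d\<close>.\<close>

lemma two_pow_card_prime_factors_le:
  assumes "d > 0"
  shows "(2::real) ^ card (prime_factors d) \<le> 2 * sqrt (real d)"
proof -
  let ?F = "prime_factors d"
  define w :: "nat \<Rightarrow> nat" where "w p = (if p \<in> {2, 3} then 2 else 1)" for p
  have "\<Prod>?F dvd d"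
  proof -
    have "int (\<Prod>?F) dvd int d" by (subst prod_primes_dvd_iff) auto
    then show ?thesis by (simp only: of_nat_dvd_iff)
  qed
  then have 1: "\<Prod>?F \<le> d" using assms by (rule dvd_imp_le)
  have "4 ^ card ?F = (\<Prod>p\<in>?F. 4::nat)" by simp
  also have "\<dots> \<le> (\<Prod>p\<in>?F. p * w p)"
  proof (rule prod_mono)
    fix p assume "p \<in> ?F"
    then have p: "prime p" by auto
    moreover have "p \<noteq> 4" using p by (auto simp: prime_nat_iff dest: spec[of _ 2])
    ultimately have "p = 2 \<or> p = 3 \<or> p \<ge> 5" using prime_ge_2_nat[of p] by linarith
    then show "0 \<le> (4::nat) \<and> 4 \<le> p * w p" unfolding w_def by auto
  qed
  also have "\<dots> = \<Prod>?F * prod w ?F" by (rule prod.distrib)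
  also have "prod w ?F = prod w (?F \<inter> {2, 3})"
    by (rule prod.mono_neutral_right) (auto simp: w_def)
  also have "\<dots> = (\<Prod>p\<in>?F \<inter> {2, 3}. 2)" by (rule prod.cong) (auto simp: w_def)
  also have "\<dots> = 2 ^ card (?F \<inter> {2, 3})" by simp
  also have "\<Prod>?F * 2 ^ card (?F \<inter> {2, 3}) \<le> d * 2 ^ 2"
  proof (intro mult_le_mono power_increasing)
    have "card (?F \<inter> {2, 3}) \<le> card {2, 3::nat}" by (rule card_mono) auto
    then show "card (?F \<inter> {2, 3}) \<le> 2" by simp
  qed (use 1 in auto)
  finally have "4 ^ card ?F \<le> 4 * d" by simp
  then have "real (4 ^ card ?F) \<le> real (4 * d)" by (rule of_nat_mono)
  then have "(4::real) ^ card ?F \<le> 4 * real d" by simp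
  moreover have "((2::real) ^ card ?F)\<^sup>2 = 4 ^ card ?F" by (simp add: power2_eq_square flip: power_mult_distrib)
  ultimately have "((2::real) ^ card ?F)\<^sup>2 \<le> (2 * sqrt (real d))\<^sup>2" by (simp add: power_mult_distrib)
  then show ?thesis by (rule power2_le_imp_le) simp
qed

definition reduced_fractions :: "nat set \<Rightarrow> real set" where
  "reduced_fractions S = (\<lambda>(d, a). real_of_int a / real d) ` (SIGMA d:S. {a. 0 \<le> a \<and> a \<le> int d \<and> coprime a (int d)})"

lemma finite_reduced_fractions:
  assumes "finite S" shows "finite (reduced_fractions S)"
proof -
  have "finite {a. 0 \<le> a \<and> a \<le> int d \<and> coprime a (int d)}" for d
    by (rule finite_subset[of _ "{0..int d}"]) auto
  then show ?thesis unfolding reduced_fractions_def using assms by (intro finite_imageI finite_SigmaI)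
qed

lemma reduced_fractions_separated:
  assumes S: "\<And>d. d \<in> S \<Longrightarrow> d > 0 \<and> d \<le> X"
    and x: "x \<in> reduced_fractions S" and y: "y \<in> reduced_fractions S" and "x \<noteq> y"
  shows "\<bar>x - y\<bar> \<ge> 1 / (real X)\<^sup>2"
proof -
  obtain d a where d: "d \<in> S" "x = real_of_int a / real d" using x unfolding reduced_fractions_def by auto
  obtain e b where e: "e \<in> S" "y = real_of_int b / real e" using y unfolding reduced_fractions_def by auto
  have pos: "real d > 0" "real e > 0" "d \<le> X" "e \<le> X" using S d e by auto
  have diff: "x - y = real_of_int (a * int e - b * int d) / (real d * real e)"
    unfolding d e using pos by (simp add: field_simps)
  have "a * int e - b * int d \<noteq> 0"
  proof
    assume "a * int e - b * int d = 0"
    then have "x - y = 0" using diff by (simp only: of_int_0 div_0)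
    then show False using \<open>x \<noteq> y\<close> by simp
  qed
  then have "1 \<le> \<bar>real_of_int (a * int e - b * int d)\<bar>" by linarith
  then have "1 / (real d * real e) \<le> \<bar>real_of_int (a * int e - b * int d)\<bar> / (real d * real e)"
    using pos by (intro divide_right_mono) auto
  also have "\<dots> = \<bar>x - y\<bar>" unfolding diff using pos by (simp add: abs_divide)
  finally have "1 / (real d * real e) \<le> \<bar>x - y\<bar>" .
  moreover have "1 / (real X)\<^sup>2 \<le> 1 / (real d * real e)"
    unfolding power2_eq_square using pos by (intro divide_left_mono mult_mono) auto
  ultimately show ?thesis by linarith
qed

text \<open>Each \<open>d\<close> has at least (v - u) d / K - 1 - 2 sqrt X coprime numerators in
  the interval, and (v - u) d / K is at least \<tau> X. The lower bound for sqrt X says \<tau> sqrt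
  X \<ge> 6, so the error, at most 3 sqrt X, is at most half of \<tau> X.\<close>

lemma card_reduced_fractions_ge:
  fixes u v K \<delta> c :: real
  assumes uv: "0 \<le> u" "u < v" "v \<le> 1" and K: "K \<ge> 1" and \<delta>: "\<delta> > 0"
    and S: "\<And>d. d \<in> S \<Longrightarrow> d > 0 \<and> d \<le> X \<and> inv_totient_ratio d \<le> K \<and> real d \<ge> \<delta> * real X"
    and fS: "finite S" and card: "real (card S) \<ge> c * real X" and c: "c > 0"
    and X: "X \<ge> 1" "sqrt (real X) \<ge> 6 * K / ((v - u) * \<delta>)"
  shows "real (card (reduced_fractions S \<inter> {u..v})) \<ge> c * \<delta> / (2 * K) * (v - u) * (real X)\<^sup>2"
proof -
  define \<tau> where "\<tau> = (v - u) * \<delta> / K"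
  have \<tau>: "\<tau> > 0" unfolding \<tau>_def using uv K \<delta> by simp
  have sX: "\<tau> * sqrt (real X) \<ge> 6"
  proof -
    have "6 / \<tau> \<le> sqrt (real X)" using X(2) unfolding \<tau>_def by simp
    then show ?thesis using \<tau> by (simp add: pos_divide_le_eq mult.commute)
  qed
  have s1: "sqrt (real X) \<ge> 1" using X by simp
  have "6 * sqrt (real X) \<le> \<tau> * sqrt (real X) * sqrt (real X)" using sX by (rule mult_right_mono) simp
  then have \<tau>X: "6 * sqrt (real X) \<le> \<tau> * real X" by (simp add: mult.assoc)
  let ?I = "\<lambda>d. {a \<in> {\<lfloor>u * real d\<rfloor><..\<lfloor>v * real d\<rfloor>}. coprime a (int d)}"
  have each: "\<tau> / 2 * real X \<le> real (card (?I d))" if d: "d \<in> S" for d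
  proof -
    let ?f = "inv_totient_ratio d"
    have f: "1 \<le> ?f" "?f \<le> K" using inv_totient_ratio_ge_1 S[OF d] by auto
    have le: "\<lfloor>u * real d\<rfloor> \<le> \<lfloor>v * real d\<rfloor>" using uv by (intro floor_mono mult_right_mono) auto
    have "\<tau> * real X \<le> (v - u) * real d / K"
      unfolding \<tau>_def using S[OF d] uv K by (simp add: divide_right_mono mult_left_mono mult.assoc)
    then have big: "6 \<le> (v - u) * real d / K" using \<tau>X s1 by linarith
    have "(v - u) * real d / K \<le> (v - u) * real d"
      using divide_left_mono[of 1 K "(v - u) * real d"] K uv by simp
    then have ge1: "(v - u) * real d \<ge> 1" using big by linarith
    have "(v - u) * real d / K - 1 \<le> ((v - u) * real d - 1) / K" using K by (simp add: diff_divide_distrib divide_le_eq)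
    also have "\<dots> \<le> ((v - u) * real d - 1) / ?f" using f ge1 by (intro divide_left_mono) auto
    also have "\<dots> \<le> real_of_int (\<lfloor>v * real d\<rfloor> - \<lfloor>u * real d\<rfloor>) / ?f"
    proof (rule divide_right_mono)
      have "real_of_int \<lfloor>v * real d\<rfloor> > v * real d - 1" "real_of_int \<lfloor>u * real d\<rfloor> \<le> u * real d" by linarith+
      then show "(v - u) * real d - 1 \<le> real_of_int (\<lfloor>v * real d\<rfloor> - \<lfloor>u * real d\<rfloor>)"
        unfolding left_diff_distrib of_int_diff by linarith
    qed (use f in simp)
    finally have "(v - u) * real d / K - 1 - 2 ^ card (prime_factors d) \<le> real (card (?I d))"
      using card_coprime_ge[of d "\<lfloor>u * real d\<rfloor>" "\<lfloor>v * real d\<rfloor>"] le S[OF d] by linarith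
    moreover have "(2::real) ^ card (prime_factors d) \<le> 2 * sqrt (real X)"
    proof -
      have "sqrt (real d) \<le> sqrt (real X)" using S[OF d] by simp
      then show ?thesis using two_pow_card_prime_factors_le[of d] S[OF d] by linarith
    qed
    ultimately show ?thesis using \<open>\<tau> * real X \<le> (v - u) * real d / K\<close> \<tau>X s1 by linarith
  qed
  let ?Z = "SIGMA d:S. ?I d"
  let ?q = "\<lambda>(d, a). real_of_int a / real d"
  \<comment> \<open>A reduced fraction determines its denominator, so different \<open>d\<close>
    contribute different points.\<close>
  have inj: "inj_on ?q ?Z"
  proof (rule inj_onI, clarify)
    fix d a e b assume d: "d \<in> S" "coprime a (int d)" and e: "e \<in> S" "coprime b (int e)"
      and eq: "real_of_int a / real d = real_of_int b / real e"
    have pos: "d > 0" "e > 0" using S d e by auto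
    have "real_of_int a * real e = real_of_int b * real d" using eq pos by (simp add: field_simps)
    then have "real_of_int (a * int e) = real_of_int (b * int d)" by simp
    then have cross: "a * int e = b * int d" by (simp only: of_int_eq_iff)
    have "int d dvd a * int e" unfolding cross by simp
    then have "int d dvd int e" using d(2) by (simp add: coprime_dvd_mult_right_iff coprime_commute)
    moreover have "int e dvd b * int d" unfolding cross[symmetric] by simp
    then have "int e dvd int d" using e(2) by (simp add: coprime_dvd_mult_right_iff coprime_commute)
    ultimately have "d = e" by (simp add: dvd_antisym)
    then show "d = e \<and> a = b" using cross pos by simp
  qed
  have sub: "?q ` ?Z \<subseteq> reduced_fractions S \<inter> {u..v}"
  proof clarify
    fix d a assume d: "d \<in> S" and a: "a \<in> {\<lfloor>u * real d\<rfloor><..\<lfloor>v * real d\<rfloor>}" and cop: "coprime a (int d)"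
    have pos: "real d > 0" using S d by auto
    have "real_of_int a > u * real d" "real_of_int a \<le> v * real d" using a by (auto simp: floor_less_iff le_floor_iff)
    then have uva: "u \<le> real_of_int a / real d" "real_of_int a / real d \<le> v" using pos by (auto simp: field_simps)
    have "real_of_int a / real d \<ge> 0" "real_of_int a / real d \<le> 1" using uva uv by linarith+
    then have "0 \<le> a" "a \<le> int d" using pos by (auto simp: field_simps)
    then have "real_of_int a / real d \<in> reduced_fractions S"
      unfolding reduced_fractions_def using d cop by (intro image_eqI[of _ _ "(d, a)"]) auto
    then show "real_of_int a / real d \<in> reduced_fractions S \<inter> {u..v}" using uva by simp
  qed
  have "c * \<delta> / (2 * K) * (v - u) * (real X)\<^sup>2 = (c * real X) * (\<tau> / 2 * real X)"
    unfolding \<tau>_def by (simp add: power2_eq_square mult_ac)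
  also have "\<dots> \<le> real (card S) * (\<tau> / 2 * real X)" by (rule mult_right_mono[OF card]) (use \<tau> in simp)
  also have "\<dots> = (\<Sum>d\<in>S. \<tau> / 2 * real X)" by simp
  also have "\<dots> \<le> (\<Sum>d\<in>S. real (card (?I d)))" by (rule sum_mono[OF each])
  also have "\<dots> = real (card ?Z)"
    using fS by (subst card_SigmaI) (auto intro: finite_subset[of _ "{\<lfloor>u * real d\<rfloor><..\<lfloor>v * real d\<rfloor>}" for d])
  also have "card ?Z = card (?q ` ?Z)" by (rule card_image[OF inj, symmetric])
  also have "real (card (?q ` ?Z)) \<le> real (card (reduced_fractions S \<inter> {u..v}))"
    by (intro of_nat_mono card_mono[OF _ sub]) (use finite_reduced_fractions[OF fS] in simp)
  finally show ?thesis .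
qed

subsection \<open>The zero-one law\<close>

lemma dist_int_le: "dist_int x \<le> \<bar>x - real_of_int k\<bar>"
  unfolding dist_int_def using round_diff_minimal[of x k] by simp

lemma dist_int_minus: "dist_int (- x) = dist_int x"
proof -
  have "dist_int (- x) \<le> dist_int x" for x
    using dist_int_le[of "- x" "- round x"] unfolding dist_int_def by simp
  from this[of x] this[of "- x"] show ?thesis by simp
qed

text \<open>The distance to the nearest integer is an even function, so only the positive
  differences matter.\<close>

lemma delta_min_set:
  "{dist_int ((real (nth_prime m) - real (nth_prime n)) * \<alpha>) | m n.
      1 \<le> m \<and> m \<le> N \<and> 1 \<le> n \<and> n \<le> N \<and> m \<noteq> n} = (\<lambda>d. dist_int (real d * \<alpha>)) ` prime_diffs N" (is "?L = ?R")
proof (intro equalityI subsetI)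
  have *: "dist_int ((real (nth_prime m) - real (nth_prime n)) * \<alpha>) \<in> ?R" if mn: "1 \<le> n" "n < m" "m \<le> N" for m n
  proof -
    have "nth_prime n < nth_prime m" using mn by (subst nth_prime_less_iff) auto
    then have eq: "real (nth_prime m) - real (nth_prime n) = real (nth_prime m - nth_prime n)" by simp
    have "nth_prime m - nth_prime n \<in> prime_diffs N" unfolding prime_diffs_def using mn by blast
    then show ?thesis unfolding eq by (rule imageI)
  qed
  fix x assume "x \<in> ?L"
  then obtain m n where mn: "x = dist_int ((real (nth_prime m) - real (nth_prime n)) * \<alpha>)" "1 \<le> m" "m \<le> N" "1 \<le> n" "n \<le> N" "m \<noteq> n"
    by blast
  show "x \<in> ?R"
  proof (cases "n < m")
    case True
    then show ?thesis unfolding mn(1) using mn by (intro *) auto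
  next
    case False
    have "(real (nth_prime m) - real (nth_prime n)) * \<alpha> = - ((real (nth_prime n) - real (nth_prime m)) * \<alpha>)"
      by (simp add: algebra_simps)
    then have "x = dist_int ((real (nth_prime n) - real (nth_prime m)) * \<alpha>)"
      unfolding mn(1) by (simp only: dist_int_minus)
    moreover have "\<dots> \<in> ?R" using False mn by (intro *) auto
    ultimately show ?thesis by simp
  qed
next
  fix x assume "x \<in> ?R"
  then obtain m n where mn: "x = dist_int (real (nth_prime m - nth_prime n) * \<alpha>)" "1 \<le> n" "n < m" "m \<le> N"
    unfolding prime_diffs_def by blast
  have "nth_prime n < nth_prime m" using mn by (subst nth_prime_less_iff) auto
  then have eq: "real (nth_prime m) - real (nth_prime n) = real (nth_prime m - nth_prime n)" by simp
  have "x = dist_int ((real (nth_prime m) - real (nth_prime n)) * \<alpha>)" unfolding eq by (rule mn(1))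
  then show "x \<in> ?L" using mn(2-4) by (intro CollectI exI[of _ m] exI[of _ n] conjI) linarith+
qed

lemma prime_diffs_bounds:
  assumes "d \<in> prime_diffs N"
  shows "d > 0" "d \<le> 128 * NlogN N"
proof -
  obtain m n where mn: "d = nth_prime m - nth_prime n" "1 \<le> n" "n < m" "m \<le> N"
    using assms unfolding prime_diffs_def by blast
  have "nth_prime n < nth_prime m" using mn by (subst nth_prime_less_iff) auto
  then show "d > 0" using mn by simp
  have "nth_prime m \<le> nth_prime N"
    using mn nth_prime_less_iff[of N m] by (cases "nth_prime m \<le> nth_prime N") auto
  then show "d \<le> 128 * NlogN N" using mn nth_prime_le_NlogN[of N] by simp
qed

lemma finite_prime_diffs: "finite (prime_diffs N)"
  by (rule finite_subset[of _ "{..128 * NlogN N}"]) (use prime_diffs_bounds in auto)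

lemma prime_diffs_nonempty:
  assumes "N \<ge> 2" shows "prime_diffs N \<noteq> {}"
proof -
  have "nth_prime 2 - nth_prime 1 \<in> prime_diffs N"
    unfolding prime_diffs_def using assms by (intro CollectI exI[of _ 2] exI[of _ 1]) auto
  then show ?thesis by blast
qed

text \<open>\<open>2 \<le> N\<close> ensures that the minimum is taken over a non-empty set.\<close>

lemma delta_min_le_iff:
  assumes "N \<ge> 2"
  shows "delta_min \<alpha> N \<le> x \<longleftrightarrow> (\<exists>d\<in>prime_diffs N. dist_int (real d * \<alpha>) \<le> x)"
  unfolding delta_min_def delta_min_set
  using finite_prime_diffs prime_diffs_nonempty[OF assms] by (subst Min_le_iff) auto

text \<open>The factor 8 consists of 2 for \<open>N\<close>, 2 for the logarithm and 2 for rounding.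
  The lower bound separates the scales of the limsup argument, the upper bound permits
  condensation.\<close>

lemma NlogN_double:
  assumes "N \<ge> 1"
  shows "2 * NlogN N \<le> NlogN (2 * N)" "NlogN (2 * N) \<le> 8 * NlogN N"
proof -
  have N: "real N \<ge> 1" using assms by simp
  have ln: "ln (2 * real N) = ln 2 + ln (real N)" using N by (subst ln_mult) auto
  have ln2: "0 < ln (2::real)" "ln (2::real) < 1" using ln_2_less_1 by auto
  have mono: "logm (real N) \<le> logm (2 * real N)" unfolding logm_def ln using ln2 by (intro max.mono) auto
  have up: "logm (2 * real N) \<le> 2 * logm (real N)" unfolding logm_def ln using ln2 by auto
  have "real (2 * NlogN N) \<le> 2 * (real N * logm (real N))" using NlogN_le[of N] by simp
  also have "\<dots> \<le> 2 * (real N * logm (2 * real N))" using mono by (intro mult_left_mono) auto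
  finally have "real (2 * NlogN N) \<le> real (2 * N) * logm (real (2 * N))" by simp
  then have "int (2 * NlogN N) \<le> \<lfloor>real (2 * N) * logm (real (2 * N))\<rfloor>" by (simp only: le_floor_iff of_int_of_nat_eq)
  then show "2 * NlogN N \<le> NlogN (2 * N)" unfolding NlogN_def[of "2 * N"] by linarith
  have "real (NlogN (2 * N)) \<le> real (2 * N) * logm (real (2 * N))" by (rule NlogN_le)
  also have "\<dots> = 2 * (real N * logm (2 * real N))" by simp
  also have "\<dots> \<le> 2 * (real N * (2 * logm (real N)))" using up by (intro mult_left_mono) auto
  also have "\<dots> \<le> 8 * real (NlogN N)" using NlogN_ge(1)[OF assms] by simp
  finally show "NlogN (2 * N) \<le> 8 * NlogN N" by linarith
qed

lemma NlogN_1: "NlogN 1 = 1"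
  by (simp add: NlogN_def logm_def)

section \<open>The divergent series\<close>

text \<open>Cauchy condensation along a sequence with bounded quotients: the block from
  \<open>Y k\<close> to \<open>Y (Suc k)\<close> has at most \<open>C * Y k\<close> terms, each at
  most \<open>\<eta> (Y k)\<close>.\<close>

lemma not_summable_condensed:
  fixes \<eta> :: "nat \<Rightarrow> real" and Y :: "nat \<Rightarrow> nat"
  assumes anti: "\<And>M N. 1 \<le> M \<Longrightarrow> M \<le> N \<Longrightarrow> \<eta> N \<le> \<eta> M"
    and nonneg: "\<And>N. 1 \<le> N \<Longrightarrow> \<eta> N \<ge> 0"
    and Y: "Y 0 = 1" "\<And>k. Y k \<le> Y (Suc k)" "\<And>k. Y (Suc k) \<le> C * Y k" "\<And>k. k < Y k"
    and ns: "\<not> summable (\<lambda>N. \<eta> (Suc N))"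
  shows "\<not> summable (\<lambda>k. real (Y k) * \<eta> (Y k))"
proof
  assume sm: "summable (\<lambda>k. real (Y k) * \<eta> (Y k))"
  let ?s = "\<Sum>k. real (Y k) * \<eta> (Y k)"
  have Y1: "Y k \<ge> 1" for k using Y(4)[of k] by simp
  have part: "(\<Sum>n\<in>{1..<Y k}. \<eta> n) \<le> real C * (\<Sum>j<k. real (Y j) * \<eta> (Y j))" for k
  proof (induction k)
    case 0
    then show ?case using Y by simp
  next
    case (Suc k)
    have "(\<Sum>n\<in>{1..<Y (Suc k)}. \<eta> n) = (\<Sum>n\<in>{1..<Y k}. \<eta> n) + (\<Sum>n\<in>{Y k..<Y (Suc k)}. \<eta> n)"
      by (rule sum.atLeastLessThan_concat[symmetric]) (use Y1 Y in auto)
    moreover have "(\<Sum>n\<in>{Y k..<Y (Suc k)}. \<eta> n) \<le> real C * (real (Y k) * \<eta> (Y k))"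
    proof -
      have "(\<Sum>n\<in>{Y k..<Y (Suc k)}. \<eta> n) \<le> real (card {Y k..<Y (Suc k)}) * \<eta> (Y k)"
        by (rule sum_bounded_above) (use anti Y1 in auto)
      also have "\<dots> \<le> real (C * Y k) * \<eta> (Y k)"
        using Y(3)[of k] nonneg[OF Y1[of k]] by (intro mult_right_mono of_nat_mono) auto
      finally show ?thesis by (simp add: mult.assoc)
    qed
    ultimately show ?case using Suc by (simp add: distrib_left)
  qed
  have "summable (\<lambda>N. \<eta> (Suc N))"
  proof (rule bounded_imp_summable)
    show "0 \<le> \<eta> (Suc n)" for n using nonneg by simp
    show "(\<Sum>k\<le>n. \<eta> (Suc k)) \<le> real C * ?s" for n
    proof -
      have "(\<Sum>k\<le>n. \<eta> (Suc k)) = (\<Sum>k\<in>{1..Suc n}. \<eta> k)"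
        using sum.shift_bounds_cl_Suc_ivl[of \<eta> 0 n] by (simp add: atLeast0AtMost)
      also have "\<dots> \<le> (\<Sum>k\<in>{1..<Y (Suc n)}. \<eta> k)"
      proof (rule sum_mono2)
        show "{1..Suc n} \<subseteq> {1..<Y (Suc n)}" using Y(4)[of "Suc n"] by auto
        show "0 \<le> \<eta> b" if "b \<in> {1..<Y (Suc n)} - {1..Suc n}" for b using that nonneg by auto
      qed simp
      also have "\<dots> \<le> real C * (\<Sum>j<Suc n. real (Y j) * \<eta> (Y j))" by (rule part)
      also have "\<dots> \<le> real C * ?s"
        using sm nonneg Y1 by (intro mult_left_mono sum_le_suminf) auto
      finally show ?thesis .
    qed
  qed
  then show False using ns by simp
qed

text \<open>If \<alpha> is within \<open>\<eta> (Y k) / X k\<close> of b / d with d \<le>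
  \<open>X k\<close>, then d \<alpha> is within \<open>\<eta> (Y k)\<close> of b. So the limsup set
  of balls around fractions whose denominators are prime differences consists of approximable
  \<alpha>.\<close>

lemma approximable_full_measure:
  fixes \<eta> :: "nat \<Rightarrow> real"
  assumes anti: "\<And>M N. 1 \<le> M \<Longrightarrow> M \<le> N \<Longrightarrow> \<eta> N \<le> \<eta> M"
    and nonneg: "\<And>N. 1 \<le> N \<Longrightarrow> \<eta> N \<ge> 0"
    and ns: "\<not> summable (\<lambda>N. \<eta> (Suc N))"
  shows "{0..1} - {\<alpha>. infinite {N. 2 \<le> N \<and> delta_min \<alpha> N \<le> \<eta> (NlogN N)}} \<in> null_sets lebesgue"
proof -
  obtain K \<delta> c :: real where K: "K \<ge> 1" and \<delta>: "\<delta> > 0" and c: "c > 0"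
    and dens: "\<And>N. N \<ge> 4 \<Longrightarrow> real (card {d \<in> prime_diffs N. inv_totient_ratio d \<le> K \<and> real d \<ge> \<delta> * real (128 * NlogN N)}) \<ge> c * real (128 * NlogN N)"
    by (rule many_prime_diffs) blast
  define Y where "Y k = NlogN (2 ^ k)" for k :: nat
  define X where "X k = 128 * Y k" for k
  define S where "S k = {d \<in> prime_diffs (2 ^ k). inv_totient_ratio d \<le> K \<and> real d \<ge> \<delta> * real (X k)}" for k
  \<comment> \<open>The cap keeps \<open>r k * (X k)\<^sup>2\<close> at most 1/4, as the theorem on
    balls demands.\<close>
  define r where "r k = min (\<eta> (Y k) / real (X k)) (1 / (4 * (real (X k))\<^sup>2))" for k
  have Ygt: "k < Y k" for k
  proof -
    have "2 ^ k \<le> NlogN (2 ^ k)" by (rule NlogN_ge(2)) simp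
    then show ?thesis using less_exp[of k] unfolding Y_def by (rule order_less_le_trans[rotated])
  qed
  have Ypos: "Y k \<ge> 1" for k using Ygt[of k] by simp
  have Xpos: "real (X k) > 0" for k using Ypos[of k] unfolding X_def by simp
  have Ydbl: "2 * Y k \<le> Y (Suc k)" "Y (Suc k) \<le> 8 * Y k" for k
    using NlogN_double[of "2 ^ k"] unfolding Y_def by auto
  have finS: "finite (S k)" for k unfolding S_def using finite_prime_diffs by simp
  have S: "d > 0 \<and> d \<le> X k \<and> inv_totient_ratio d \<le> K \<and> real d \<ge> \<delta> * real (X k)" if "d \<in> S k" for d k
    using that prime_diffs_bounds[of d "2 ^ k"] unfolding S_def X_def Y_def by auto
  have r0: "r k \<ge> 0" for k unfolding r_def using nonneg[OF Ypos[of k]] by simp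
  have rX: "r k * (real (X k))\<^sup>2 = min (real (X k) * \<eta> (Y k)) (1 / 4)" for k
  proof -
    have "r k * (real (X k))\<^sup>2 = min (\<eta> (Y k) / real (X k) * (real (X k))\<^sup>2) (1 / (4 * (real (X k))\<^sup>2) * (real (X k))\<^sup>2)"
      unfolding r_def by (rule min_mult_distrib_right[THEN trans]) simp
    also have "\<eta> (Y k) / real (X k) * (real (X k))\<^sup>2 = real (X k) * \<eta> (Y k)"
      using Xpos[of k] by (simp add: power2_eq_square)
    also have "1 / (4 * (real (X k))\<^sup>2) * (real (X k))\<^sup>2 = 1 / 4" using Xpos[of k] by simp
    finally show ?thesis .
  qed
  have "{0..1} - {\<alpha>. \<exists>\<^sub>\<infinity>k. \<exists>a\<in>reduced_fractions (S k). \<bar>\<alpha> - a\<bar> \<le> r k} \<in> null_sets lebesgue"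
  proof (rule limsup_balls_full_measure[where X = "\<lambda>k. real (X k)" and c = "c * \<delta> / (2 * K)"])
    show "finite (reduced_fractions (S k))" for k by (rule finite_reduced_fractions[OF finS])
    show "2 * real (X k) \<le> real (X (Suc k))" for k using Ydbl(1)[of k] unfolding X_def by linarith
    show "r k * (real (X k))\<^sup>2 \<le> 1 / 4" for k unfolding rX by simp
    show "\<bar>a - b\<bar> \<ge> 1 / (real (X k))\<^sup>2" if "a \<in> reduced_fractions (S k)" "b \<in> reduced_fractions (S k)" "a \<noteq> b" for k a b
      by (rule reduced_fractions_separated[OF _ that]) (use S in auto)
    show "\<not> summable (\<lambda>k. r k * (real (X k))\<^sup>2)"
    proof
      \<comment> \<open>If the series converged, its terms would tend to 0 and the cap would be
        inactive from some point on. The terms would then be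
        \<open>128 * (Y k * \<eta> (Y k))\<close>, against condensation.\<close>
      assume sm: "summable (\<lambda>k. r k * (real (X k))\<^sup>2)"
      then have "(\<lambda>k. r k * (real (X k))\<^sup>2) \<longlonglongrightarrow> 0" by (rule summable_LIMSEQ_zero)
      then have "eventually (\<lambda>k. r k * (real (X k))\<^sup>2 < 1 / 4) sequentially" by (rule order_tendstoD) simp
      then have "eventually (\<lambda>k. r k * (real (X k))\<^sup>2 = 128 * (real (Y k) * \<eta> (Y k))) sequentially"
      proof eventually_elim
        case (elim k)
        then show ?case unfolding rX by (auto simp: min_def X_def split: if_splits)
      qed
      then have "summable (\<lambda>k. 128 * (real (Y k) * \<eta> (Y k)))" using sm by (simp add: summable_cong)
      then have "summable (\<lambda>k. real (Y k) * \<eta> (Y k))" by (simp add: summable_cmult_iff)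
      moreover have "\<not> summable (\<lambda>k. real (Y k) * \<eta> (Y k))"
      proof (rule not_summable_condensed[OF anti nonneg _ _ Ydbl(2) Ygt ns])
        show "Y 0 = 1" unfolding Y_def using NlogN_1 by simp
        show "Y k \<le> Y (Suc k)" for k using Ydbl(1)[of k] by simp
      qed
      ultimately show False by simp
    qed
    fix u v :: real assume uv: "0 \<le> u" "u < v" "v \<le> 1"
    \<comment> \<open>Since \<open>k < Y k\<close>, every \<open>k \<ge> n0\<close> makes
      \<open>X k\<close> large enough for counting fractions; the additional 2 gives
      \<open>4 \<le> 2 ^ k\<close>.\<close>
    define n0 where "n0 = nat \<lceil>(6 * K / ((v - u) * \<delta>))\<^sup>2\<rceil>"
    show "eventually (\<lambda>k. c * \<delta> / (2 * K) * (v - u) * (real (X k))\<^sup>2 \<le> real (card (reduced_fractions (S k) \<inter> {u..v}))) sequentially"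
    proof (rule eventually_sequentiallyI[of "n0 + 2"])
      fix k assume k: "n0 + 2 \<le> k"
      have "(4::nat) = 2 ^ 2" by simp
      also have "\<dots> \<le> 2 ^ k" using k by (intro power_increasing) auto
      finally have k4: "(4::nat) \<le> 2 ^ k" .
      show "c * \<delta> / (2 * K) * (v - u) * (real (X k))\<^sup>2 \<le> real (card (reduced_fractions (S k) \<inter> {u..v}))"
      proof (rule card_reduced_fractions_ge[OF uv K \<delta> S finS _ c])
        show "c * real (X k) \<le> real (card (S k))" using dens[OF k4] unfolding S_def X_def Y_def .
        show "1 \<le> X k" using Ypos[of k] unfolding X_def by simp
        have "(6 * K / ((v - u) * \<delta>))\<^sup>2 \<le> real n0" unfolding n0_def by (rule real_nat_ceiling_ge)
        also have "\<dots> \<le> real (X k)" using k Ygt[of k] unfolding X_def by simp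
        finally show "6 * K / ((v - u) * \<delta>) \<le> sqrt (real (X k))" by (rule real_le_rsqrt)
      qed
    qed
  qed (use r0 Xpos c \<delta> K in auto)
  then have neg: "negligible ({0..1} - {\<alpha>. \<exists>\<^sub>\<infinity>k. \<exists>a\<in>reduced_fractions (S k). \<bar>\<alpha> - a\<bar> \<le> r k})"
    by (simp only: negligible_iff_null_sets)
  have "\<alpha> \<in> {\<alpha>. infinite {N. 2 \<le> N \<and> delta_min \<alpha> N \<le> \<eta> (NlogN N)}}"
    if \<alpha>: "\<exists>\<^sub>\<infinity>k. \<exists>a\<in>reduced_fractions (S k). \<bar>\<alpha> - a\<bar> \<le> r k" for \<alpha>
  proof -
    have ok: "delta_min \<alpha> (2 ^ k) \<le> \<eta> (NlogN (2 ^ k))" if k: "k \<ge> 1" and a: "a \<in> reduced_fractions (S k)" "\<bar>\<alpha> - a\<bar> \<le> r k" for k a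
    proof -
      obtain d b where d: "d \<in> S k" "a = real_of_int b / real d" using a(1) unfolding reduced_fractions_def by auto
      have dpos: "real d > 0" "real d \<le> real (X k)" using S[OF d(1)] by auto
      have "dist_int (real d * \<alpha>) \<le> \<bar>real d * \<alpha> - real_of_int b\<bar>" by (rule dist_int_le)
      also have "real d * \<alpha> - real_of_int b = real d * (\<alpha> - a)" unfolding d(2) using dpos by (simp add: field_simps)
      also have "\<bar>real d * (\<alpha> - a)\<bar> = real d * \<bar>\<alpha> - a\<bar>" using dpos by (simp add: abs_mult)
      also have "\<dots> \<le> real (X k) * (\<eta> (Y k) / real (X k))"
        using dpos a(2) r0[of k] unfolding r_def by (intro mult_mono) auto
      also have "\<dots> = \<eta> (NlogN (2 ^ k))" using Xpos[of k] unfolding Y_def by simp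
      finally have "dist_int (real d * \<alpha>) \<le> \<eta> (NlogN (2 ^ k))" .
      moreover have "d \<in> prime_diffs (2 ^ k)" using d(1) unfolding S_def by simp
      moreover have "2 \<le> (2::nat) ^ k" using k self_le_power[of "2::nat" k] by simp
      ultimately show ?thesis using delta_min_le_iff by blast
    qed
    have "infinite {k. \<exists>a\<in>reduced_fractions (S k). \<bar>\<alpha> - a\<bar> \<le> r k}" using \<alpha> unfolding INFM_iff_infinite .
    \<comment> \<open>\<open>k = 0\<close> is removed because it corresponds to
      \<open>N = 1\<close>, for which there is no difference.\<close>
    then have "infinite ({k. \<exists>a\<in>reduced_fractions (S k). \<bar>\<alpha> - a\<bar> \<le> r k} - {0})" by simp
    then have "infinite ((\<lambda>k. (2::nat) ^ k) ` ({k. \<exists>a\<in>reduced_fractions (S k). \<bar>\<alpha> - a\<bar> \<le> r k} - {0}))"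
      by (subst finite_image_iff) (auto intro: inj_onI)
    moreover have "(\<lambda>k. (2::nat) ^ k) ` ({k. \<exists>a\<in>reduced_fractions (S k). \<bar>\<alpha> - a\<bar> \<le> r k} - {0}) \<subseteq> {N. 2 \<le> N \<and> delta_min \<alpha> N \<le> \<eta> (NlogN N)}"
    proof
      fix N assume "N \<in> (\<lambda>k. (2::nat) ^ k) ` ({k. \<exists>a\<in>reduced_fractions (S k). \<bar>\<alpha> - a\<bar> \<le> r k} - {0})"
      then obtain k where N: "N = 2 ^ k" and k0: "k \<in> {k. \<exists>a\<in>reduced_fractions (S k). \<bar>\<alpha> - a\<bar> \<le> r k} - {0}"
        by (elim imageE)
      from k0 obtain a where a: "a \<in> reduced_fractions (S k)" "\<bar>\<alpha> - a\<bar> \<le> r k" by blast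
      have k: "k \<ge> 1" using k0 by auto
      show "N \<in> {N. 2 \<le> N \<and> delta_min \<alpha> N \<le> \<eta> (NlogN N)}"
        using ok[OF k a] self_le_power[of "2::nat" k] k N by simp
    qed
    ultimately show ?thesis using infinite_super by blast
  qed
  then have "{0..1} - {\<alpha>. infinite {N. 2 \<le> N \<and> delta_min \<alpha> N \<le> \<eta> (NlogN N)}} \<subseteq> {0..1} - {\<alpha>. \<exists>\<^sub>\<infinity>k. \<exists>a\<in>reduced_fractions (S k). \<bar>\<alpha> - a\<bar> \<le> r k}"
    by blast
  \<comment> \<open>Completeness of Lebesgue measure supplies the measurability of the smaller
    set.\<close>
  then have "negligible ({0..1} - {\<alpha>. infinite {N. 2 \<le> N \<and> delta_min \<alpha> N \<le> \<eta> (NlogN N)}})"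
    using neg negligible_subset by blast
  then show ?thesis by (simp only: negligible_iff_null_sets)
qed


section \<open>The convergent series\<close>

text \<open>The \<alpha> in question lie in d + 1 intervals of length 2 \<epsilon>(d) / d, of total
  length at most 4 \<epsilon>(d), so Borel-Cantelli applies.\<close>

lemma limsup_dist_int_null:
  fixes \<epsilon> :: "nat \<Rightarrow> real"
  assumes nonneg: "\<And>d. \<epsilon> d \<ge> 0" and sm: "summable \<epsilon>"
  shows "{\<alpha> \<in> {0..1}. infinite {d. 1 \<le> d \<and> dist_int (real d * \<alpha>) \<le> \<epsilon> d}} \<in> null_sets lebesgue"
proof -
  define B where "B d = (\<Union>a\<in>{0..d}. {(real a - \<epsilon> d) / real d..(real a + \<epsilon> d) / real d})" for d :: nat
  have B_fm: "B d \<in> lmeasurable" for d unfolding B_def by (intro fmeasurable.finite_UN) auto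
  have B_meas: "measure lebesgue (B d) \<le> 4 * \<epsilon> d" for d
  proof (cases "d = 0")
    \<comment> \<open>Division by zero makes the only interval of \<open>B 0\<close> the single
      point 0.\<close>
    case True
    then show ?thesis using nonneg[of d] unfolding B_def by simp
  next
    case False
    have "measure lebesgue (B d) \<le> (\<Sum>a\<in>{0..d}. measure lebesgue {(real a - \<epsilon> d) / real d..(real a + \<epsilon> d) / real d})"
      unfolding B_def by (rule measure_UNION_le) auto
    also have "\<dots> = (\<Sum>a\<in>{0..d}. 2 * \<epsilon> d / real d)"
    proof (rule sum.cong[OF refl])
      fix a
      have "(real a - \<epsilon> d) / real d \<le> (real a + \<epsilon> d) / real d" using nonneg[of d] by (intro divide_right_mono) auto
      then show "measure lebesgue {(real a - \<epsilon> d) / real d..(real a + \<epsilon> d) / real d} = 2 * \<epsilon> d / real d"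
        by (simp add: diff_divide_distrib[symmetric])
    qed
    also have "\<dots> = (real d + 1) * (2 * \<epsilon> d / real d)" by simp
    also have "\<dots> \<le> (2 * real d) * (2 * \<epsilon> d / real d)"
      using False nonneg[of d] by (intro mult_right_mono) auto
    also have "\<dots> = 4 * \<epsilon> d" using False by simp
    finally show ?thesis .
  qed
  have "limsup B \<in> null_sets lebesgue"
  proof (rule borel_cantelli_limsup1)
    show "B n \<in> sets lebesgue" for n using B_fm by (rule fmeasurableD)
    show "emeasure lebesgue (B n) < \<infinity>" for n using B_fm[of n] by (auto simp: fmeasurable_def)
    show "summable (\<lambda>n. measure lebesgue (B n))"
      by (rule summable_comparison_test'[OF summable_mult[OF sm, of 4], of 0]) (use B_meas in auto)
  qed
  then have "negligible (limsup B)" by (simp only: negligible_iff_null_sets)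
  moreover have "{\<alpha> \<in> {0..1}. infinite {d. 1 \<le> d \<and> dist_int (real d * \<alpha>) \<le> \<epsilon> d}} \<subseteq> limsup B"
  proof
    fix \<alpha> assume \<alpha>: "\<alpha> \<in> {\<alpha> \<in> {0..1}. infinite {d. 1 \<le> d \<and> dist_int (real d * \<alpha>) \<le> \<epsilon> d}}"
    have in_B: "\<alpha> \<in> B d" if d: "1 \<le> d" "dist_int (real d * \<alpha>) \<le> \<epsilon> d" for d
    proof -
      define a where "a = nat (round (real d * \<alpha>))"
      have "round (0::real) \<le> round (real d * \<alpha>)" "round (real d * \<alpha>) \<le> round (real d)"
        using \<alpha> by (intro round_mono; simp add: mult_left_le)+
      then have r: "0 \<le> round (real d * \<alpha>)" "round (real d * \<alpha>) \<le> int d" by simp_all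
      then have a: "real a = real_of_int (round (real d * \<alpha>))" "a \<le> d" unfolding a_def by auto
      have "\<bar>real d * \<alpha> - real a\<bar> \<le> \<epsilon> d" using d(2) unfolding dist_int_def a(1) .
      then have "(real a - \<epsilon> d) / real d \<le> \<alpha>" "\<alpha> \<le> (real a + \<epsilon> d) / real d"
        using d(1) by (auto simp: field_simps abs_le_iff)
      then show ?thesis unfolding B_def using a(2) by auto
    qed
    have "\<exists>d\<ge>n. \<alpha> \<in> B d" for n
    proof -
      have "infinite {d. 1 \<le> d \<and> dist_int (real d * \<alpha>) \<le> \<epsilon> d}" using \<alpha> by simp
      then obtain d where "d > n" "d \<in> {d. 1 \<le> d \<and> dist_int (real d * \<alpha>) \<le> \<epsilon> d}"
        unfolding infinite_nat_iff_unbounded by blast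
      then show ?thesis using in_B[of d] by (intro exI[of _ d]) auto
    qed
    then show "\<alpha> \<in> limsup B" by (auto simp: limsup_INF_SUP)
  qed
  ultimately have "negligible {\<alpha> \<in> {0..1}. infinite {d. 1 \<le> d \<and> dist_int (real d * \<alpha>) \<le> \<epsilon> d}}"
    using negligible_subset by blast
  then show ?thesis by (simp only: negligible_iff_null_sets)
qed

text \<open>A difference \<open>d\<close> of the first \<open>N\<close> primes is at most
  \<open>2 ^ 7 * NlogN N\<close>, so seven doublings bound \<open>\<eta> (NlogN N)\<close> by
  \<open>\<eta> d / c0 ^ 7\<close>, which depends on \<open>d\<close> alone. It remains to pass from
  infinitely many \<open>N\<close> to infinitely many \<open>d\<close>.\<close>

lemma approximable_null:
  fixes \<eta> :: "nat \<Rightarrow> real" and c0 :: real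
  assumes anti: "\<And>M N. 1 \<le> M \<Longrightarrow> M \<le> N \<Longrightarrow> \<eta> N \<le> \<eta> M"
    and nonneg: "\<And>N. 1 \<le> N \<Longrightarrow> \<eta> N \<ge> 0"
    and c0: "c0 > 0"
    and doubling: "\<And>N. 1 \<le> N \<Longrightarrow> c0 * \<eta> N \<le> \<eta> (2 * N)"
    and sm: "summable (\<lambda>N. \<eta> (Suc N))"
  shows "{\<alpha> \<in> {0..1}. infinite {N. 2 \<le> N \<and> delta_min \<alpha> N \<le> \<eta> (NlogN N)}} \<in> null_sets lebesgue"
proof -
  \<comment> \<open>\<open>\<eta> 0\<close> is unconstrained, hence the separate value at 0.\<close>
  define \<epsilon> where "\<epsilon> d = (if d = 0 then 0 else \<eta> d / c0 ^ 7)" for d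
  have \<epsilon>0: "\<epsilon> d \<ge> 0" for d unfolding \<epsilon>_def using nonneg[of d] c0 by auto
  have \<epsilon>_sm: "summable \<epsilon>"
  proof -
    have "summable (\<lambda>d. \<epsilon> (Suc d))" unfolding \<epsilon>_def using summable_divide[OF sm, of "c0 ^ 7"] by simp
    then show ?thesis by (simp only: summable_Suc_iff)
  qed
  have dbl: "c0 ^ k * \<eta> N \<le> \<eta> (2 ^ k * N)" if N: "1 \<le> N" for k N
  proof (induction k)
    case (Suc k)
    have "c0 ^ Suc k * \<eta> N \<le> c0 * \<eta> (2 ^ k * N)" using mult_left_mono[OF Suc, of c0] c0 by (simp add: mult.assoc)
    also have "\<dots> \<le> \<eta> (2 * (2 ^ k * N))" using N by (intro doubling) simp
    finally show ?case by (simp add: mult.assoc)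
  qed simp
  have key: "\<eta> (NlogN N) \<le> \<epsilon> d" if N: "N \<ge> 1" and d: "d \<in> prime_diffs N" for N d
  proof -
    have d': "d > 0" "d \<le> 128 * NlogN N" using prime_diffs_bounds[OF d] by auto
    have "c0 ^ 7 * \<eta> (NlogN N) \<le> \<eta> (2 ^ 7 * NlogN N)" using NlogN_ge(2)[OF N] N by (intro dbl) linarith
    also have "\<dots> \<le> \<eta> d" using d' by (intro anti) auto
    finally show ?thesis unfolding \<epsilon>_def using d' c0 by (simp add: pos_le_divide_eq mult.commute)
  qed
  have "{\<alpha> \<in> {0..1}. infinite {N. 2 \<le> N \<and> delta_min \<alpha> N \<le> \<eta> (NlogN N)}}
      \<subseteq> {\<alpha> \<in> {0..1}. infinite {d. 1 \<le> d \<and> dist_int (real d * \<alpha>) \<le> \<epsilon> d}} \<union> \<rat>"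
  proof
    fix \<alpha> assume \<alpha>: "\<alpha> \<in> {\<alpha> \<in> {0..1}. infinite {N. 2 \<le> N \<and> delta_min \<alpha> N \<le> \<eta> (NlogN N)}}"
    let ?D = "{d. 1 \<le> d \<and> dist_int (real d * \<alpha>) \<le> \<epsilon> d}"
    have "infinite ?D" if irr: "\<alpha> \<notin> \<rat>"
    proof
      assume fin: "finite ?D"
      have pos: "dist_int (real d * \<alpha>) > 0" if "d \<ge> 1" for d
      proof (rule ccontr)
        assume "\<not> dist_int (real d * \<alpha>) > 0"
        then have "real d * \<alpha> = real_of_int (round (real d * \<alpha>))" unfolding dist_int_def by simp
        then have "\<alpha> = real_of_int (round (real d * \<alpha>)) / real d" using that by (simp add: field_simps)
        then show False using irr by (metis Rats_divide Rats_of_int Rats_of_nat)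
      qed
      \<comment> \<open>For irrational \<alpha> finitely many \<open>d\<close> keep d \<alpha> at a
        positive distance from the integers, while \<eta> tends to 0, so they cannot serve
        infinitely many \<open>N\<close>. The inserted 1 covers an empty \<open>?D\<close>.\<close>
      define \<mu> where "\<mu> = Min (insert 1 ((\<lambda>d. dist_int (real d * \<alpha>)) ` ?D))"
      have \<mu>0: "\<mu> > 0" unfolding \<mu>_def using fin pos by (subst Min_gr_iff) auto
      have \<mu>_le: "\<mu> \<le> dist_int (real d * \<alpha>)" if "d \<in> ?D" for d
        unfolding \<mu>_def using fin that by (intro Min_le) auto
      have "(\<lambda>N. \<eta> (Suc N)) \<longlonglongrightarrow> 0" using sm by (rule summable_LIMSEQ_zero)
      then have "eventually (\<lambda>N. \<eta> (Suc N) < \<mu>) sequentially" using \<mu>0 by (rule order_tendstoD)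
      then obtain n0 where n0: "\<And>n. n \<ge> n0 \<Longrightarrow> \<eta> (Suc n) < \<mu>" unfolding eventually_sequentially by blast
      have "infinite {N. 2 \<le> N \<and> delta_min \<alpha> N \<le> \<eta> (NlogN N)}" using \<alpha> by simp
      then obtain N where N: "N > Suc n0" "N \<in> {N. 2 \<le> N \<and> delta_min \<alpha> N \<le> \<eta> (NlogN N)}"
        unfolding infinite_nat_iff_unbounded by blast
      then obtain d where d: "d \<in> prime_diffs N" "dist_int (real d * \<alpha>) \<le> \<eta> (NlogN N)"
        using delta_min_le_iff[of N \<alpha> "\<eta> (NlogN N)"] by auto
      have "\<eta> (NlogN N) \<le> \<epsilon> d" using N d by (intro key) auto
      then have "d \<in> ?D" using d prime_diffs_bounds(1)[OF d(1)] by auto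
      then have "\<mu> \<le> \<eta> (NlogN N)" using \<mu>_le[of d] d(2) by linarith
      also have "\<dots> \<le> \<eta> (Suc (N - 1))" using N NlogN_ge(2)[of N] by (intro anti) auto
      also have "\<dots> < \<mu>" using N by (intro n0) auto
      finally show False by simp
    qed
    then show "\<alpha> \<in> {\<alpha> \<in> {0..1}. infinite {d. 1 \<le> d \<and> dist_int (real d * \<alpha>) \<le> \<epsilon> d}} \<union> \<rat>" using \<alpha> by blast
  qed
  moreover have "negligible ({\<alpha> \<in> {0..1}. infinite {d. 1 \<le> d \<and> dist_int (real d * \<alpha>) \<le> \<epsilon> d}} \<union> \<rat>)"
    unfolding negligible_iff_null_sets
    by (intro null_sets.Un limsup_dist_int_null[OF \<epsilon>0 \<epsilon>_sm] null_sets_completionI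
      countable_imp_null_set_lborel countable_rat)
  ultimately have "negligible {\<alpha> \<in> {0..1}. infinite {N. 2 \<le> N \<and> delta_min \<alpha> N \<le> \<eta> (NlogN N)}}"
    using negligible_subset by blast
  then show ?thesis by (simp only: negligible_iff_null_sets)
qed

text \<open>The series runs over \<open>\<eta> (Suc N)\<close> because it starts at index 1 and
  \<open>\<eta> 0\<close> is unconstrained; \<open>2 \<le> N\<close> avoids a minimum over an empty
  set.\<close>

theorem theorem4:
  fixes \<eta> :: "nat \<Rightarrow> real" and c0 :: real
  assumes decr: "\<And>M N. 1 \<le> M \<Longrightarrow> M < N \<Longrightarrow> \<eta> N < \<eta> M"
    and nonneg: "\<And>N. 1 \<le> N \<Longrightarrow> \<eta> N \<ge> 0"
    and c0_pos: "c0 > 0"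
    and doubling: "\<And>N. 1 \<le> N \<Longrightarrow> \<eta> (2 * N) / \<eta> N \<ge> c0"
  defines "A \<equiv> {\<alpha> \<in> {0..1::real}.
      infinite {N::nat. 2 \<le> N \<and> delta_min \<alpha> N \<le> \<eta> (nat \<lfloor>real N * logm (real N)\<rfloor>)}}"
  shows "(summable (\<lambda>N. \<eta> (Suc N)) \<longrightarrow> A \<in> null_sets lebesgue)
       \<and> (\<not> summable (\<lambda>N. \<eta> (Suc N)) \<longrightarrow> A \<in> sets lebesgue \<and> measure lebesgue A = 1)"
proof (intro conjI impI)
  have A: "A = {\<alpha> \<in> {0..1}. infinite {N. 2 \<le> N \<and> delta_min \<alpha> N \<le> \<eta> (NlogN N)}}"
    unfolding A_def NlogN_def ..
  have anti: "\<eta> N \<le> \<eta> M" if "1 \<le> M" "M \<le> N" for M N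
    using decr[of M N] that by (cases "M = N") auto
  have dbl: "c0 * \<eta> N \<le> \<eta> (2 * N)" if "1 \<le> N" for N
  proof -
    \<comment> \<open>Strict decrease and nonnegativity of the next term give positivity, so the
      quotient in \<open>doubling\<close> is a genuine one.\<close>
    have "\<eta> N > 0" using decr[of N "Suc N"] nonneg[of "Suc N"] that by simp
    then show ?thesis using doubling[OF that] by (simp add: pos_le_divide_eq)
  qed
  show "A \<in> null_sets lebesgue" if "summable (\<lambda>N. \<eta> (Suc N))"
    unfolding A by (rule approximable_null[OF anti nonneg c0_pos dbl that])
  assume "\<not> summable (\<lambda>N. \<eta> (Suc N))"
  from approximable_full_measure[OF anti nonneg this]
  moreover have "{0..1} - {\<alpha>. infinite {N. 2 \<le> N \<and> delta_min \<alpha> N \<le> \<eta> (NlogN N)}} = {0..1} - A"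
    unfolding A by blast
  ultimately have null: "{0..1} - A \<in> null_sets lebesgue" by (simp only:)
  \<comment> \<open>The null complement yields both the measurability of \<open>A\<close> and its
    measure.\<close>
  have A_eq: "A = {0..1} - ({0..1} - A)" unfolding A_def by auto
  show "A \<in> sets lebesgue" by (subst A_eq) (use null in auto)
  have "measure lebesgue ({0..1} - ({0..1} - A)) = measure lebesgue {0..1::real}"
    by (rule measure_Diff_null_set) (use null in auto)
  then show "measure lebesgue A = 1" using A_eq by simp
qed

end
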